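(* Given a restriction species $R$, the corresponding simplicial groupoid $\mathbf{R}$ is a decomposition space, and the cardinality of the associated incidence coalgebra is the Schmitt coalgebra of $R$. A morphism of restriction species $R\Rightarrow R'$ induces a conservative ULF functor $\mathbf{R}\to\mathbf{R}'$, whose cardinality is the coalgebra homomorphism resulting from the Schmitt construction.
   Context: Restriction species. Let $\mathbb{I}$ be the category of finite sets and injections. A restriction species is a functor $R:\mathbb{I}^{\mathrm{op}}\to\mathbf{Set}$; for $A\subset S$ and $X\in R[S]$ write $X|A\in R[A]$ for the restriction. A morphism of restriction species is a natural transformation. The Schmitt coalgebra of $R$ is the $\mathbb{Q}$-vector space spanned by isomorphism classes of $R$-structures (pairs $(S,X)$ with $X\in R[S]$, isomorphisms being bijections of underlying sets compatible with the structures), with comultiplication $\Delta(X)=\sum_{A+B=S}X|A\otimes X|B$ for $X\in R[S]$ (sum over all ordered pairs of complementary subsets $A,B$ of $S$) and with counit sending structures on the empty set to $1$ and all others to $0$. A morphism of restriction species induces a coalgebra homomorphism by applying it to structures. The simplicial groupoid $\mathbf{R}$. $\mathbf{R}_k$ is the groupoid of $R$-structures $(S,X)$ equipped with an arbitrary map $S\to\underline{k}=\{1,\dots,k\}$, i.e. an ordered partition of $S$ into $k$ possibly empty parts; morphisms are isomorphisms of $R$-structures compatible with the partitions. Inner face maps join two adjacent parts, degeneracy maps insert an empty part, and the outer face maps $d_\bot$ (resp. $d_\top$) delete the first (resp. last) part and restrict the $R$-structure to the union of the remaining parts. Decomposition spaces. $\mathbf{Grpd}$ is the $\infty$-category of $\infty$-groupoids,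 with homotopy pullbacks. In $\Delta$, a map is generic if it preserves end-points and free if $f(i+1)=f(i)+1$ for all $i$; these admit pushouts along each other. A decomposition space is $X:\Delta^{\mathrm{op}}\to\mathbf{Grpd}$ sending all pushouts of generic maps along free maps to pullbacks. A simplicial map is ULF (resp. conservative) if its naturality squares on inner face maps (resp. degeneracy maps) are pullbacks. Incidence coalgebra and cardinality. The incidence coalgebra of $X$ is $\mathbf{Grpd}_{/X_1}$ with comultiplication given by the span $X_1\xleftarrow{d_1}X_2\xrightarrow{(d_2,d_0)}X_1\times X_1$ and counit by $X_1\xleftarrow{s_0}X_0\to1$ (pull back along the left leg, postcompose with the right leg). When $X_1$ has finite automorphism groups and $d_1$, $s_0$ have finite fibres, its cardinality is the $\mathbb{Q}$-vector space with basis $\{\delta_f\}_{f\in\pi_0X_1}$, comultiplication $\delta_f\mapsto\sum_{a,b}|(X_1)_{[a]}||(X_1)_{[b]}||(X_2)_{f,a,b}|\,\delta_a\otimes\delta_b$ and counit $\delta_f\mapsto|(X_0)_f|$, where $|\cdot|$ is homotopy (groupoid) cardinality, $(X_1)_{[a]}$ is the component of $a$, and $(X_2)_{f,a,b}$, $(X_0)_f$ are the homotopy fibres of $(d_1,d_2,d_0):X_2\to X_1^3$ over $(f,a,b)$ and of $s_0$ over $f$. A conservative ULF map $F$ induces on cardinality the coalgebra homomorphism $\delta_f\mapsto\delta_{F(f)}$. *)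

theory Defs
  imports Complex_Main "HOL-Library.FuncSet" "HOL-Library.Infinite_Typeclass"
begin

section \<open>Groupoids and homotopy pullbacks\<close>

text \<open>
  Hom-sets need not be disjoint, so composition and the action of a functor on arrows carry their
  end-points as arguments: \<open>cmp G x y z g f\<close> is the composite of \<open>f : x \<rightarrow> y\<close> and \<open>g : y \<rightarrow> z\<close>.
\<close>

record ('o, 'm) category =
  ob  :: "'o set"
  hom :: "'o \<Rightarrow> 'o \<Rightarrow> 'm set"
  ide :: "'o \<Rightarrow> 'm"
  cmp :: "'o \<Rightarrow> 'o \<Rightarrow> 'o \<Rightarrow> 'm \<Rightarrow> 'm \<Rightarrow> 'm"

locale groupoid =
  fixes G :: "('o, 'm) category"
  assumes ide_closed: "x \<in> ob G \<Longrightarrow> ide G x \<in> hom G x x"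
    and cmp_closed: "\<lbrakk>x \<in> ob G; y \<in> ob G; z \<in> ob G; f \<in> hom G x y; g \<in> hom G y z\<rbrakk>
      \<Longrightarrow> cmp G x y z g f \<in> hom G x z"
    and ide_right: "\<lbrakk>x \<in> ob G; y \<in> ob G; f \<in> hom G x y\<rbrakk> \<Longrightarrow> cmp G x x y f (ide G x) = f"
    and ide_left: "\<lbrakk>x \<in> ob G; y \<in> ob G; f \<in> hom G x y\<rbrakk> \<Longrightarrow> cmp G x y y (ide G y) f = f"
    and cmp_assoc: "\<lbrakk>w \<in> ob G; x \<in> ob G; y \<in> ob G; z \<in> ob G;
        f \<in> hom G w x; g \<in> hom G x y; h \<in> hom G y z\<rbrakk>
      \<Longrightarrow> cmp G w x z (cmp G x y z h g) f = cmp G w y z h (cmp G w x y g f)"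
    and inverse: "\<lbrakk>x \<in> ob G; y \<in> ob G; f \<in> hom G x y\<rbrakk>
      \<Longrightarrow> \<exists>g \<in> hom G y x. cmp G x y x g f = ide G x \<and> cmp G y x y f g = ide G y"

record ('o, 'm, 'p, 'q) fctr =
  on_ob  :: "'o \<Rightarrow> 'p"
  on_hom :: "'o \<Rightarrow> 'o \<Rightarrow> 'm \<Rightarrow> 'q"

locale groupoid_functor = dom: groupoid G + cod: groupoid H
  for G :: "('o, 'm) category" and H :: "('p, 'q) category" +
  fixes F :: "('o, 'm, 'p, 'q) fctr"
  assumes on_ob_closed: "x \<in> ob G \<Longrightarrow> on_ob F x \<in> ob H"
    and on_hom_closed: "\<lbrakk>x \<in> ob G; y \<in> ob G; f \<in> hom G x y\<rbrakk>
      \<Longrightarrow> on_hom F x y f \<in> hom H (on_ob F x) (on_ob F y)"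
    and on_hom_ide: "x \<in> ob G \<Longrightarrow> on_hom F x x (ide G x) = ide H (on_ob F x)"
    and on_hom_cmp: "\<lbrakk>x \<in> ob G; y \<in> ob G; z \<in> ob G; f \<in> hom G x y; g \<in> hom G y z\<rbrakk>
      \<Longrightarrow> on_hom F x z (cmp G x y z g f) =
          cmp H (on_ob F x) (on_ob F y) (on_ob F z) (on_hom F y z g) (on_hom F x y f)"

definition fctr_eq ::
  "('o, 'm) category \<Rightarrow> ('o, 'm, 'p, 'q) fctr \<Rightarrow> ('o, 'm, 'p, 'q) fctr \<Rightarrow> bool" where
  "fctr_eq G F F' \<longleftrightarrow> (\<forall>x \<in> ob G. on_ob F x = on_ob F' x) \<and>
     (\<forall>x \<in> ob G. \<forall>y \<in> ob G. \<forall>f \<in> hom G x y. on_hom F x y f = on_hom F' x y f)"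

definition fctr_id :: "('o, 'm, 'o, 'm) fctr" where
  "fctr_id = \<lparr>on_ob = (\<lambda>x. x), on_hom = (\<lambda>x y f. f)\<rparr>"

definition fctr_comp ::
  "('p, 'q, 's, 't) fctr \<Rightarrow> ('o, 'm, 'p, 'q) fctr \<Rightarrow> ('o, 'm, 's, 't) fctr" where
  "fctr_comp F' F = \<lparr>on_ob = (\<lambda>x. on_ob F' (on_ob F x)),
     on_hom = (\<lambda>x y f. on_hom F' (on_ob F x) (on_ob F y) (on_hom F x y f))\<rparr>"

definition equivalence ::
  "('o, 'm) category \<Rightarrow> ('p, 'q) category \<Rightarrow> ('o, 'm, 'p, 'q) fctr \<Rightarrow> bool" where
  "equivalence G H F \<longleftrightarrow> groupoid_functor G H F \<and>
     (\<forall>x \<in> ob G. \<forall>y \<in> ob G. bij_betw (on_hom F x y) (hom G x y) (hom H (on_ob F x) (on_ob F y))) \<and>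
     (\<forall>z \<in> ob H. \<exists>x \<in> ob G. hom H (on_ob F x) z \<noteq> {})"

text \<open>
  The standard model of the homotopy pullback of \<open>f : A \<rightarrow> C \<leftarrow> B : g\<close>: objects are triples
  \<open>(x, y, \<gamma> : f x \<rightarrow> g y)\<close>.
\<close>

definition iso_comma ::
  "('a, 'b) category \<Rightarrow> ('c, 'd) category \<Rightarrow> ('e, 'f) category \<Rightarrow>
   ('a, 'b, 'e, 'f) fctr \<Rightarrow> ('c, 'd, 'e, 'f) fctr \<Rightarrow> ('a \<times> 'c \<times> 'f, 'b \<times> 'd) category" where
  "iso_comma A B C f g = \<lparr>
     ob = {(x, y, \<gamma>). x \<in> ob A \<and> y \<in> ob B \<and> \<gamma> \<in> hom C (on_ob f x) (on_ob g y)},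
     hom = (\<lambda>(x, y, \<gamma>) (x', y', \<gamma>'). {(m, n). m \<in> hom A x x' \<and> n \<in> hom B y y' \<and>
       cmp C (on_ob f x) (on_ob f x') (on_ob g y') \<gamma>' (on_hom f x x' m) =
       cmp C (on_ob f x) (on_ob g y) (on_ob g y') (on_hom g y y' n) \<gamma>}),
     ide = (\<lambda>(x, y, \<gamma>). (ide A x, ide B y)),
     cmp = (\<lambda>(x, y, \<gamma>) (x', y', \<gamma>') (x'', y'', \<gamma>'') (m', n') (m, n).
       (cmp A x x' x'' m' m, cmp B y y' y'' n' n))\<rparr>"

text \<open>
  \<open>homotopy_pullback P A B C a b f g\<close>: the square with \<open>a : P \<rightarrow> A\<close>, \<open>b : P \<rightarrow> B\<close>, \<open>f : A \<rightarrow> C\<close>,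
  \<open>g : B \<rightarrow> C\<close> commutes strictly and the comparison \<open>p \<mapsto> (a p, b p, id)\<close> is an equivalence.
\<close>

definition homotopy_pullback ::
  "('p, 'q) category \<Rightarrow> ('a, 'b) category \<Rightarrow> ('c, 'd) category \<Rightarrow> ('e, 'f) category \<Rightarrow>
   ('p, 'q, 'a, 'b) fctr \<Rightarrow> ('p, 'q, 'c, 'd) fctr \<Rightarrow>
   ('a, 'b, 'e, 'f) fctr \<Rightarrow> ('c, 'd, 'e, 'f) fctr \<Rightarrow> bool" where
  "homotopy_pullback P A B C a b f g \<longleftrightarrow>
     groupoid_functor P A a \<and> groupoid_functor P B b \<and>
     groupoid_functor A C f \<and> groupoid_functor B C g \<and>
     fctr_eq P (fctr_comp f a) (fctr_comp g b) \<and>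
     equivalence P (iso_comma A B C f g)
       \<lparr>on_ob = (\<lambda>p. (on_ob a p, on_ob b p, ide C (on_ob f (on_ob a p)))),
        on_hom = (\<lambda>p p' m. (on_hom a p p' m, on_hom b p p' m))\<rparr>"

definition homotopy_fibre ::
  "('o, 'm) category \<Rightarrow> ('p, 'q) category \<Rightarrow> ('o, 'm, 'p, 'q) fctr \<Rightarrow> 'p \<Rightarrow>
   ('o \<times> 'q, 'm) category" where
  "homotopy_fibre G H F y = \<lparr>
     ob = {(x, \<gamma>). x \<in> ob G \<and> \<gamma> \<in> hom H (on_ob F x) y},
     hom = (\<lambda>(x, \<gamma>) (x', \<gamma>'). {m \<in> hom G x x'.
       cmp H (on_ob F x) (on_ob F x') y \<gamma>' (on_hom F x x' m) = \<gamma>}),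
     ide = (\<lambda>(x, \<gamma>). ide G x),
     cmp = (\<lambda>(x, \<gamma>) (x', \<gamma>') (x'', \<gamma>''). cmp G x x' x'')\<rparr>"

definition prod_category ::
  "('o, 'm) category \<Rightarrow> ('p, 'q) category \<Rightarrow> ('o \<times> 'p, 'm \<times> 'q) category" where
  "prod_category G H = \<lparr>
     ob = ob G \<times> ob H,
     hom = (\<lambda>(x, y) (x', y'). hom G x x' \<times> hom H y y'),
     ide = (\<lambda>(x, y). (ide G x, ide H y)),
     cmp = (\<lambda>(x, y) (x', y') (x'', y'') (m', n') (m, n).
       (cmp G x x' x'' m' m, cmp H y y' y'' n' n))\<rparr>"

definition fctr_pair ::
  "('o, 'm, 'p, 'q) fctr \<Rightarrow> ('o, 'm, 's, 't) fctr \<Rightarrow> ('o, 'm, 'p \<times> 's, 'q \<times> 't) fctr" where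
  "fctr_pair F F' = \<lparr>on_ob = (\<lambda>x. (on_ob F x, on_ob F' x)),
     on_hom = (\<lambda>x y f. (on_hom F x y f, on_hom F' x y f))\<rparr>"


section \<open>Homotopy cardinality\<close>

definition iso_rel :: "('o, 'm) category \<Rightarrow> ('o \<times> 'o) set" where
  "iso_rel G = {(x, y). x \<in> ob G \<and> y \<in> ob G \<and> hom G x y \<noteq> {}}"

definition pi0 :: "('o, 'm) category \<Rightarrow> 'o set set" where
  "pi0 G = ob G // iso_rel G"

definition rep :: "'o set \<Rightarrow> 'o" where
  "rep c = (SOME x. x \<in> c)"

text \<open>The component of \<open>H\<close> containing the image of the component \<open>c\<close> under \<open>F\<close>.\<close>

definition pi0_map ::
  "('p, 'q) category \<Rightarrow> ('o, 'm, 'p, 'q) fctr \<Rightarrow> 'o set \<Rightarrow> 'p set" where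
  "pi0_map H F c = iso_rel H `` (on_ob F ` c)"

definition component :: "('o, 'm) category \<Rightarrow> 'o set \<Rightarrow> ('o, 'm) category" where
  "component G c = G\<lparr>ob := c\<rparr>"

definition finite_groupoid :: "('o, 'm) category \<Rightarrow> bool" where
  "finite_groupoid G \<longleftrightarrow> finite (pi0 G) \<and> (\<forall>x \<in> ob G. finite (hom G x x))"

definition groupoid_card :: "('o, 'm) category \<Rightarrow> rat" where
  "groupoid_card G = (\<Sum>c \<in> pi0 G. 1 / of_nat (card (hom G (rep c) (rep c))))"


section \<open>Simplicial groupoids and decomposition spaces\<close>

text \<open>Monotone maps \<open>[m] \<rightarrow> [n]\<close>, where \<open>[n] = {0, \<dots>, n}\<close>.\<close>

definition Delta :: "nat \<Rightarrow> nat \<Rightarrow> (nat \<Rightarrow> nat) set" where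
  "Delta m n = {\<phi> \<in> {..m} \<rightarrow>\<^sub>E {..n}. mono_on {..m} \<phi>}"

definition generic :: "nat \<Rightarrow> nat \<Rightarrow> (nat \<Rightarrow> nat) \<Rightarrow> bool" where
  "generic m n \<phi> \<longleftrightarrow> \<phi> 0 = 0 \<and> \<phi> m = n"

definition free :: "nat \<Rightarrow> (nat \<Rightarrow> nat) \<Rightarrow> bool" where
  "free m \<phi> \<longleftrightarrow> (\<forall>i < m. \<phi> (i + 1) = \<phi> i + 1)"

text \<open>The square \<open>g : [k] \<rightarrow> [m]\<close>, \<open>f : [k] \<rightarrow> [n]\<close>, \<open>f' : [m] \<rightarrow> [p]\<close>, \<open>g' : [n] \<rightarrow> [p]\<close> is a pushout.\<close>

definition pushout_Delta ::
  "nat \<Rightarrow> nat \<Rightarrow> nat \<Rightarrow> nat \<Rightarrow> (nat \<Rightarrow> nat) \<Rightarrow> (nat \<Rightarrow> nat) \<Rightarrow> (nat \<Rightarrow> nat) \<Rightarrow> (nat \<Rightarrow> nat) \<Rightarrow> bool"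
where
  "pushout_Delta k m n p g f f' g' \<longleftrightarrow>
     g \<in> Delta k m \<and> f \<in> Delta k n \<and> f' \<in> Delta m p \<and> g' \<in> Delta n p \<and>
     compose {..k} f' g = compose {..k} g' f \<and>
     (\<forall>q. \<forall>u \<in> Delta m q. \<forall>v \<in> Delta n q. compose {..k} u g = compose {..k} v f \<longrightarrow>
       (\<exists>!w. w \<in> Delta p q \<and> compose {..m} w f' = u \<and> compose {..n} w g' = v))"

text \<open>For \<open>\<phi> : [m] \<rightarrow> [n]\<close>, the functor \<open>act X m n \<phi>\<close> goes from \<open>level X n\<close> to \<open>level X m\<close>.\<close>

record ('o, 'm) simplicial =
  level :: "nat \<Rightarrow> ('o, 'm) category"
  act :: "nat \<Rightarrow> nat \<Rightarrow> (nat \<Rightarrow> nat) \<Rightarrow> ('o, 'm, 'o, 'm) fctr"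

locale simplicial_groupoid =
  fixes X :: "('o, 'm) simplicial"
  assumes level_groupoid: "groupoid (level X n)"
    and act_functor: "\<phi> \<in> Delta m n \<Longrightarrow> groupoid_functor (level X n) (level X m) (act X m n \<phi>)"
    and act_id: "fctr_eq (level X n) (act X n n (\<lambda>i\<in>{..n}. i)) fctr_id"
    and act_comp: "\<lbrakk>\<phi> \<in> Delta l m; \<psi> \<in> Delta m n\<rbrakk> \<Longrightarrow>
      fctr_eq (level X n) (act X l n (compose {..l} \<psi> \<phi>)) (fctr_comp (act X l m \<phi>) (act X m n \<psi>))"

locale decomposition_space = simplicial_groupoid X for X :: "('o, 'm) simplicial" +
  assumes pushout_to_pullback:
    "\<lbrakk>generic k m g; free k f; pushout_Delta k m n p g f f' g'\<rbrakk> \<Longrightarrow>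
      homotopy_pullback (level X p) (level X m) (level X n) (level X k)
        (act X m p f') (act X n p g') (act X k m g) (act X k n f)"

definition coface :: "nat \<Rightarrow> nat \<Rightarrow> nat \<Rightarrow> nat" where
  "coface n i = (\<lambda>j\<in>{..n}. if j < i then j else j + 1)"

definition codegeneracy :: "nat \<Rightarrow> nat \<Rightarrow> nat \<Rightarrow> nat" where
  "codegeneracy n i = (\<lambda>j\<in>{..n+1}. if j \<le> i then j else j - 1)"

text \<open>The face maps \<open>d\<^sub>i : X\<^sub>n\<^sub>+\<^sub>1 \<rightarrow> X\<^sub>n\<close> for \<open>i \<le> n + 1\<close>, and the degeneracy maps
  \<open>s\<^sub>i : X\<^sub>n \<rightarrow> X\<^sub>n\<^sub>+\<^sub>1\<close> for \<open>i \<le> n\<close>.\<close>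

definition face :: "('o, 'm) simplicial \<Rightarrow> nat \<Rightarrow> nat \<Rightarrow> ('o, 'm, 'o, 'm) fctr" where
  "face X n i = act X n (n + 1) (coface n i)"

definition degeneracy :: "('o, 'm) simplicial \<Rightarrow> nat \<Rightarrow> nat \<Rightarrow> ('o, 'm, 'o, 'm) fctr" where
  "degeneracy X n i = act X (n + 1) n (codegeneracy n i)"

locale simplicial_map = dom: simplicial_groupoid X + cod: simplicial_groupoid Y
  for X :: "('o, 'm) simplicial" and Y :: "('p, 'q) simplicial" +
  fixes F :: "nat \<Rightarrow> ('o, 'm, 'p, 'q) fctr"
  assumes components: "groupoid_functor (level X n) (level Y n) (F n)"
    and naturality: "\<phi> \<in> Delta m n \<Longrightarrow>
      fctr_eq (level X n) (fctr_comp (F m) (act X m n \<phi>)) (fctr_comp (act Y m n \<phi>) (F n))"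

definition conservative ::
  "('o, 'm) simplicial \<Rightarrow> ('p, 'q) simplicial \<Rightarrow> (nat \<Rightarrow> ('o, 'm, 'p, 'q) fctr) \<Rightarrow> bool" where
  "conservative X Y F \<longleftrightarrow> (\<forall>n. \<forall>i \<le> n.
     homotopy_pullback (level X n) (level X (n + 1)) (level Y n) (level Y (n + 1))
       (degeneracy X n i) (F n) (F (n + 1)) (degeneracy Y n i))"

definition ULF ::
  "('o, 'm) simplicial \<Rightarrow> ('p, 'q) simplicial \<Rightarrow> (nat \<Rightarrow> ('o, 'm, 'p, 'q) fctr) \<Rightarrow> bool" where
  "ULF X Y F \<longleftrightarrow> (\<forall>n i. 0 < i \<and> i < n + 1 \<longrightarrow>
     homotopy_pullback (level X (n + 1)) (level X n) (level Y (n + 1)) (level Y n)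
       (face X n i) (F (n + 1)) (F n) (face Y n i))"


section \<open>Coalgebras over the rationals on a free vector space\<close>

text \<open>
  The vector space with basis \<open>B\<close> consists of the finitely supported functions \<open>B \<rightarrow> \<rat>\<close>, extended
  by zero; the tensor product of the spaces with bases \<open>B\<close> and \<open>C\<close> is the one with basis \<open>B \<times> C\<close>.
\<close>

definition supp :: "('b \<Rightarrow> rat) \<Rightarrow> 'b set" where
  "supp v = {b. v b \<noteq> 0}"

definition free_space :: "'b set \<Rightarrow> ('b \<Rightarrow> rat) set" where
  "free_space B = {v. finite (supp v) \<and> supp v \<subseteq> B}"

definition delta :: "'b \<Rightarrow> 'b \<Rightarrow> rat" where
  "delta b = (\<lambda>x. if x = b then 1 else 0)"

definition linear_ext :: "('b \<Rightarrow> 'c \<Rightarrow> rat) \<Rightarrow> ('b \<Rightarrow> rat) \<Rightarrow> 'c \<Rightarrow> rat" where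
  "linear_ext f v = (\<lambda>c. \<Sum>b \<in> supp v. v b * f b c)"

definition functional_ext :: "('b \<Rightarrow> rat) \<Rightarrow> ('b \<Rightarrow> rat) \<Rightarrow> rat" where
  "functional_ext e v = (\<Sum>b \<in> supp v. v b * e b)"

definition linear_between ::
  "'b set \<Rightarrow> 'c set \<Rightarrow> (('b \<Rightarrow> rat) \<Rightarrow> 'c \<Rightarrow> rat) \<Rightarrow> bool" where
  "linear_between B C F \<longleftrightarrow>
     (\<forall>v \<in> free_space B. F v \<in> free_space C) \<and>
     (\<forall>v \<in> free_space B. \<forall>w \<in> free_space B. F (\<lambda>b. v b + w b) = (\<lambda>c. F v c + F w c)) \<and>
     (\<forall>v \<in> free_space B. \<forall>r. F (\<lambda>b. r * v b) = (\<lambda>c. r * F v c))"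

definition linear_functional :: "'b set \<Rightarrow> (('b \<Rightarrow> rat) \<Rightarrow> rat) \<Rightarrow> bool" where
  "linear_functional B e \<longleftrightarrow>
     (\<forall>v \<in> free_space B. \<forall>w \<in> free_space B. e (\<lambda>b. v b + w b) = e v + e w) \<and>
     (\<forall>v \<in> free_space B. \<forall>r. e (\<lambda>b. r * v b) = r * e v)"

definition tensor_map ::
  "(('b \<Rightarrow> rat) \<Rightarrow> 'c \<Rightarrow> rat) \<Rightarrow> (('d \<Rightarrow> rat) \<Rightarrow> 'e \<Rightarrow> rat) \<Rightarrow>
   ('b \<times> 'd \<Rightarrow> rat) \<Rightarrow> 'c \<times> 'e \<Rightarrow> rat" where
  "tensor_map F G = linear_ext (\<lambda>(b, d) (c, e). F (delta b) c * G (delta d) e)"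

record 'b coalg =
  basis :: "'b set"
  comult :: "('b \<Rightarrow> rat) \<Rightarrow> 'b \<times> 'b \<Rightarrow> rat"
  counit :: "('b \<Rightarrow> rat) \<Rightarrow> rat"

locale coalgebra =
  fixes C :: "'b coalg"
  assumes comult_linear: "linear_between (basis C) (basis C \<times> basis C) (comult C)"
    and counit_linear: "linear_functional (basis C) (counit C)"
    and coassoc: "v \<in> free_space (basis C) \<Longrightarrow>
      tensor_map (comult C) (\<lambda>w. w) (comult C v) ((a, b), c) =
      tensor_map (\<lambda>w. w) (comult C) (comult C v) (a, (b, c))"
    and counit_left: "v \<in> free_space (basis C) \<Longrightarrow>
      linear_ext (\<lambda>(a, b) x. counit C (delta a) * delta b x) (comult C v) = v"
    and counit_right: "v \<in> free_space (basis C) \<Longrightarrow>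
      linear_ext (\<lambda>(a, b) x. counit C (delta b) * delta a x) (comult C v) = v"

locale coalgebra_hom = dom: coalgebra C + cod: coalgebra D
  for C :: "'b coalg" and D :: "'c coalg" +
  fixes F :: "('b \<Rightarrow> rat) \<Rightarrow> 'c \<Rightarrow> rat"
  assumes hom_linear: "linear_between (basis C) (basis D) F"
    and hom_comult: "v \<in> free_space (basis C) \<Longrightarrow> comult D (F v) = tensor_map F F (comult C v)"
    and hom_counit: "v \<in> free_space (basis C) \<Longrightarrow> counit D (F v) = counit C v"

locale coalgebra_iso = coalgebra_hom +
  assumes hom_bij: "bij_betw F (free_space (basis C)) (free_space (basis D))"


section \<open>Cardinality of the incidence coalgebra\<close>

definition finiteness_conditions :: "('o, 'm) simplicial \<Rightarrow> bool" where
  "finiteness_conditions X \<longleftrightarrow>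
     (\<forall>f \<in> ob (level X 1). finite (hom (level X 1) f f)) \<and>
     (\<forall>f \<in> ob (level X 1). finite_groupoid (homotopy_fibre (level X 2) (level X 1) (face X 1 1) f)) \<and>
     (\<forall>f \<in> ob (level X 1). finite_groupoid (homotopy_fibre (level X 0) (level X 1) (degeneracy X 0 0) f))"

text \<open>The homotopy fibre of \<open>(d\<^sub>1, d\<^sub>2, d\<^sub>0) : X\<^sub>2 \<rightarrow> X\<^sub>1 \<times> X\<^sub>1 \<times> X\<^sub>1\<close> over \<open>(f, a, b)\<close>.\<close>

definition fibre3 ::
  "('o, 'm) simplicial \<Rightarrow> 'o \<Rightarrow> 'o \<Rightarrow> 'o \<Rightarrow> ('o \<times> 'm \<times> 'm \<times> 'm, 'm) category" where
  "fibre3 X f a b =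
     homotopy_fibre (level X 2)
       (prod_category (level X 1) (prod_category (level X 1) (level X 1)))
       (fctr_pair (face X 1 1) (fctr_pair (face X 1 2) (face X 1 0)))
       (f, a, b)"

definition incidence_coeff :: "('o, 'm) simplicial \<Rightarrow> 'o set \<Rightarrow> 'o set \<times> 'o set \<Rightarrow> rat" where
  "incidence_coeff X f = (\<lambda>(a, b).
     if a \<in> pi0 (level X 1) \<and> b \<in> pi0 (level X 1)
     then groupoid_card (component (level X 1) a) * groupoid_card (component (level X 1) b) *
          groupoid_card (fibre3 X (rep f) (rep a) (rep b))
     else 0)"

definition incidence_coalgebra :: "('o, 'm) simplicial \<Rightarrow> 'o set coalg" where
  "incidence_coalgebra X = \<lparr>
     basis = pi0 (level X 1),
     comult = linear_ext (incidence_coeff X),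
     counit = functional_ext (\<lambda>f. groupoid_card
       (homotopy_fibre (level X 0) (level X 1) (degeneracy X 0 0) (rep f)))\<rparr>"

definition cardinality_map ::
  "('p, 'q) simplicial \<Rightarrow> (nat \<Rightarrow> ('o, 'm, 'p, 'q) fctr) \<Rightarrow>
   ('o set \<Rightarrow> rat) \<Rightarrow> 'p set \<Rightarrow> rat" where
  "cardinality_map Y F = linear_ext (\<lambda>f. delta (pi0_map (level Y 1) (F 1) f))"


section \<open>Restriction species and the Schmitt coalgebra\<close>

text \<open>
  Finite sets are the finite subsets of an infinite type \<open>'a\<close>. For an injection \<open>f : A \<rightarrow> S\<close>,
  \<open>pull R A S f : R[S] \<rightarrow> R[A]\<close> is the contravariant action of \<open>f\<close>.
\<close>

definition injections :: "'a set \<Rightarrow> 'a set \<Rightarrow> ('a \<Rightarrow> 'a) set" where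
  "injections A S = {f \<in> A \<rightarrow>\<^sub>E S. inj_on f A}"

record ('a, 'r) species =
  strs :: "'a set \<Rightarrow> 'r set"
  pull :: "'a set \<Rightarrow> 'a set \<Rightarrow> ('a \<Rightarrow> 'a) \<Rightarrow> 'r \<Rightarrow> 'r"

locale restriction_species =
  fixes R :: "('a::infinite, 'r) species"
  assumes pull_closed: "\<lbrakk>finite A; finite S; f \<in> injections A S; X \<in> strs R S\<rbrakk>
      \<Longrightarrow> pull R A S f X \<in> strs R A"
    and pull_id: "\<lbrakk>finite S; X \<in> strs R S\<rbrakk> \<Longrightarrow> pull R S S (\<lambda>s\<in>S. s) X = X"
    and pull_comp: "\<lbrakk>finite A; finite B; finite S; f \<in> injections A B; g \<in> injections B S; X \<in> strs R S\<rbrakk>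
      \<Longrightarrow> pull R A S (compose A g f) X = pull R A B f (pull R B S g X)"

definition restr :: "('a, 'r) species \<Rightarrow> 'a set \<Rightarrow> 'r \<Rightarrow> 'a set \<Rightarrow> 'r" where
  "restr R S X A = pull R A S (\<lambda>s\<in>A. s) X"

definition species_morphism ::
  "('a, 'r) species \<Rightarrow> ('a, 's) species \<Rightarrow> ('a set \<Rightarrow> 'r \<Rightarrow> 's) \<Rightarrow> bool" where
  "species_morphism R R' \<alpha> \<longleftrightarrow>
     (\<forall>S. finite S \<longrightarrow> (\<forall>X \<in> strs R S. \<alpha> S X \<in> strs R' S)) \<and>
     (\<forall>A S. finite A \<and> finite S \<longrightarrow> (\<forall>f \<in> injections A S. \<forall>X \<in> strs R S.
        \<alpha> A (pull R A S f X) = pull R' A S f (\<alpha> S X)))"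

definition struct_isos :: "('a, 'r) species \<Rightarrow> 'a set \<times> 'r \<Rightarrow> 'a set \<times> 'r \<Rightarrow> ('a \<Rightarrow> 'a) set" where
  "struct_isos R = (\<lambda>(S, X) (T, Y). {f \<in> S \<rightarrow>\<^sub>E T. bij_betw f S T \<and> pull R S T f Y = X})"

definition structures :: "('a, 'r) species \<Rightarrow> ('a set \<times> 'r, 'a \<Rightarrow> 'a) category" where
  "structures R = \<lparr>
     ob = {(S, X). finite S \<and> X \<in> strs R S},
     hom = struct_isos R,
     ide = (\<lambda>(S, X). \<lambda>s\<in>S. s),
     cmp = (\<lambda>(S, X) _ _ g f. compose S g f)\<rparr>"

definition struct_class :: "('a, 'r) species \<Rightarrow> 'a set \<times> 'r \<Rightarrow> ('a set \<times> 'r) set" where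
  "struct_class R x = iso_rel (structures R) `` {x}"

definition schmitt_comult ::
  "('a, 'r) species \<Rightarrow> 'a set \<times> 'r \<Rightarrow> ('a set \<times> 'r) set \<times> ('a set \<times> 'r) set \<Rightarrow> rat" where
  "schmitt_comult R = (\<lambda>(S, X) z. \<Sum>(A, B) \<in> {(A, B). A \<union> B = S \<and> A \<inter> B = {}}.
     delta (struct_class R (A, restr R S X A), struct_class R (B, restr R S X B)) z)"

definition schmitt_counit :: "'a set \<times> 'r \<Rightarrow> rat" where
  "schmitt_counit = (\<lambda>(S, X). if S = {} then 1 else 0)"

definition schmitt_coalgebra :: "('a, 'r) species \<Rightarrow> ('a set \<times> 'r) set coalg" where
  "schmitt_coalgebra R = \<lparr>
     basis = pi0 (structures R),
     comult = linear_ext (\<lambda>c. schmitt_comult R (rep c)),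
     counit = functional_ext (\<lambda>c. schmitt_counit (rep c))\<rparr>"

definition schmitt_map ::
  "('a, 's) species \<Rightarrow> ('a set \<Rightarrow> 'r \<Rightarrow> 's) \<Rightarrow>
   (('a set \<times> 'r) set \<Rightarrow> rat) \<Rightarrow> ('a set \<times> 's) set \<Rightarrow> rat" where
  "schmitt_map R' \<alpha> = linear_ext (\<lambda>c. delta (pi0_map (structures R')
     \<lparr>on_ob = (\<lambda>(S, X). (S, \<alpha> S X)), on_hom = (\<lambda>x y f. f)\<rparr> c))"


section \<open>The simplicial groupoid of a restriction species\<close>

text \<open>Objects of the \<open>k\<close>-th groupoid are triples \<open>(S, X, p)\<close> with \<open>X \<in> R[S]\<close> and \<open>p : S \<rightarrow> {1, \<dots>, k}\<close>.\<close>

type_synonym ('a, 'r) part_struct = "'a set \<times> 'r \<times> ('a \<Rightarrow> nat)"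

definition part_level :: "('a, 'r) species \<Rightarrow> nat \<Rightarrow> (('a, 'r) part_struct, 'a \<Rightarrow> 'a) category" where
  "part_level R k = \<lparr>
     ob = {(S, X, p). finite S \<and> X \<in> strs R S \<and> p \<in> S \<rightarrow>\<^sub>E {1..k}},
     hom = (\<lambda>(S, X, p) (T, Y, q). {f \<in> struct_isos R (S, X) (T, Y). \<forall>s \<in> S. q (f s) = p s}),
     ide = (\<lambda>(S, X, p). \<lambda>s\<in>S. s),
     cmp = (\<lambda>(S, X, p) _ _ g f. compose S g f)\<rparr>"

text \<open>
  A map \<open>\<phi> : [m] \<rightarrow> [n]\<close> turns a partition into \<open>n\<close> parts into one into \<open>m\<close> parts: the new
  part \<open>j\<close> is the union of the old parts \<open>i\<close> with \<open>\<phi> (j - 1) < i \<le> \<phi> j\<close>. The elements of the old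
  parts \<open>i \<le> \<phi> 0\<close> and \<open>i > \<phi> m\<close> are deleted. The lemmas below specialise this to face and
  degeneracy maps.
\<close>

definition kept :: "nat \<Rightarrow> (nat \<Rightarrow> nat) \<Rightarrow> ('a, 'r) part_struct \<Rightarrow> 'a set" where
  "kept m \<phi> = (\<lambda>(S, X, p). {s \<in> S. \<phi> 0 < p s \<and> p s \<le> \<phi> m})"

definition new_part :: "nat \<Rightarrow> (nat \<Rightarrow> nat) \<Rightarrow> nat \<Rightarrow> nat" where
  "new_part m \<phi> i = (THE j. j \<in> {1..m} \<and> \<phi> (j - 1) < i \<and> i \<le> \<phi> j)"

definition part_act ::
  "('a, 'r) species \<Rightarrow> nat \<Rightarrow> nat \<Rightarrow> (nat \<Rightarrow> nat) \<Rightarrow>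
   (('a, 'r) part_struct, 'a \<Rightarrow> 'a, ('a, 'r) part_struct, 'a \<Rightarrow> 'a) fctr" where
  "part_act R m n \<phi> = \<lparr>
     on_ob = (\<lambda>(S, X, p). (kept m \<phi> (S, X, p), restr R S X (kept m \<phi> (S, X, p)),
       \<lambda>s\<in>kept m \<phi> (S, X, p). new_part m \<phi> (p s))),
     on_hom = (\<lambda>x y f. restrict f (kept m \<phi> x))\<rparr>"

definition species_simplicial ::
  "('a, 'r) species \<Rightarrow> (('a, 'r) part_struct, 'a \<Rightarrow> 'a) simplicial" where
  "species_simplicial R = \<lparr>level = part_level R, act = part_act R\<rparr>"

definition species_functor ::
  "('a set \<Rightarrow> 'r \<Rightarrow> 's) \<Rightarrow> nat \<Rightarrow>
   (('a, 'r) part_struct, 'a \<Rightarrow> 'a, ('a, 's) part_struct, 'a \<Rightarrow> 'a) fctr" where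
  "species_functor \<alpha> k = \<lparr>on_ob = (\<lambda>(S, X, p). (S, \<alpha> S X, p)), on_hom = (\<lambda>x y f. f)\<rparr>"

text \<open>
  The identification of structures with objects of the groupoid in degree 1, where the partition
  is trivial.
\<close>

definition schmitt_to_incidence ::
  "('a, 'r) species \<Rightarrow> (('a set \<times> 'r) set \<Rightarrow> rat) \<Rightarrow> ('a, 'r) part_struct set \<Rightarrow> rat" where
  "schmitt_to_incidence R = linear_ext (\<lambda>c. delta (pi0_map (part_level R 1)
     \<lparr>on_ob = (\<lambda>(S, X). (S, X, \<lambda>s\<in>S. 1)), on_hom = (\<lambda>x y f. f)\<rparr> c))"


subsection \<open>Face and degeneracy maps\<close>

lemma new_part_eqI:
  assumes "\<phi> \<in> Delta m n" "j \<in> {1..m}" "\<phi> (j - 1) < i" "i \<le> \<phi> j"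
  shows "new_part m \<phi> i = j"
  unfolding new_part_def
proof (rule the_equality)
  show "j \<in> {1..m} \<and> \<phi> (j - 1) < i \<and> i \<le> \<phi> j" using assms by simp
next
  fix j' assume j': "j' \<in> {1..m} \<and> \<phi> (j' - 1) < i \<and> i \<le> \<phi> j'"
  have mono: "\<phi> a \<le> \<phi> b" if "a \<le> b" "b \<le> m" for a b
    using assms(1) that by (auto simp: Delta_def monotone_on_def)
  show "j' = j"
  proof (rule ccontr)
    assume "j' \<noteq> j"
    then consider "j \<le> j' - 1" | "j' \<le> j - 1" by linarith
    then show False
    proof cases
      case 1
      have "\<phi> j \<le> \<phi> (j' - 1)" using 1 j' by (intro mono) auto
      then show False using j' assms(4) by linarith
    next
      case 2
      have "\<phi> j' \<le> \<phi> (j - 1)" using 2 assms(2) by (intro mono) auto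
      then show False using j' assms(3) by linarith
    qed
  qed
qed

lemma coface_in_Delta: "coface n i \<in> Delta n (n + 1)"
  by (auto simp: coface_def Delta_def monotone_on_def)

lemma codegeneracy_in_Delta: "i \<le> n \<Longrightarrow> codegeneracy n i \<in> Delta (n + 1) n"
  by (auto simp: codegeneracy_def Delta_def monotone_on_def)

context restriction_species
begin

lemma restr_self: "finite S \<Longrightarrow> X \<in> strs R S \<Longrightarrow> restr R S X S = X"
  by (simp add: restr_def pull_id)

lemma bottom_face:
  assumes "(S, X, p) \<in> ob (part_level R (n + 1))"
  defines "A \<equiv> {s \<in> S. p s \<noteq> 1}"
  shows "on_ob (face (species_simplicial R) n 0) (S, X, p) = (A, restr R S X A, \<lambda>s\<in>A. p s - 1)"
proof -
  have p: "1 \<le> p s \<and> p s \<le> n + 1" if "s \<in> S" for s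
    using assms that by (auto simp: part_level_def)
  have k: "kept n (coface n 0) (S, X, p) = A"
    unfolding A_def kept_def coface_def using p by force
  have "new_part n (coface n 0) (p s) = p s - 1" if "s \<in> A" for s
    using p[of s] that by (intro new_part_eqI[OF coface_in_Delta]) (auto simp: A_def coface_def)
  then show ?thesis
    by (auto simp: face_def species_simplicial_def part_act_def k intro!: restrict_ext)
qed

lemma top_face:
  assumes "(S, X, p) \<in> ob (part_level R (n + 1))"
  defines "A \<equiv> {s \<in> S. p s \<noteq> n + 1}"
  shows "on_ob (face (species_simplicial R) n (n + 1)) (S, X, p) = (A, restr R S X A, \<lambda>s\<in>A. p s)"
proof -
  have p: "1 \<le> p s \<and> p s \<le> n + 1" if "s \<in> S" for s
    using assms that by (auto simp: part_level_def)
  have k: "kept n (coface n (n + 1)) (S, X, p) = A"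
    unfolding A_def kept_def coface_def using p by force
  have "new_part n (coface n (n + 1)) (p s) = p s" if "s \<in> A" for s
    using p[of s] that by (intro new_part_eqI[OF coface_in_Delta]) (auto simp: A_def coface_def)
  then show ?thesis
    by (auto simp: face_def species_simplicial_def part_act_def k[simplified] intro!: restrict_ext)
qed

lemma inner_face:
  assumes "(S, X, p) \<in> ob (part_level R (n + 1))" "0 < i" "i < n + 1"
  shows "on_ob (face (species_simplicial R) n i) (S, X, p) =
    (S, X, \<lambda>s\<in>S. if p s \<le> i then p s else p s - 1)"
proof -
  have p: "1 \<le> p s \<and> p s \<le> n + 1" if "s \<in> S" for s
    using assms that by (auto simp: part_level_def)
  have k: "kept n (coface n i) (S, X, p) = S"
    unfolding kept_def coface_def using p assms(2,3) by force
  have "new_part n (coface n i) (p s) = (if p s \<le> i then p s else p s - 1)" if "s \<in> S" for s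
    using p[of s] that assms(2,3)
    by (intro new_part_eqI[OF coface_in_Delta]) (auto simp: coface_def)
  moreover have "restr R S X S = X"
    using assms(1) by (auto simp: part_level_def restr_self)
  ultimately show ?thesis
    by (auto simp: face_def species_simplicial_def part_act_def k intro!: restrict_ext)
qed

lemma degeneracy_empty_part:
  assumes "(S, X, p) \<in> ob (part_level R n)" "i \<le> n"
  shows "on_ob (degeneracy (species_simplicial R) n i) (S, X, p) =
    (S, X, \<lambda>s\<in>S. if p s \<le> i then p s else p s + 1)"
proof -
  have p: "1 \<le> p s \<and> p s \<le> n" if "s \<in> S" for s
    using assms that by (auto simp: part_level_def)
  have k: "kept (n + 1) (codegeneracy n i) (S, X, p) = S"
    unfolding kept_def codegeneracy_def using p assms(2) by force
  have "new_part (n + 1) (codegeneracy n i) (p s) = (if p s \<le> i then p s else p s + 1)"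
    if "s \<in> S" for s
    using p[of s] that assms(2)
    by (intro new_part_eqI[OF codegeneracy_in_Delta[OF assms(2)]]) (auto simp: codegeneracy_def)
  moreover have "restr R S X S = X"
    using assms(1) by (auto simp: part_level_def restr_self)
  ultimately show ?thesis
    by (auto simp: degeneracy_def species_simplicial_def part_act_def k[simplified] intro!: restrict_ext)
qed

end

subsection \<open>The Schmitt operations are independent of representatives\<close>

lemma (in groupoid) equiv_iso_rel: "equiv (ob G) (iso_rel G)"
proof (rule equivI)
  show "iso_rel G \<subseteq> ob G \<times> ob G" by (auto simp: iso_rel_def)
  show "refl_on (ob G) (iso_rel G)" by (auto simp: refl_on_def iso_rel_def intro: ide_closed)
  show "sym (iso_rel G)" unfolding sym_def iso_rel_def using inverse by blast
  show "trans (iso_rel G)" unfolding trans_def iso_rel_def using cmp_closed by blast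
qed

context restriction_species
begin

lemma struct_isos_comp:
  assumes "finite S" "finite T" "finite U" "Z \<in> strs R U"
    "f \<in> struct_isos R (S, X) (T, Y)" "g \<in> struct_isos R (T, Y) (U, Z)"
  shows "compose S g f \<in> struct_isos R (S, X) (U, Z)"
proof -
  have bij: "bij_betw (compose S g f) S U"
    using assms(5,6) bij_betw_compose[of f S T g U] by (simp add: struct_isos_def)
  have fg: "f \<in> injections S T" "g \<in> injections T U"
    using assms(5,6) by (auto simp: struct_isos_def injections_def bij_betw_def)
  have "pull R S U (compose S g f) Z = pull R S T f (pull R T U g Z)"
    using pull_comp[OF assms(1-3) fg assms(4)] .
  also have "\<dots> = X" using assms(5,6) by (simp add: struct_isos_def)
  finally show ?thesis
    using bij by (auto simp: struct_isos_def bij_betw_def compose_def)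
qed

lemma struct_isos_inverse:
  assumes "finite S" "finite T" "Y \<in> strs R T" "f \<in> struct_isos R (S, X) (T, Y)"
  obtains g where "g \<in> struct_isos R (T, Y) (S, X)"
    "compose S g f = (\<lambda>s\<in>S. s)" "compose T f g = (\<lambda>s\<in>T. s)"
proof
  let ?g = "\<lambda>t\<in>T. inv_into S f t"
  have f: "bij_betw f S T" "f \<in> S \<rightarrow>\<^sub>E T" "pull R S T f Y = X"
    using assms(4) by (auto simp: struct_isos_def)
  have g: "bij_betw ?g T S"
    using bij_betw_inv_into[OF f(1)] by (simp cong: bij_betw_cong)
  have inj: "?g \<in> injections T S" "f \<in> injections S T"
    using g f by (auto simp: injections_def bij_betw_def)
  show gf: "compose S ?g f = (\<lambda>s\<in>S. s)"
    using f by (auto simp: compose_def fun_eq_iff bij_betw_def)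
  show fg: "compose T f ?g = (\<lambda>s\<in>T. s)"
    using f by (auto simp: compose_def fun_eq_iff bij_betw_def f_inv_into_f)
  have "pull R T S ?g X = Y"
    using pull_comp[OF assms(2,1,2) inj assms(3)] f(3) fg pull_id[OF assms(2,3)] by simp
  then show "?g \<in> struct_isos R (T, Y) (S, X)"
    using g by (auto simp: struct_isos_def bij_betw_def)
qed

lemma groupoid_structures: "groupoid (structures R)"
proof
  fix x assume "x \<in> ob (structures R)"
  then show "ide (structures R) x \<in> hom (structures R) x x"
    by (auto simp: structures_def struct_isos_def pull_id bij_betw_def inj_on_def)
next
  fix x y z f g
  assume "x \<in> ob (structures R)" "y \<in> ob (structures R)" "z \<in> ob (structures R)"
    "f \<in> hom (structures R) x y" "g \<in> hom (structures R) y z"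
  then show "cmp (structures R) x y z g f \<in> hom (structures R) x z"
    by (auto simp: structures_def intro: struct_isos_comp)
next
  fix x y f
  assume "x \<in> ob (structures R)" "y \<in> ob (structures R)" "f \<in> hom (structures R) x y"
  then show "cmp (structures R) x x y f (ide (structures R) x) = f"
    by (auto simp: structures_def struct_isos_def compose_def fun_eq_iff PiE_def extensional_def)
next
  fix x y f
  assume "x \<in> ob (structures R)" "y \<in> ob (structures R)" "f \<in> hom (structures R) x y"
  then show "cmp (structures R) x y y (ide (structures R) y) f = f"
    by (auto simp: structures_def struct_isos_def compose_def fun_eq_iff PiE_def extensional_def)
next
  fix w x y z f g h
  assume "w \<in> ob (structures R)" "x \<in> ob (structures R)" "f \<in> hom (structures R) w x"
  then show "cmp (structures R) w x z (cmp (structures R) x y z h g) f =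
    cmp (structures R) w y z h (cmp (structures R) w x y g f)"
    by (auto simp: structures_def struct_isos_def compose_def fun_eq_iff)
next
  fix x y f
  assume a: "x \<in> ob (structures R)" "y \<in> ob (structures R)" "f \<in> hom (structures R) x y"
  obtain S X T Y where xy: "x = (S, X)" "y = (T, Y)" by fastforce
  show "\<exists>g \<in> hom (structures R) y x.
    cmp (structures R) x y x g f = ide (structures R) x \<and>
    cmp (structures R) y x y f g = ide (structures R) y"
    using struct_isos_inverse[of S T Y f X] a unfolding xy
    by (auto simp: structures_def)
qed

lemma restrict_struct_iso:
  assumes "finite S" "finite T" "Y \<in> strs R T" "f \<in> struct_isos R (S, X) (T, Y)" "A \<subseteq> S"
  shows "restrict f A \<in> struct_isos R (A, restr R S X A) (f ` A, restr R T Y (f ` A))"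
proof -
  have f: "bij_betw f S T" "f \<in> S \<rightarrow>\<^sub>E T" "pull R S T f Y = X"
    using assms(4) by (auto simp: struct_isos_def)
  have fin: "finite A" "finite (f ` A)" using assms(1,5) finite_subset by auto
  have inj: "inj_on f A" using f(1) assms(5) by (auto simp: bij_betw_def intro: inj_on_subset)
  have sub: "f ` A \<subseteq> T" using f(2) assms(5) by auto
  have injs: "restrict f A \<in> injections A (f ` A)" "(\<lambda>t\<in>f ` A. t) \<in> injections (f ` A) T"
      "(\<lambda>s\<in>A. s) \<in> injections A S" "f \<in> injections S T"
    using inj sub f assms(5) by (auto simp: injections_def inj_on_def bij_betw_def)
  have eq: "compose A (\<lambda>t\<in>f ` A. t) (restrict f A) = compose A f (\<lambda>s\<in>A. s)"
    by (auto simp: compose_def fun_eq_iff)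
  have "pull R A (f ` A) (restrict f A) (restr R T Y (f ` A)) =
      pull R A T (compose A (\<lambda>t\<in>f ` A. t) (restrict f A)) Y"
    unfolding restr_def using pull_comp[OF fin assms(2) injs(1,2) assms(3)] by simp
  also have "\<dots> = restr R S X A"
    unfolding restr_def eq using pull_comp[OF fin(1) assms(1,2) injs(3,4) assms(3)] f(3) by simp
  finally show ?thesis
    using inj by (auto simp: struct_isos_def bij_betw_def)
qed

lemma restr_closed: "finite S \<Longrightarrow> X \<in> strs R S \<Longrightarrow> A \<subseteq> S \<Longrightarrow> restr R S X A \<in> strs R A"
  unfolding restr_def
  by (rule pull_closed) (auto simp: injections_def inj_on_def intro: finite_subset)

lemma struct_class_restr_eq:
  assumes "finite S" "finite T" "X \<in> strs R S" "Y \<in> strs R T"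
    "f \<in> struct_isos R (S, X) (T, Y)" "A \<subseteq> S"
  shows "struct_class R (A, restr R S X A) = struct_class R (f ` A, restr R T Y (f ` A))"
proof -
  have "f ` A \<subseteq> T" using assms(5,6) by (auto simp: struct_isos_def)
  moreover have "finite A" using assms(1,6) finite_subset by auto
  ultimately have "((A, restr R S X A), (f ` A, restr R T Y (f ` A))) \<in> iso_rel (structures R)"
    using restrict_struct_iso[OF assms(1,2,4-6)] assms
    by (auto simp: iso_rel_def structures_def intro: restr_closed)
  then show ?thesis
    unfolding struct_class_def
    using equiv_class_eq[OF groupoid.equiv_iso_rel[OF groupoid_structures]] by blast
qed

lemma schmitt_comult_cong:
  assumes "(x, y) \<in> iso_rel (structures R)"
  shows "schmitt_comult R x = schmitt_comult R y"
proof -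
  obtain S X T Y where xy: "x = (S, X)" "y = (T, Y)" by fastforce
  obtain f where f: "f \<in> struct_isos R (S, X) (T, Y)"
    and fin: "finite S" "finite T" "X \<in> strs R S" "Y \<in> strs R T"
    using assms by (auto simp: iso_rel_def structures_def xy)
  have bij: "bij_betw f S T" using f by (auto simp: struct_isos_def)
  let ?P = "\<lambda>S. {(A, B). A \<union> B = S \<and> A \<inter> B = {}}"
  have img: "f ` S = T" "inj_on f S" using bij by (auto simp: bij_betw_def)
  define g where "g = inv_into S f"
  have gf: "g ` (f ` A) = A" if "A \<subseteq> S" for A
    using that img(2) unfolding g_def by (simp add: inv_into_image_cancel)
  have fg: "f ` (g ` A) = A" if "A \<subseteq> T" for A
    using that img(1) unfolding g_def by (simp add: image_inv_into_cancel)
  have gimg: "g ` T = S" "inj_on g T" 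
    using bij_betw_inv_into[OF bij] by (auto simp: g_def bij_betw_def)
  have "schmitt_comult R (S, X) z = schmitt_comult R (T, Y) z" for z
    unfolding schmitt_comult_def split_def prod.sel
  proof (rule sum.reindex_bij_witness[where
        i = "\<lambda>(A, B). (g ` A, g ` B)" and j = "\<lambda>(A, B). (f ` A, f ` B)"], goal_cases)
    case (1 a)
    then have "fst a \<subseteq> S" "snd a \<subseteq> S" by auto
    then show ?case by (simp add: gf split_def)
  next
    case (2 a)
    then have "f ` fst a \<union> f ` snd a = T" "f ` fst a \<inter> f ` snd a = {}"
      using img by (auto simp: inj_on_def)
    then show ?case by (simp add: split_def)
  next
    case (3 b)
    then have "fst b \<subseteq> T" "snd b \<subseteq> T" by auto
    then show ?case by (simp add: fg split_def)
  next
    case (4 b)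
    then have "g ` fst b \<union> g ` snd b = S" "g ` fst b \<inter> g ` snd b = {}"
      using gimg by (auto simp: inj_on_def)
    then show ?case by (simp add: split_def)
  next
    case (5 a)
    then show ?case
      using struct_class_restr_eq[OF fin f, of "fst a"] struct_class_restr_eq[OF fin f, of "snd a"]
      by (auto simp: split_def)
  qed
  then show ?thesis unfolding xy by blast
qed

lemma rep_struct_class:
  assumes "x \<in> ob (structures R)"
  shows "(x, rep (struct_class R x)) \<in> iso_rel (structures R)"
proof -
  have "x \<in> struct_class R x"
    using equiv_class_self[OF groupoid.equiv_iso_rel[OF groupoid_structures] assms]
    by (simp add: struct_class_def)
  then have "rep (struct_class R x) \<in> struct_class R x" unfolding rep_def by (rule someI)
  then show ?thesis by (simp add: struct_class_def)
qed

lemma supp_delta: "supp (delta b) = {b}"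
  by (auto simp: supp_def delta_def)

lemma linear_ext_delta: "linear_ext f (delta b) = f b"
  by (simp add: linear_ext_def supp_delta) (simp add: delta_def)

lemma functional_ext_delta: "functional_ext e (delta b) = e b"
  by (simp add: functional_ext_def supp_delta) (simp add: delta_def)

theorem comult_delta_struct_class:
  assumes "finite S" "X \<in> strs R S"
  shows "comult (schmitt_coalgebra R) (delta (struct_class R (S, X))) =
    (\<lambda>z. \<Sum>(A, B) \<in> {(A, B). A \<union> B = S \<and> A \<inter> B = {}}.
      delta (struct_class R (A, restr R S X A), struct_class R (B, restr R S X B)) z)"
proof -
  have "(S, X) \<in> ob (structures R)" using assms by (simp add: structures_def)
  from schmitt_comult_cong[OF rep_struct_class[OF this]] show ?thesis
    unfolding schmitt_coalgebra_def coalg.simps linear_ext_delta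
    by (metis (mono_tags, lifting) case_prod_conv schmitt_comult_def)
qed

theorem counit_delta_struct_class:
  assumes "finite S" "X \<in> strs R S"
  shows "counit (schmitt_coalgebra R) (delta (struct_class R (S, X))) = (if S = {} then 1 else 0)"
proof -
  have "(S, X) \<in> ob (structures R)" using assms by (simp add: structures_def)
  from rep_struct_class[OF this] have "fst (rep (struct_class R (S, X))) = {} \<longleftrightarrow> S = {}"
    by (auto simp: iso_rel_def structures_def struct_isos_def bij_betw_def split: prod.splits)
  then show ?thesis
    by (simp add: schmitt_coalgebra_def functional_ext_delta schmitt_counit_def split_def)
qed

end

end

theory Submission
  imports Defs
begin

text \<open>
  A generic map relabels the parts and keeps the underlying structure, so it acts by a functor
  along which isomorphisms lift; any strict pullback along such a functor is a homotopy pullback.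
  In \<open>\<Delta>\<close>, the pushout of a generic \<open>g : [k] \<rightarrow> [m]\<close> along a free \<open>f : [k] \<rightarrow> [n]\<close> replaces the
  segment \<open>f\<close> of \<open>[n]\<close> by \<open>[m]\<close>. A partition indexed by the pushout is thus a partition indexed by
  \<open>[n]\<close> together with a refinement of its parts in the segment, which is the decomposition
  condition. The functor of a morphism of species changes neither the underlying sets nor the
  partitions, so its naturality squares on generic maps are strict pullbacks, and structures can
  be transported along isomorphisms.

  The homotopy fibre of \<open>(d\<^sub>1, d\<^sub>2, d\<^sub>0)\<close> over \<open>(X, a, b)\<close> is discrete: a component is a subset \<open>A\<close> of
  the underlying set \<open>S\<close> with isomorphisms \<open>X|A \<cong> a\<close> and \<open>X|(S - A) \<cong> b\<close>. The factors
  \<open>1 / |Aut a|\<close> and \<open>1 / |Aut b|\<close> cancel the choice of isomorphisms, which leaves the number of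
  splittings of \<open>X\<close> into parts of the classes of \<open>a\<close> and \<open>b\<close>.
\<close>

section \<open>Groupoids, homotopy pullbacks and homotopy cardinality\<close>

text \<open>The pushouts in the decomposition condition are known only through their universal
  property in \<Delta>, with an unknown vertex [p]. Since isomorphisms in \<Delta> are identities,
  such a pushout is not merely isomorphic but equal to the explicit glueing of [n] and [m], and f'
  and g' can be computed pointwise. A homotopy pullback can then be checked strictly: an isomorphism
  in the corner groupoid is lifted along one leg until both objects agree on the nose. Homotopy
  cardinalities are evaluated at representatives chosen by \<open>rep\<close>, of which only the
  class is known. Every coefficient is therefore computed for an arbitrary structure and then shown
  to be invariant under isomorphism. After that no groupoids remain: both comultiplications are sums
  over subsets of the underlying set, and the coalgebra axioms and the homomorphism property are
  proved once, for sums of this form. Coassociativity there reindexes two descriptions of the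
  ordered splittings into three parts.\<close>

context groupoid
begin

text \<open>Gives closure of \<open>iso_comma\<close> under composition: \<open>p\<close>,
  \<open>q\<close>, \<open>r\<close> become the comparison arrows of three objects, and the
  horizontal sides become the images of the components of two arrows.\<close>

lemma square_paste:
  assumes "a \<in> ob G" "b \<in> ob G" "c \<in> ob G" "a' \<in> ob G" "b' \<in> ob G" "c' \<in> ob G"
    and "p \<in> hom G a a'" "q \<in> hom G b b'" "r \<in> hom G c c'"
    and "u \<in> hom G a b" "v \<in> hom G b c" "u' \<in> hom G a' b'" "v' \<in> hom G b' c'"
    and "cmp G a b b' q u = cmp G a a' b' u' p" "cmp G b c c' r v = cmp G b b' c' v' q"
  shows "cmp G a c c' r (cmp G a b c v u) = cmp G a a' c' (cmp G a' b' c' v' u') p"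
proof -
  note sq = assms(14,15) and closed = assms(1-13)
  have "cmp G a c c' r (cmp G a b c v u) = cmp G a b c' (cmp G b c c' r v) u"
    using closed by (simp add: cmp_assoc)
  also have "\<dots> = cmp G a b c' (cmp G b b' c' v' q) u"
    using sq(2) by (rule arg_cong)
  also have "\<dots> = cmp G a b' c' v' (cmp G a b b' q u)"
    using closed by (simp add: cmp_assoc)
  also have "\<dots> = cmp G a b' c' v' (cmp G a a' b' u' p)"
    using sq(1) by (rule arg_cong)
  also have "\<dots> = cmp G a a' c' (cmp G a' b' c' v' u') p"
    using closed by (simp add: cmp_assoc)
  finally show ?thesis .
qed

text \<open>Gives inverses in \<open>iso_comma\<close>. One inverse law is inserted on the right of
  \<open>q\<close>, the other is cancelled on the left of \<open>p\<close>.\<close>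

lemma square_inverse:
  assumes "a \<in> ob G" "b \<in> ob G" "a' \<in> ob G" "b' \<in> ob G"
    and "p \<in> hom G a a'" "q \<in> hom G b b'"
    and "u \<in> hom G a b" "v \<in> hom G b a" "u' \<in> hom G a' b'" "v' \<in> hom G b' a'"
    and "cmp G a b b' q u = cmp G a a' b' u' p"
    and "cmp G b a b u v = ide G b" "cmp G a' b' a' v' u' = ide G a'"
  shows "cmp G b a a' p v = cmp G b b' a' v' q"
proof -
  note closed = assms(1-10)
  have "cmp G b b' a' v' q = cmp G b b' a' v' (cmp G b b b' q (cmp G b a b u v))"
    unfolding assms(12) using closed by (simp add: ide_right)
  also have "\<dots> = cmp G b b' a' v' (cmp G b a b' (cmp G a b b' q u) v)"
    using closed by (simp add: cmp_assoc)
  also have "\<dots> = cmp G b b' a' v' (cmp G b a b' (cmp G a a' b' u' p) v)"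
    unfolding assms(11) ..
  also have "\<dots> = cmp G b a' a' (cmp G a' b' a' v' u') (cmp G b a a' p v)"
    using closed by (simp add: cmp_assoc cmp_closed)
  also have "\<dots> = cmp G b a a' p v"
    unfolding assms(13) using closed by (simp add: ide_left cmp_closed)
  finally show ?thesis ..
qed

lemma iso_rel_class_eq_iff:
  assumes "x \<in> ob G" "y \<in> ob G"
  shows "iso_rel G `` {x} = iso_rel G `` {y} \<longleftrightarrow> hom G x y \<noteq> {}"
  using eq_equiv_class_iff[OF equiv_iso_rel assms] assms by (simp add: iso_rel_def)

lemma rep_in_class: "c \<in> pi0 G \<Longrightarrow> rep c \<in> c"
  unfolding pi0_def rep_def using in_quotient_imp_non_empty[OF equiv_iso_rel] by (metis ex_in_conv someI)

lemma rep_in_ob: "c \<in> pi0 G \<Longrightarrow> rep c \<in> ob G"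
  using rep_in_class in_quotient_imp_subset[OF equiv_iso_rel] unfolding pi0_def by blast

lemma class_eqI: "c \<in> pi0 G \<Longrightarrow> x \<in> c \<Longrightarrow> iso_rel G `` {x} = c"
  unfolding pi0_def using equiv_class_eq[OF equiv_iso_rel] by (auto elim!: quotientE)

lemma class_rep: "c \<in> pi0 G \<Longrightarrow> iso_rel G `` {rep c} = c"
  by (intro class_eqI rep_in_class)

lemma pi0_eq_class_image: "pi0 G = (\<lambda>x. iso_rel G `` {x}) ` ob G"
  by (auto simp: pi0_def quotient_def)

text \<open>\<open>D\<close> is a transversal of the components, so that counting components becomes
  counting \<open>D\<close>.\<close>

lemma bij_betw_pi0:
  assumes "D \<subseteq> ob G" "\<And>x. x \<in> ob G \<Longrightarrow> \<exists>d \<in> D. hom G x d \<noteq> {}"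
    and "\<And>d d'. \<lbrakk>d \<in> D; d' \<in> D; hom G d d' \<noteq> {}\<rbrakk> \<Longrightarrow> d = d'"
  shows "bij_betw (\<lambda>x. iso_rel G `` {x}) D (pi0 G)"
proof (rule bij_betw_imageI)
  show "inj_on (\<lambda>x. iso_rel G `` {x}) D"
    using assms(1) iso_rel_class_eq_iff by (intro inj_onI assms(3)) blast+
  show "(\<lambda>x. iso_rel G `` {x}) ` D = pi0 G"
    unfolding pi0_eq_class_image
  proof
    show "(\<lambda>x. iso_rel G `` {x}) ` ob G \<subseteq> (\<lambda>x. iso_rel G `` {x}) ` D"
    proof (clarify)
      fix x assume x: "x \<in> ob G"
      with assms(2) obtain d where "d \<in> D" "hom G x d \<noteq> {}" by blast
      then show "iso_rel G `` {x} \<in> (\<lambda>x. iso_rel G `` {x}) ` D"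
        using iso_rel_class_eq_iff[OF x] assms(1) by blast
    qed
  qed (use assms(1) in auto)
qed

lemma finite_pi0:
  assumes "finite D" "D \<subseteq> ob G" "\<And>x. x \<in> ob G \<Longrightarrow> \<exists>d \<in> D. hom G x d \<noteq> {}"
  shows "finite (pi0 G)"
proof -
  have "pi0 G \<subseteq> (\<lambda>x. iso_rel G `` {x}) ` D"
    unfolding pi0_eq_class_image
  proof (clarify)
    fix x assume x: "x \<in> ob G"
    with assms(3) obtain d where "d \<in> D" "hom G x d \<noteq> {}" by blast
    then show "iso_rel G `` {x} \<in> (\<lambda>x. iso_rel G `` {x}) ` D"
      using iso_rel_class_eq_iff[OF x] assms(2) by blast
  qed
  then show ?thesis using assms(1) finite_surj by blast
qed

lemma groupoid_card_discrete:
  assumes "\<And>x f g. \<lbrakk>x \<in> ob G; f \<in> hom G x x; g \<in> hom G x x\<rbrakk> \<Longrightarrow> f = g"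
  shows "groupoid_card G = of_nat (card (pi0 G))"
proof -
  have "card (hom G (rep c) (rep c)) = 1" if "c \<in> pi0 G" for c
  proof -
    have "hom G (rep c) (rep c) = {ide G (rep c)}"
      using assms[OF rep_in_ob[OF that]] ide_closed[OF rep_in_ob[OF that]] by blast
    then show ?thesis by simp
  qed
  then show ?thesis by (simp add: groupoid_card_def)
qed

text \<open>The only class of the component is the set \<open>c\<close> itself, so
  \<open>rep\<close> picks the same representative in the component as in \<open>G\<close>.\<close>

lemma groupoid_card_component:
  assumes "c \<in> pi0 G"
  shows "groupoid_card (component G c) = 1 / of_nat (card (hom G (rep c) (rep c)))"
proof -
  have c: "x \<in> c \<longleftrightarrow> (rep c, x) \<in> iso_rel G" for x
    using class_rep[OF assms] by blast
  have "iso_rel (component G c) = iso_rel G \<inter> c \<times> c"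
    using c by (auto simp: iso_rel_def component_def)
  also have "\<dots> = c \<times> c"
  proof -
    have "(x, y) \<in> iso_rel G" if "x \<in> c" "y \<in> c" for x y
      using class_eqI[OF assms that(1)] that(2) by blast
    then show ?thesis by blast
  qed
  finally have "iso_rel (component G c) = c \<times> c" .
  then have "pi0 (component G c) = {c}"
    using rep_in_class[OF assms] by (auto simp: pi0_def quotient_def component_def)
  then show ?thesis by (simp add: groupoid_card_def component_def)
qed

text \<open>A nonempty hom-set is a torsor under the automorphisms of its target; one chosen arrow
  identifies the two.\<close>

lemma hom_card_eq_automorphisms:
  assumes "x \<in> ob G" "y \<in> ob G" "hom G x y \<noteq> {}"
  shows "card (hom G x y) = card (hom G y y)"
proof -
  obtain f g where f: "f \<in> hom G x y" and g: "g \<in> hom G y x"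
    and fg: "cmp G x y x g f = ide G x" "cmp G y x y f g = ide G y"
    using assms inverse by blast
  have "bij_betw (\<lambda>h. cmp G y x y h g) (hom G x y) (hom G y y)"
  proof (rule bij_betw_byWitness[where f' = "\<lambda>h. cmp G x y y h f"])
    show "\<forall>h\<in>hom G x y. cmp G x y y (cmp G y x y h g) f = h"
      using assms f g fg by (simp add: cmp_assoc ide_right)
    show "\<forall>h\<in>hom G y y. cmp G y x y (cmp G x y y h f) g = h"
      using assms f g fg by (simp add: cmp_assoc ide_right)
  qed (use assms f g in \<open>auto intro: cmp_closed\<close>)
  then show ?thesis by (rule bij_betw_same_card)
qed

end

section \<open>The standard homotopy pullback\<close>

lemma iso_comma_simps [simp]:
  "(x, y, \<gamma>) \<in> ob (iso_comma A B C f g) \<longleftrightarrow>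
    x \<in> ob A \<and> y \<in> ob B \<and> \<gamma> \<in> hom C (on_ob f x) (on_ob g y)"
  "(m, n) \<in> hom (iso_comma A B C f g) (x, y, \<gamma>) (x', y', \<gamma>') \<longleftrightarrow>
    m \<in> hom A x x' \<and> n \<in> hom B y y' \<and>
    cmp C (on_ob f x) (on_ob f x') (on_ob g y') \<gamma>' (on_hom f x x' m) =
    cmp C (on_ob f x) (on_ob g y) (on_ob g y') (on_hom g y y' n) \<gamma>"
  "ide (iso_comma A B C f g) (x, y, \<gamma>) = (ide A x, ide B y)"
  "cmp (iso_comma A B C f g) (x, y, \<gamma>) (x', y', \<gamma>') (x'', y'', \<gamma>'') (m', n') (m, n) =
    (cmp A x x' x'' m' m, cmp B y y' y'' n' n)"
  by (auto simp: iso_comma_def)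

lemma groupoid_iso_comma:
  assumes "groupoid_functor A C f" "groupoid_functor B C g"
  shows "groupoid (iso_comma A B C f g)"
proof -
  interpret f: groupoid_functor A C f by fact
  interpret g: groupoid_functor B C g by fact
  show ?thesis
  proof (unfold_locales, goal_cases)
    case (1 x)
    then show ?case
      by (cases x) (auto simp: f.on_hom_ide g.on_hom_ide f.cod.ide_left f.cod.ide_right
          f.on_ob_closed g.on_ob_closed f.dom.ide_closed g.dom.ide_closed)
  next
    case (2 x y z f' g')
    obtain a b \<gamma> a' b' \<gamma>' a'' b'' \<gamma>'' m n m' n' where eqs: "x = (a, b, \<gamma>)" "y = (a', b', \<gamma>')"
      "z = (a'', b'', \<gamma>'')" "f' = (m, n)" "g' = (m', n')"
      by (cases x; cases y; cases z; cases f'; cases g')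
    from 2 have o: "a \<in> ob A" "a' \<in> ob A" "a'' \<in> ob A" "b \<in> ob B" "b' \<in> ob B" "b'' \<in> ob B"
      "\<gamma> \<in> hom C (on_ob f a) (on_ob g b)" "\<gamma>' \<in> hom C (on_ob f a') (on_ob g b')"
      "\<gamma>'' \<in> hom C (on_ob f a'') (on_ob g b'')"
      "m \<in> hom A a a'" "n \<in> hom B b b'" "m' \<in> hom A a' a''" "n' \<in> hom B b' b''"
      and sq: "cmp C (on_ob f a) (on_ob f a') (on_ob g b') \<gamma>' (on_hom f a a' m) =
         cmp C (on_ob f a) (on_ob g b) (on_ob g b') (on_hom g b b' n) \<gamma>"
        "cmp C (on_ob f a') (on_ob f a'') (on_ob g b'') \<gamma>'' (on_hom f a' a'' m') =
         cmp C (on_ob f a') (on_ob g b') (on_ob g b'') (on_hom g b' b'' n') \<gamma>'"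
      by (auto simp: eqs)
    note closed = f.on_ob_closed g.on_ob_closed f.on_hom_closed g.on_hom_closed
    have "cmp C (on_ob f a) (on_ob f a'') (on_ob g b'') \<gamma>'' (on_hom f a a'' (cmp A a a' a'' m' m)) =
        cmp C (on_ob f a) (on_ob g b) (on_ob g b'') (on_hom g b b'' (cmp B b b' b'' n' n)) \<gamma>"
      unfolding f.on_hom_cmp[OF o(1-3,10,12)] g.on_hom_cmp[OF o(4-6,11,13)]
      by (rule f.cod.square_paste[OF _ _ _ _ _ _ _ _ _ _ _ _ _ sq]) (use o in \<open>simp_all add: closed\<close>)
    with o show ?case by (simp add: eqs f.dom.cmp_closed g.dom.cmp_closed)
  next
    case (3 x y f)
    then show ?case
      by (cases x; cases y; cases f) (simp add: f.dom.ide_right g.dom.ide_right)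
  next
    case (4 x y f)
    then show ?case
      by (cases x; cases y; cases f) (simp add: f.dom.ide_left g.dom.ide_left)
  next
    case (5 w x y z f g h)
    then show ?case
      by (cases w; cases x; cases y; cases z; cases f; cases g; cases h)
        (simp add: f.dom.cmp_assoc g.dom.cmp_assoc)
  next
    case (6 x y f')
    obtain a b \<gamma> a' b' \<gamma>' m n where eqs: "x = (a, b, \<gamma>)" "y = (a', b', \<gamma>')" "f' = (m, n)"
      by (cases x; cases y; cases f')
    from 6 have o: "a \<in> ob A" "a' \<in> ob A" "b \<in> ob B" "b' \<in> ob B"
      "\<gamma> \<in> hom C (on_ob f a) (on_ob g b)" "\<gamma>' \<in> hom C (on_ob f a') (on_ob g b')"
      and h: "m \<in> hom A a a'" "n \<in> hom B b b'"
      and sq: "cmp C (on_ob f a) (on_ob f a') (on_ob g b') \<gamma>' (on_hom f a a' m) =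
         cmp C (on_ob f a) (on_ob g b) (on_ob g b') (on_hom g b b' n) \<gamma>"
      by (auto simp: eqs)
    obtain m' where m': "m' \<in> hom A a' a" "cmp A a a' a m' m = ide A a" "cmp A a' a a' m m' = ide A a'"
      using f.dom.inverse o h by blast
    obtain n' where n': "n' \<in> hom B b' b" "cmp B b b' b n' n = ide B b" "cmp B b' b b' n n' = ide B b'"
      using g.dom.inverse o h by blast
    have "cmp C (on_ob f a') (on_ob f a) (on_ob f a') (on_hom f a a' m) (on_hom f a' a m') = ide C (on_ob f a')"
      using o h m' f.on_hom_cmp[of a' a a' m' m] by (simp add: f.on_hom_ide)
    moreover have "cmp C (on_ob g b) (on_ob g b') (on_ob g b) (on_hom g b' b n') (on_hom g b b' n) = ide C (on_ob g b)"
      using o h n' g.on_hom_cmp[of b b' b n n'] by (simp add: g.on_hom_ide)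
    ultimately have "cmp C (on_ob f a') (on_ob f a) (on_ob g b) \<gamma> (on_hom f a' a m') =
        cmp C (on_ob f a') (on_ob g b') (on_ob g b) (on_hom g b' b n') \<gamma>'"
      by (intro f.cod.square_inverse[OF _ _ _ _ _ _ _ _ _ _ sq])
        (use o h m'(1) n'(1) in \<open>simp_all add: f.on_ob_closed g.on_ob_closed f.on_hom_closed g.on_hom_closed\<close>)
    then show ?case using m' n' unfolding eqs by (intro bexI[of _ "(m', n')"]) auto
  qed
qed

text \<open>Between objects of the form (a p, b p, id) the square in \<open>iso_comma\<close>
  collapses to an equality, so \<open>arrows\<close> makes the comparison fully faithful. For
  essential surjectivity, (x, y, \<gamma>) is replaced by (x', y, id), where x' is the end of a lift
  of \<gamma> along \<open>f\<close>; \<open>objects\<close> provides a preimage of the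
  latter.\<close>

lemma homotopy_pullback_if_lifting:
  assumes "groupoid_functor P A a" "groupoid_functor P B b"
    and "groupoid_functor A C f" "groupoid_functor B C g"
    and comm: "fctr_eq P (fctr_comp f a) (fctr_comp g b)"
    and objects: "\<And>x y. \<lbrakk>x \<in> ob A; y \<in> ob B; on_ob f x = on_ob g y\<rbrakk>
      \<Longrightarrow> \<exists>p \<in> ob P. on_ob a p = x \<and> on_ob b p = y"
    and arrows: "\<And>p p' m n. \<lbrakk>p \<in> ob P; p' \<in> ob P; m \<in> hom A (on_ob a p) (on_ob a p');
      n \<in> hom B (on_ob b p) (on_ob b p');
      on_hom f (on_ob a p) (on_ob a p') m = on_hom g (on_ob b p) (on_ob b p') n\<rbrakk>
      \<Longrightarrow> \<exists>!l. l \<in> hom P p p' \<and> on_hom a p p' l = m \<and> on_hom b p p' l = n"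
    and lifting: "\<And>x z \<gamma>. \<lbrakk>x \<in> ob A; z \<in> ob C; \<gamma> \<in> hom C (on_ob f x) z\<rbrakk>
      \<Longrightarrow> \<exists>x' \<in> ob A. on_ob f x' = z \<and> (\<exists>m \<in> hom A x x'. on_hom f x x' m = \<gamma>)"
  shows "homotopy_pullback P A B C a b f g"
proof -
  interpret a: groupoid_functor P A a by fact
  interpret b: groupoid_functor P B b by fact
  interpret f: groupoid_functor A C f by fact
  interpret g: groupoid_functor B C g by fact
  interpret comma: groupoid "iso_comma A B C f g" by (rule groupoid_iso_comma) fact+
  have co: "on_ob g (on_ob b p) = on_ob f (on_ob a p)" if "p \<in> ob P" for p
    using comm that by (simp add: fctr_eq_def fctr_comp_def)
  have ch: "on_hom g (on_ob b p) (on_ob b p') (on_hom b p p' l) =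
      on_hom f (on_ob a p) (on_ob a p') (on_hom a p p' l)"
    if "p \<in> ob P" "p' \<in> ob P" "l \<in> hom P p p'" for p p' l
    using comm that by (simp add: fctr_eq_def fctr_comp_def)
  let ?F = "\<lparr>on_ob = (\<lambda>p. (on_ob a p, on_ob b p, ide C (on_ob f (on_ob a p)))),
        on_hom = (\<lambda>p p' m. (on_hom a p p' m, on_hom b p p' m))\<rparr>"
  have F: "groupoid_functor P (iso_comma A B C f g) ?F"
  proof (unfold_locales, goal_cases)
    case (1 x)
    then show ?case
      by (simp add: a.on_ob_closed b.on_ob_closed co f.on_ob_closed f.cod.ide_closed)
  next
    case (2 x y l)
    then have "on_hom f (on_ob a x) (on_ob a y) (on_hom a x y l) \<in>
        hom C (on_ob f (on_ob a x)) (on_ob f (on_ob a y))"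
      by (intro f.on_hom_closed a.on_hom_closed a.on_ob_closed)
    with 2 show ?case
      by (simp add: a.on_ob_closed b.on_ob_closed a.on_hom_closed b.on_hom_closed co ch
          f.on_ob_closed f.cod.ide_left f.cod.ide_right)
  next
    case (3 x)
    then show ?case by (simp add: a.on_hom_ide b.on_hom_ide)
  next
    case (4 x y z l l')
    then show ?case by (simp add: a.on_hom_cmp b.on_hom_cmp)
  qed
  have bij: "bij_betw (on_hom ?F p p') (hom P p p')
      (hom (iso_comma A B C f g) (on_ob ?F p) (on_ob ?F p'))" if p: "p \<in> ob P" "p' \<in> ob P" for p p'
  proof -
    have eq: "on_hom f (on_ob a p) (on_ob a p') m = on_hom g (on_ob b p) (on_ob b p') n"
      and mn: "m \<in> hom A (on_ob a p) (on_ob a p')" "n \<in> hom B (on_ob b p) (on_ob b p')"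
      if "(m, n) \<in> hom (iso_comma A B C f g) (on_ob ?F p) (on_ob ?F p')" for m n
    proof -
      show mn: "m \<in> hom A (on_ob a p) (on_ob a p')" "n \<in> hom B (on_ob b p) (on_ob b p')"
        using that by auto
      have "on_hom f (on_ob a p) (on_ob a p') m \<in> hom C (on_ob f (on_ob a p)) (on_ob f (on_ob a p'))"
        "on_hom g (on_ob b p) (on_ob b p') n \<in> hom C (on_ob f (on_ob a p)) (on_ob f (on_ob a p'))"
        using mn p f.on_hom_closed[of "on_ob a p" "on_ob a p'" m]
          g.on_hom_closed[of "on_ob b p" "on_ob b p'" n]
        by (simp_all add: co a.on_ob_closed b.on_ob_closed)
      then show "on_hom f (on_ob a p) (on_ob a p') m = on_hom g (on_ob b p) (on_ob b p') n"
        using that p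
        by (simp add: co a.on_ob_closed b.on_ob_closed f.on_ob_closed f.cod.ide_left f.cod.ide_right)
    qed
    show ?thesis
    proof (rule bij_betw_imageI)
      show "inj_on (on_hom ?F p p') (hom P p p')"
      proof (rule inj_onI)
        fix l l' assume l: "l \<in> hom P p p'" "l' \<in> hom P p p'" "on_hom ?F p p' l = on_hom ?F p p' l'"
        \<comment> \<open>Both \<open>l\<close> and \<open>l'\<close> solve the problem posed by the
          two images of \<open>l\<close>, hence they agree.\<close>
        have "\<exists>!k. k \<in> hom P p p' \<and> on_hom a p p' k = on_hom a p p' l \<and> on_hom b p p' k = on_hom b p p' l"
          using l p by (intro arrows) (auto simp: ch a.on_hom_closed b.on_hom_closed)
        with l show "l = l'" by auto
      qed
      show "on_hom ?F p p' ` hom P p p' = hom (iso_comma A B C f g) (on_ob ?F p) (on_ob ?F p')"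
      proof
        show "on_hom ?F p p' ` hom P p p' \<subseteq> hom (iso_comma A B C f g) (on_ob ?F p) (on_ob ?F p')"
          using groupoid_functor.on_hom_closed[OF F p] by blast
        show "hom (iso_comma A B C f g) (on_ob ?F p) (on_ob ?F p') \<subseteq> on_hom ?F p p' ` hom P p p'"
        proof
          fix h assume h: "h \<in> hom (iso_comma A B C f g) (on_ob ?F p) (on_ob ?F p')"
          obtain m n where h': "h = (m, n)" by (cases h)
          obtain l where "l \<in> hom P p p'" "on_hom a p p' l = m" "on_hom b p p' l = n"
            using arrows[OF p mn eq, of m n] h unfolding h' by blast
          then show "h \<in> on_hom ?F p p' ` hom P p p'" by (auto simp: h')
        qed
      qed
    qed
  qed
  have surj: "\<exists>p \<in> ob P. hom (iso_comma A B C f g) (on_ob ?F p) z \<noteq> {}"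
    if z: "z \<in> ob (iso_comma A B C f g)" for z
  proof -
    obtain x y \<gamma> where z': "z = (x, y, \<gamma>)" by (cases z)
    have xy: "x \<in> ob A" "y \<in> ob B" "\<gamma> \<in> hom C (on_ob f x) (on_ob g y)" using z by (auto simp: z')
    obtain x' m where m: "x' \<in> ob A" "on_ob f x' = on_ob g y" "m \<in> hom A x x'" "on_hom f x x' m = \<gamma>"
      using lifting[OF xy(1) g.on_ob_closed[OF xy(2)] xy(3)] by blast
    obtain p where p: "p \<in> ob P" "on_ob a p = x'" "on_ob b p = y" using objects[OF m(1) xy(2) m(2)] by blast
    \<comment> \<open>The lift runs from x to x', but the required arrow starts at the object over
      x'; hence its inverse.\<close>
    obtain m' where m': "m' \<in> hom A x' x" "cmp A x' x x' m m' = ide A x'"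
      using a.cod.inverse[OF xy(1) m(1,3)] by blast
    have "cmp C (on_ob f x') (on_ob f x) (on_ob f x') \<gamma> (on_hom f x' x m') = ide C (on_ob f x')"
      using f.on_hom_cmp[OF m(1) xy(1) m(1) m'(1) m(3)] m'(2) m by (simp add: f.on_hom_ide)
    then have "(m', ide B y) \<in> hom (iso_comma A B C f g) (on_ob ?F p) z"
      using m m' p xy unfolding z'
      by (simp add: b.cod.ide_closed g.on_hom_ide g.on_ob_closed f.cod.ide_left f.cod.ide_closed)
    with p(1) show ?thesis by blast
  qed
  show ?thesis
    unfolding homotopy_pullback_def equivalence_def using assms(1-5) F bij surj by blast
qed

section \<open>Homotopy fibres and products of groupoids\<close>

lemma homotopy_fibre_simps [simp]:
  "(x, \<gamma>) \<in> ob (homotopy_fibre G H F y) \<longleftrightarrow> x \<in> ob G \<and> \<gamma> \<in> hom H (on_ob F x) y"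
  "m \<in> hom (homotopy_fibre G H F y) (x, \<gamma>) (x', \<gamma>') \<longleftrightarrow>
    m \<in> hom G x x' \<and> cmp H (on_ob F x) (on_ob F x') y \<gamma>' (on_hom F x x' m) = \<gamma>"
  "ide (homotopy_fibre G H F y) (x, \<gamma>) = ide G x"
  "cmp (homotopy_fibre G H F y) (x, \<gamma>) (x', \<gamma>') (x'', \<gamma>'') = cmp G x x' x''"
  by (auto simp: homotopy_fibre_def)

lemma groupoid_homotopy_fibre:
  assumes "groupoid_functor G H F" "y \<in> ob H"
  shows "groupoid (homotopy_fibre G H F y)"
proof -
  interpret F: groupoid_functor G H F by fact
  show ?thesis
  proof (unfold_locales, goal_cases)
    case (1 x)
    then show ?case
      using assms(2) by (cases x) (auto simp: F.on_hom_ide F.cod.ide_right F.on_ob_closed F.dom.ide_closed)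
  next
    case (2 x y z f' g')
    then show ?case
      using assms(2)
      by (cases x; cases y; cases z)
        (auto simp: F.on_hom_cmp F.cod.cmp_assoc[symmetric] F.on_ob_closed F.on_hom_closed
          intro: F.dom.cmp_closed)
  next
    case (3 x y f)
    then show ?case by (cases x; cases y) (simp add: F.dom.ide_right)
  next
    case (4 x y f)
    then show ?case by (cases x; cases y) (simp add: F.dom.ide_left)
  next
    case (5 w x y z f g h)
    then show ?case by (cases w; cases x; cases y; cases z) (simp add: F.dom.cmp_assoc)
  next
    case (6 u v m)
    obtain a \<gamma> a' \<gamma>' where eqs: "u = (a, \<gamma>)" "v = (a', \<gamma>')" by (cases u; cases v)
    from 6 have o: "a \<in> ob G" "a' \<in> ob G" "\<gamma>' \<in> hom H (on_ob F a') y" "m \<in> hom G a a'"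
      and \<gamma>: "cmp H (on_ob F a) (on_ob F a') y \<gamma>' (on_hom F a a' m) = \<gamma>"
      by (auto simp: eqs)
    obtain m' where m': "m' \<in> hom G a' a" "cmp G a a' a m' m = ide G a" "cmp G a' a a' m m' = ide G a'"
      using F.dom.inverse o by blast
    have "cmp H (on_ob F a') (on_ob F a) (on_ob F a') (on_hom F a a' m) (on_hom F a' a m') = ide H (on_ob F a')"
      using o m' F.on_hom_cmp[of a' a a' m' m] by (simp add: F.on_hom_ide)
    then have "cmp H (on_ob F a') (on_ob F a) y \<gamma> (on_hom F a' a m') = \<gamma>'"
      using o m' assms(2) unfolding \<gamma>[symmetric]
      by (simp add: F.cod.cmp_assoc F.on_ob_closed F.on_hom_closed F.cod.ide_right)
    then show ?case using m' unfolding eqs by (intro bexI[of _ m']) auto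
  qed
qed

lemma groupoid_prod_category:
  assumes "groupoid G" "groupoid H"
  shows "groupoid (prod_category G H)"
proof -
  interpret G: groupoid G by fact
  interpret H: groupoid H by fact
  show ?thesis
  proof (unfold_locales, goal_cases)
    case (6 u v h)
    obtain x y x' y' m n where eqs: "u = (x, y)" "v = (x', y')" "h = (m, n)"
      by (cases u; cases v; cases h)
    obtain m' where "m' \<in> hom G x' x" "cmp G x x' x m' m = ide G x" "cmp G x' x x' m m' = ide G x'"
      using G.inverse[of x x' m] 6 by (auto simp: eqs prod_category_def)
    moreover obtain n' where "n' \<in> hom H y' y" "cmp H y y' y n' n = ide H y" "cmp H y' y y' n n' = ide H y'"
      using H.inverse[of y y' n] 6 by (auto simp: eqs prod_category_def)
    ultimately show ?case
      by (intro bexI[of _ "(m', n')"]) (auto simp: eqs prod_category_def)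
  qed (auto simp: prod_category_def G.ide_closed H.ide_closed G.ide_left H.ide_left G.ide_right
      H.ide_right G.cmp_assoc H.cmp_assoc G.cmp_closed H.cmp_closed)
qed

lemma groupoid_functor_pair:
  assumes "groupoid_functor K G F" "groupoid_functor K H F'"
  shows "groupoid_functor K (prod_category G H) (fctr_pair F F')"
proof -
  interpret F: groupoid_functor K G F by fact
  interpret F': groupoid_functor K H F' by fact
  interpret groupoid "prod_category G H"
    by (rule groupoid_prod_category) (fact F.cod.groupoid_axioms F'.cod.groupoid_axioms)+
  show ?thesis
    by (unfold_locales, unfold prod_category_def fctr_pair_def)
      (simp_all add: F.on_hom_ide F'.on_hom_ide F.on_hom_cmp F'.on_hom_cmp
        F.on_ob_closed F'.on_ob_closed F.on_hom_closed F'.on_hom_closed)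
qed

section \<open>The simplicial groupoid of a restriction species\<close>

lemma Delta_mono: "\<phi> \<in> Delta m n \<Longrightarrow> i \<le> j \<Longrightarrow> j \<le> m \<Longrightarrow> \<phi> i \<le> \<phi> j"
  by (auto simp: Delta_def monotone_on_def)

lemma Delta_le: "\<phi> \<in> Delta m n \<Longrightarrow> i \<le> m \<Longrightarrow> \<phi> i \<le> n"
  by (auto simp: Delta_def)

lemma Delta_compose: "\<phi> \<in> Delta l m \<Longrightarrow> \<psi> \<in> Delta m n \<Longrightarrow> compose {..l} \<psi> \<phi> \<in> Delta l n"
  unfolding Delta_def monotone_on_def compose_def by (auto simp: PiE_iff Pi_iff)

lemma Delta_id: "(\<lambda>i\<in>{..n}. i) \<in> Delta n n"
  by (auto simp: Delta_def monotone_on_def)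

text \<open>The definite description in \<open>new_part\<close> is met by the least \<open>j\<close>
  with i \<le> \<phi> j: it is positive because \<phi> 0 < i, and \<open>j - 1\<close> fails by
  minimality.\<close>

lemma new_part:
  assumes "\<phi> \<in> Delta m n" "\<phi> 0 < i" "i \<le> \<phi> m"
  shows "new_part m \<phi> i \<in> {1..m}" "\<phi> (new_part m \<phi> i - 1) < i" "i \<le> \<phi> (new_part m \<phi> i)"
proof -
  define j where "j = (LEAST j. i \<le> \<phi> j)"
  have j: "i \<le> \<phi> j" "j \<le> m"
    using assms(3) unfolding j_def by (auto intro: LeastI Least_le)
  have "j \<noteq> 0" using j(1) assms(2) by (metis not_le)
  moreover from this have "\<phi> (j - 1) < i"
    using not_less_Least[of "j - 1" "\<lambda>j. i \<le> \<phi> j"] by (simp add: j_def[symmetric])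
  ultimately have "new_part m \<phi> i = j"
    using j by (intro new_part_eqI[OF assms(1)]) auto
  with j \<open>j \<noteq> 0\<close> \<open>\<phi> (j - 1) < i\<close>
  show "new_part m \<phi> i \<in> {1..m}" "\<phi> (new_part m \<phi> i - 1) < i" "i \<le> \<phi> (new_part m \<phi> i)" by auto
qed

text \<open>A Galois connection: on the kept indices, \<open>new_part m \<phi>\<close> is left
  adjoint to \<phi>. Functoriality of \<open>part_act\<close> comes from the composition of
  adjoints.\<close>

lemma new_part_le_iff:
  assumes "\<phi> \<in> Delta m n" "\<phi> 0 < i" "i \<le> \<phi> m" "l \<le> m"
  shows "new_part m \<phi> i \<le> l \<longleftrightarrow> i \<le> \<phi> l"
proof
  assume "new_part m \<phi> i \<le> l"
  then show "i \<le> \<phi> l"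
    using new_part(3)[OF assms(1-3)] Delta_mono[OF assms(1)] assms(4) le_trans by blast
next
  assume "i \<le> \<phi> l"
  show "new_part m \<phi> i \<le> l"
  proof (rule ccontr)
    assume "\<not> new_part m \<phi> i \<le> l"
    then have "\<phi> l \<le> \<phi> (new_part m \<phi> i - 1)"
      using new_part(1)[OF assms(1-3)] by (intro Delta_mono[OF assms(1)]) auto
    then show False using new_part(2)[OF assms(1-3)] \<open>i \<le> \<phi> l\<close> by linarith
  qed
qed

text \<open>The adjunction of \<psi> is used directly at \<open>\<phi> l\<close> and in negated form
  at \<open>\<phi> 0\<close>; monotonicity of \<psi> supplies the outer bounds.\<close>

lemma kept_compose_iff:
  assumes "\<phi> \<in> Delta l m" "\<psi> \<in> Delta m n"
  shows "\<psi> (\<phi> 0) < i \<and> i \<le> \<psi> (\<phi> l) \<longleftrightarrow>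
    \<psi> 0 < i \<and> i \<le> \<psi> m \<and> \<phi> 0 < new_part m \<psi> i \<and> new_part m \<psi> i \<le> \<phi> l"
proof -
  have "\<psi> 0 \<le> \<psi> (\<phi> 0)" "\<psi> (\<phi> l) \<le> \<psi> m" "\<phi> 0 \<le> m" "\<phi> l \<le> m"
    using assms by (auto intro: Delta_mono Delta_le)
  then show ?thesis
    using new_part_le_iff[OF assms(2), of i "\<phi> 0"] new_part_le_iff[OF assms(2), of i "\<phi> l"]
    by (meson le_trans not_le order.strict_trans2 order.strict_trans1)
qed

lemma new_part_compose:
  assumes "\<phi> \<in> Delta l m" "\<psi> \<in> Delta m n" "\<psi> (\<phi> 0) < i" "i \<le> \<psi> (\<phi> l)"
  shows "new_part l (compose {..l} \<psi> \<phi>) i = new_part l \<phi> (new_part m \<psi> i)"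
proof -
  have k: "\<psi> 0 < i" "i \<le> \<psi> m" "\<phi> 0 < new_part m \<psi> i" "new_part m \<psi> i \<le> \<phi> l"
    using kept_compose_iff[OF assms(1,2)] assms(3,4) by blast+
  note np = new_part[OF assms(1) k(3,4)]
  show ?thesis
  proof (rule new_part_eqI[OF Delta_compose[OF assms(1,2)] np(1)])
    let ?j = "new_part l \<phi> (new_part m \<psi> i)"
    have "?j - 1 \<le> l" "?j \<le> l" using np(1) by auto
    then have le: "\<phi> (?j - 1) \<le> m" "\<phi> ?j \<le> m" using Delta_le[OF assms(1)] by auto
    show "compose {..l} \<psi> \<phi> (?j - 1) < i"
      using new_part_le_iff[OF assms(2) k(1,2) le(1)] np(2) \<open>?j - 1 \<le> l\<close> by (simp add: compose_def)
    show "i \<le> compose {..l} \<psi> \<phi> ?j"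
      using new_part_le_iff[OF assms(2) k(1,2) le(2)] np(3) \<open>?j \<le> l\<close> by (simp add: compose_def)
  qed
qed

section \<open>The levels and the simplicial action\<close>

lemma part_level_simps [simp]:
  "(S, X, p) \<in> ob (part_level R k) \<longleftrightarrow> finite S \<and> X \<in> strs R S \<and> p \<in> S \<rightarrow>\<^sub>E {1..k}"
  "f \<in> hom (part_level R k) (S, X, p) (T, Y, q) \<longleftrightarrow>
    f \<in> struct_isos R (S, X) (T, Y) \<and> (\<forall>s \<in> S. q (f s) = p s)"
  "ide (part_level R k) (S, X, p) = (\<lambda>s\<in>S. s)"
  "cmp (part_level R k) (S, X, p) y z g f = compose S g f"
  by (auto simp: part_level_def)

lemma part_act_simps [simp]:
  "on_ob (part_act R m n \<phi>) (S, X, p) = (kept m \<phi> (S, X, p), restr R S X (kept m \<phi> (S, X, p)),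
     \<lambda>s\<in>kept m \<phi> (S, X, p). new_part m \<phi> (p s))"
  "on_hom (part_act R m n \<phi>) x y f = restrict f (kept m \<phi> x)"
  by (simp_all add: part_act_def)

lemma species_functor_simps [simp]:
  "on_ob (species_functor \<alpha> k) (S, X, p) = (S, \<alpha> S X, p)"
  "on_hom (species_functor \<alpha> k) x y f = f"
  by (simp_all add: species_functor_def)

lemma species_simplicial_simps [simp]:
  "level (species_simplicial R) = part_level R" "act (species_simplicial R) = part_act R"
  by (simp_all add: species_simplicial_def)

lemma struct_isosD:
  assumes "f \<in> struct_isos R (S, X) (T, Y)"
  shows "bij_betw f S T" "f \<in> S \<rightarrow>\<^sub>E T" "pull R S T f Y = X" "f ` S = T" "\<And>s. s \<in> S \<Longrightarrow> f s \<in> T"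
    "restrict f S = f"
  using assms by (auto simp: struct_isos_def bij_betw_def PiE_def extensional_restrict)

text \<open>Preservation of the end-points puts every part index into the kept range, so nothing is
  deleted.\<close>

lemma generic_kept:
  assumes "generic m n \<phi>" "p \<in> S \<rightarrow>\<^sub>E {1..n}"
  shows "kept m \<phi> (S, X, p) = S"
  using assms by (force simp: kept_def generic_def)

context restriction_species
begin

lemma restr_restr:
  assumes "finite S" "X \<in> strs R S" "B \<subseteq> A" "A \<subseteq> S"
  shows "restr R A (restr R S X A) B = restr R S X B"
proof -
  have "finite A" using assms(1,4) by (rule rev_finite_subset)
  moreover from this have "finite B" using assms(3) by (rule rev_finite_subset)
  moreover have "(\<lambda>s\<in>B. s) \<in> injections B A" "(\<lambda>s\<in>A. s) \<in> injections A S"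
    using assms by (auto simp: injections_def inj_on_def)
  moreover have "compose B (\<lambda>s\<in>A. s) (\<lambda>s\<in>B. s) = (\<lambda>s\<in>B. s)"
    using assms(3) by (auto simp: compose_def fun_eq_iff)
  ultimately show ?thesis
    unfolding restr_def using pull_comp[of B A S "\<lambda>s\<in>B. s" "\<lambda>s\<in>A. s" X] assms by simp
qed

lemma groupoid_part_level: "groupoid (part_level R k)"
proof (unfold_locales, goal_cases)
  case (1 x)
  then show ?case
    by (cases x) (auto simp: struct_isos_def pull_id bij_betw_def inj_on_def)
next
  case (2 x y z f g)
  then show ?case
    by (cases x; cases y; cases z) (auto intro: struct_isos_comp dest: struct_isosD(5) simp: compose_eq)
next
  case (3 x y f)
  then show ?case
    by (cases x; cases y) (auto simp: struct_isos_def compose_def fun_eq_iff PiE_def extensional_def)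
next
  case (4 x y f)
  then show ?case
    by (cases x; cases y) (auto simp: struct_isos_def compose_def fun_eq_iff PiE_def extensional_def)
next
  case (5 w x y z f g h)
  then show ?case
    by (cases w; cases x; cases y; cases z) (auto simp: struct_isos_def compose_def fun_eq_iff)
next
  case (6 x y f)
  obtain S X p T Y q where xy: "x = (S, X, p)" "y = (T, Y, q)" by (metis prod_cases3)
  from 6 have f: "f \<in> struct_isos R (S, X) (T, Y)" "\<forall>s \<in> S. q (f s) = p s"
    and fin: "finite S" "finite T" "Y \<in> strs R T"
    by (auto simp: xy)
  obtain g where g: "g \<in> struct_isos R (T, Y) (S, X)"
    "compose S g f = (\<lambda>s\<in>S. s)" "compose T f g = (\<lambda>s\<in>T. s)"
    using struct_isos_inverse[OF fin f(1)] by blast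
  have "p (g t) = q t" if "t \<in> T" for t
    using f(2) struct_isosD(5)[OF g(1) that] fun_cong[OF g(3), of t] that by (auto simp: compose_def)
  with g show ?case unfolding xy by (intro bexI[of _ g]) auto
qed

lemma part_act_on_ob_closed:
  assumes "\<phi> \<in> Delta m n" "x \<in> ob (part_level R n)"
  shows "on_ob (part_act R m n \<phi>) x \<in> ob (part_level R m)"
  using assms new_part(1)[OF assms(1)]
  by (cases x) (auto simp: kept_def intro!: restr_closed)

lemma groupoid_functor_part_act:
  assumes "\<phi> \<in> Delta m n"
  shows "groupoid_functor (part_level R n) (part_level R m) (part_act R m n \<phi>)"
proof -
  interpret dom: groupoid "part_level R n" by (rule groupoid_part_level)
  interpret cod: groupoid "part_level R m" by (rule groupoid_part_level)
  \<comment> \<open>An isomorphism compatible with the partitions carries kept elements onto kept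
    elements; this makes \<open>restrict_struct_iso\<close> applicable to the kept sets.\<close>
  have im: "f ` kept m \<phi> (S, X, p) = kept m \<phi> (T, Y, q)"
    if "f \<in> struct_isos R (S, X) (T, Y)" "\<forall>s \<in> S. q (f s) = p s" for f S X p T Y q
    using struct_isosD(4,5)[OF that(1)] that(2) by (fastforce simp: kept_def)
  show ?thesis
  proof (unfold_locales, goal_cases)
    case (1 x)
    then show ?case by (rule part_act_on_ob_closed[OF assms])
  next
    case (2 x y f)
    obtain S X p T Y q where xy: "x = (S, X, p)" "y = (T, Y, q)" by (metis prod_cases3)
    from 2 have f: "f \<in> struct_isos R (S, X) (T, Y)" "\<forall>s \<in> S. q (f s) = p s"
      and fin: "finite S" "finite T" "Y \<in> strs R T"
      by (auto simp: xy)
    have "kept m \<phi> (S, X, p) \<subseteq> S" by (auto simp: kept_def)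
    from restrict_struct_iso[OF fin f(1) this]
    have "restrict f (kept m \<phi> x) \<in> struct_isos R
        (kept m \<phi> x, restr R S X (kept m \<phi> x)) (kept m \<phi> y, restr R T Y (kept m \<phi> y))"
      unfolding im[OF f] xy .
    moreover have "f s \<in> kept m \<phi> (T, Y, q)" if "s \<in> kept m \<phi> (S, X, p)" for s
      using im[OF f] that by blast
    ultimately show ?case
      using f by (auto simp: xy) (auto simp: kept_def)
  next
    case (3 x)
    then show ?case by (cases x) (auto simp: kept_def fun_eq_iff)
  next
    case (4 x y z f g)
    obtain S X p T Y q where xy: "x = (S, X, p)" "y = (T, Y, q)" by (metis prod_cases3)
    from 4 have f: "f \<in> struct_isos R (S, X) (T, Y)" "\<forall>s \<in> S. q (f s) = p s"
      by (auto simp: xy)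
    have "f s \<in> kept m \<phi> (T, Y, q)" "s \<in> S" if "s \<in> kept m \<phi> (S, X, p)" for s
      using im[OF f] that by (auto simp: kept_def)
    then show ?case
      unfolding xy part_act_simps part_level_simps by (auto simp: compose_def fun_eq_iff)
  qed
qed

text \<open>The simplicial identities hold strictly: by \<open>kept_compose_iff\<close> both sides
  delete the same elements, and iterated restrictions agree on the nose by
  \<open>restr_restr\<close>.\<close>

lemma part_act_compose:
  assumes "\<phi> \<in> Delta l m" "\<psi> \<in> Delta m n"
  shows "fctr_eq (part_level R n) (part_act R l n (compose {..l} \<psi> \<phi>))
    (fctr_comp (part_act R l m \<phi>) (part_act R m n \<psi>))"
proof -
  have k: "kept l \<phi> (on_ob (part_act R m n \<psi>) (S, X, p)) = kept l (compose {..l} \<psi> \<phi>) (S, X, p)"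
    for S :: "'a set" and X :: 'r and p
    using kept_compose_iff[OF assms] by (auto simp: kept_def compose_def)
  have sub: "kept l (compose {..l} \<psi> \<phi>) (S, X, p) \<subseteq> kept m \<psi> (S, X, p)"
    "kept m \<psi> (S, X, p) \<subseteq> S" for S :: "'a set" and X :: 'r and p
    using kept_compose_iff[OF assms] by (auto simp: kept_def compose_def)
  have "new_part l (compose {..l} \<psi> \<phi>) (p s) = new_part l \<phi> (new_part m \<psi> (p s))"
    if "s \<in> kept l (compose {..l} \<psi> \<phi>) (S, X, p)" for S :: "'a set" and X :: 'r and p s
    using that by (intro new_part_compose[OF assms]) (auto simp: kept_def compose_def)
  moreover have "s \<in> kept m \<psi> (S, X, p)" if "s \<in> kept l (compose {..l} \<psi> \<phi>) (S, X, p)" for S :: "'a set" and X :: 'r and p s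
    using sub(1) that by blast
  ultimately show ?thesis
    using k sub unfolding fctr_eq_def fctr_comp_def
    by (auto simp: restr_restr Int_absorb1 Int_absorb2 intro!: restrict_ext)
qed

lemma part_act_id: "fctr_eq (part_level R n) (part_act R n n (\<lambda>i\<in>{..n}. i)) fctr_id"
proof -
  have gen: "generic n n (\<lambda>i\<in>{..n}. i)" by (simp add: generic_def)
  have "new_part n (\<lambda>i\<in>{..n}. i) i = i" if "i \<in> {1..n}" for i
    using that by (intro new_part_eqI[OF Delta_id]) auto
  then have "new_part n (\<lambda>i\<in>{..n}. i) (p s) = p s" if "p \<in> S \<rightarrow>\<^sub>E {1..n}" "s \<in> S" for p s and S :: "'a set"
    using that by (auto simp: PiE_def Pi_def)
  then have "(\<lambda>s\<in>S. new_part n (\<lambda>i\<in>{..n}. i) (p s)) = p" if "p \<in> S \<rightarrow>\<^sub>E {1..n}" for p and S :: "'a set"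
    using that by (auto simp: fun_eq_iff restrict_def PiE_def extensional_def)
  then show ?thesis
    unfolding fctr_eq_def fctr_id_def
    by (auto simp: generic_kept[OF gen] restr_self dest: struct_isosD(6))
qed

lemma simplicial_groupoid_species: "simplicial_groupoid (species_simplicial R)"
  unfolding simplicial_groupoid_def species_simplicial_simps
  using groupoid_part_level groupoid_functor_part_act part_act_id part_act_compose by blast

end

section \<open>Pushouts of generic maps along free maps\<close>

text \<open>The universal property applied to the explicit cocone \<open>F\<close>, \<open>G\<close>
  on [P] gives \<open>w\<close>; glueing f' and g' gives a map \<open>w'\<close> back. They are
  mutually inverse, and order isomorphisms of finite ordinals are identities, so the given cocone is
  the explicit one.\<close>

lemma pushout_Delta_explicit:
  assumes gen: "generic k m g" and fr: "free k f" and po: "pushout_Delta k m n p g f f' g'"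
  shows "f 0 + k \<le> n" "i \<le> k \<Longrightarrow> f i = f 0 + i" "p = n + m - k"
    and "i \<le> m \<Longrightarrow> f' i = f 0 + i"
    and "i \<le> n \<Longrightarrow> g' i = (if i \<le> f 0 then i else if i \<le> f 0 + k then f 0 + g (i - f 0) else i + m - k)"
proof -
  note D = po[unfolded pushout_Delta_def]
  have Delta: "g \<in> Delta k m" "f \<in> Delta k n" "f' \<in> Delta m p" "g' \<in> Delta n p"
    and comm: "compose {..k} f' g = compose {..k} g' f"
    using D by auto
  have univ: "\<exists>!w. w \<in> Delta p q \<and> compose {..m} w f' = u \<and> compose {..n} w g' = v"
    if "u \<in> Delta m q" "v \<in> Delta n q" "compose {..k} u g = compose {..k} v f" for q u v
    using D that by blast
  have g: "g 0 = 0" "g k = m" using gen by (auto simp: generic_def)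
  have f: "f i = f 0 + i" if "i \<le> k" for i
    using that
  proof (induction i)
    case (Suc i)
    then show ?case using fr by (auto simp: free_def)
  qed simp
  then show "i \<le> k \<Longrightarrow> f i = f 0 + i" for i .
  have fk: "f k = f 0 + k" using f[of k] by simp
  then show k: "f 0 + k \<le> n" using Delta_le[OF Delta(2), of k] by simp
  \<comment> \<open>The k + 1 points of [n] from f 0 to f 0 + k are replaced by m + 1 points. Points
    above them move by m - k, which may be negative; adding \<open>m\<close> before subtracting
    \<open>k\<close> keeps natural subtraction exact.\<close>
  define P where "P = n + m - k"
  define F where "F = (\<lambda>i\<in>{..m}. f 0 + i)"
  define G where "G = (\<lambda>i\<in>{..n}. if i \<le> f 0 then i else if i \<le> f 0 + k then f 0 + g (i - f 0) else i + m - k)"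
  have gm: "g i \<le> m" if "i \<le> k" for i using Delta_le[OF Delta(1) that] .
  have F: "F \<in> Delta m P" using k by (auto simp: F_def P_def Delta_def monotone_on_def)
  have gm': "g (i - f 0) \<le> m" if "i \<le> f 0 + k" for i
    using gm[of "i - f 0"] that by simp
  have "G i \<le> P" if "i \<le> n" for i
    using that k gm'[of i] by (auto simp: G_def P_def)
  moreover have "G i \<le> G j" if "i \<le> j" "j \<le> n" for i j
  proof -
    have "g (i - f 0) \<le> g (j - f 0)" if "j \<le> f 0 + k"
      using Delta_mono[OF Delta(1), of "i - f 0" "j - f 0"] that \<open>i \<le> j\<close> by simp
    then show ?thesis
      using that k gm'[of i] by (auto simp: G_def)
  qed
  ultimately have G: "G \<in> Delta n P" by (auto simp: Delta_def monotone_on_def G_def)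
  have FG: "compose {..k} F g = compose {..k} G f"
  proof (rule extensionalityI)
    fix i assume "i \<in> {..k}"
    then show "compose {..k} F g i = compose {..k} G f i"
      using gm[of i] k g f[of i] by (auto simp: compose_def F_def G_def)
  qed (auto simp: compose_def)
  obtain w where w: "w \<in> Delta p P" "compose {..m} w f' = F" "compose {..n} w g' = G"
    using univ[OF F G FG] by blast
  have wf: "w (f' i) = f 0 + i" if "i \<le> m" for i
    using fun_cong[OF w(2), of i] that by (simp add: compose_def F_def)
  have wg: "w (g' i) = G i" if "i \<le> n" for i
    using fun_cong[OF w(3), of i] that by (simp add: compose_def)
  have c: "f' (g i) = g' (f 0 + i)" if "i \<le> k" for i
    using fun_cong[OF comm, of i] that f[OF that] by (simp add: compose_def)
  have c0: "f' 0 = g' (f 0)" and ck: "f' m = g' (f 0 + k)" using c[of 0] c[of k] g by auto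
  \<comment> \<open>f' on the inserted segment and g' outside it. The pieces agree at the two ends
    of the segment by \<open>c0\<close> and \<open>ck\<close>.\<close>
  define w' where "w' = (\<lambda>i\<in>{..P}. if i \<le> f 0 then g' i else if i \<le> f 0 + m then f' (i - f 0) else g' (i + k - m))"
  note mf = Delta_mono[OF Delta(3)] and mg = Delta_mono[OF Delta(4)]
  have "w' i \<le> p" if "i \<le> P" for i
    using that k Delta_le[OF Delta(3), of "i - f 0"] Delta_le[OF Delta(4), of "i"]
      Delta_le[OF Delta(4), of "i + k - m"] by (auto simp: w'_def P_def)
  moreover have mono': "w' i \<le> w' j" if ij: "i \<le> j" "j \<le> P" for i j
  proof -
    \<comment> \<open>A comparison across an end of the segment passes through the value that f' and
      g' share there.\<close>
    have a: "g' i' \<le> f' j'" if "i' \<le> f 0" "j' \<le> m" for i' j'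
      using mg[of i' "f 0"] mf[of 0 j'] that k c0 by simp
    have b: "f' i' \<le> g' j'" if "f 0 + k \<le> j'" "j' \<le> n" "i' \<le> m" for i' j'
      using mg[of "f 0 + k" j'] mf[of i' m] that k ck by simp
    have "i \<le> P" using ij by simp
    consider "j \<le> f 0" | "i \<le> f 0" "f 0 < j" "j \<le> f 0 + m" | "i \<le> f 0" "f 0 + m < j"
      | "f 0 < i" "j \<le> f 0 + m" | "f 0 < i" "i \<le> f 0 + m" "f 0 + m < j" | "f 0 + m < i"
      using ij by linarith
    then show ?thesis
    proof cases
      case 1 then show ?thesis using ij k \<open>i \<le> P\<close> by (auto simp: w'_def intro: mg)
    next
      case 2 then show ?thesis using ij k \<open>i \<le> P\<close> by (auto simp: w'_def intro: a)
    next
      case 3 then show ?thesis using ij k \<open>i \<le> P\<close> by (auto simp: w'_def P_def intro!: mg)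
    next
      case 4 then show ?thesis using ij k \<open>i \<le> P\<close> by (auto simp: w'_def intro!: mf)
    next
      case 5 then show ?thesis using ij k \<open>i \<le> P\<close> by (auto simp: w'_def P_def intro!: b)
    next
      case 6 then show ?thesis using ij k \<open>i \<le> P\<close> by (auto simp: w'_def P_def intro!: mg)
    qed
  qed
  ultimately have w': "w' \<in> Delta P p" by (auto simp: Delta_def monotone_on_def w'_def)
  have w'F: "w' (F i) = f' i" if "i \<le> m" for i
    using that k c0 by (auto simp: w'_def F_def P_def)
  have w'G: "w' (G i) = g' i" if "i \<le> n" for i
  proof -
    have GP: "G i \<le> P" using Delta_le[OF G that] .
    consider "i \<le> f 0" | "f 0 < i" "i \<le> f 0 + k" | "f 0 + k < i" by linarith
    then show ?thesis
    proof cases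
      case 1
      then show ?thesis using that k GP by (simp add: w'_def G_def)
    next
      case 2
      then have "G i = F (g (i - f 0))" using gm[of "i - f 0"] that by (simp add: G_def F_def)
      then show ?thesis using w'F[OF gm[of "i - f 0"]] c[of "i - f 0"] 2 by simp
    next
      case 3
      then show ?thesis using that k GP by (auto simp: w'_def G_def)
    qed
  qed
  have ww': "w (w' i) = i" if "i \<le> P" for i
  proof -
    consider "i \<le> f 0" | "f 0 < i" "i \<le> f 0 + m" | "f 0 + m < i" by linarith
    then show ?thesis
    proof cases
      case 1
      then show ?thesis using that k wg[of i] by (simp add: w'_def G_def)
    next
      case 2
      then show ?thesis using that k wf[of "i - f 0"] by (simp add: w'_def)
    next
      case 3
      then show ?thesis using that k wg[of "i + k - m"] by (auto simp: w'_def G_def P_def)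
    qed
  qed
  have w'w: "w' (w i) = i" if "i \<le> p" for i
  proof -
    \<comment> \<open>The composite of \<open>w\<close> and \<open>w'\<close> and the identity both
      mediate from the given cocone to itself, so uniqueness equates them.\<close>
    let ?Q = "\<lambda>v. v \<in> Delta p p \<and> compose {..m} v f' = f' \<and> compose {..n} v g' = g'"
    have ext: "f' \<in> extensional {..m}" "g' \<in> extensional {..n}"
      using Delta by (auto simp: Delta_def PiE_def)
    have "f' i \<le> p" if "i \<le> m" for i using Delta_le[OF Delta(3) that] .
    moreover have "g' i \<le> p" if "i \<le> n" for i using Delta_le[OF Delta(4) that] .
    moreover have "w' (w (f' i)) = f' i" if "i \<le> m" for i
      using wf[OF that] w'F[OF that] that by (simp add: F_def)
    moreover have "w' (w (g' i)) = g' i" if "i \<le> n" for i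
      using wg[OF that] w'G[OF that] by simp
    ultimately have "?Q (compose {..p} w' w)" "?Q (\<lambda>i\<in>{..p}. i)"
      using Delta_compose[OF w(1) w'] Delta_id ext
      by (auto simp: fun_eq_iff compose_def extensional_def)
    then have "compose {..p} w' w = (\<lambda>i\<in>{..p}. i)"
      using univ[OF Delta(3,4) comm] by blast
    from fun_cong[OF this, of i] that show ?thesis by (simp add: compose_def)
  qed
  \<comment> \<open>An injective monotone map never falls below the identity. Applied to
    \<open>w\<close> and to its inverse \<open>w'\<close> this gives i \<le> w i \<le> w' (w i) =
    i.\<close>
  have above: "i \<le> v i" if "v \<in> Delta a b" "inj_on v {..a}" "i \<le> a" for v a b and i :: nat
    using that(3)
  proof (induction i)
    case (Suc i)
    moreover have "v i < v (Suc i)"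
      using Delta_mono[OF that(1), of i "Suc i"] inj_onD[OF that(2), of i "Suc i"] Suc.prems by fastforce
    ultimately show ?case by simp
  qed simp
  have inj: "inj_on w {..p}" "inj_on w' {..P}"
    by (rule inj_on_inverseI[where g = w'], use w'w in simp,
        rule inj_on_inverseI[where g = w], use ww' in simp)
  have w_id: "w i = i" if "i \<le> p" for i
    using above[OF w(1) inj(1) that] above[OF w' inj(2), of "w i"] Delta_le[OF w(1) that] w'w[OF that]
    by simp
  have "p \<le> P" using Delta_le[OF w(1), of p] w_id by simp
  moreover have "P \<le> p" using above[OF w' inj(2), of P] Delta_le[OF w', of P] by simp
  ultimately show "p = n + m - k" by (simp add: P_def)
  show "i \<le> m \<Longrightarrow> f' i = f 0 + i" for i
    using wf[of i] w_id[of "f' i"] Delta_le[OF Delta(3)] by simp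
  show "i \<le> n \<Longrightarrow> g' i = (if i \<le> f 0 then i else if i \<le> f 0 + k then f 0 + g (i - f 0) else i + m - k)" for i
    using wg[of i] w_id[of "g' i"] Delta_le[OF Delta(4)] by (simp add: G_def)
qed

section \<open>The decomposition condition for restriction species\<close>

context restriction_species
begin

lemma generic_on_ob:
  assumes "generic m n \<phi>" "(S, X, p) \<in> ob (part_level R n)"
  shows "on_ob (part_act R m n \<phi>) (S, X, p) = (S, X, \<lambda>s\<in>S. new_part m \<phi> (p s))"
  using assms by (simp add: generic_kept restr_self)

text \<open>The target already carries the structure \<open>Y\<close>; only the finer partition has
  to be transported, along the inverse of \<gamma>. The lift of \<gamma> is then \<gamma>
  itself.\<close>

lemma generic_lifting:
  assumes "\<phi> \<in> Delta m n" "generic m n \<phi>" "x \<in> ob (part_level R n)" "z \<in> ob (part_level R m)"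
    "\<gamma> \<in> hom (part_level R m) (on_ob (part_act R m n \<phi>) x) z"
  shows "\<exists>x' \<in> ob (part_level R n). on_ob (part_act R m n \<phi>) x' = z \<and>
    (\<exists>l \<in> hom (part_level R n) x x'. on_hom (part_act R m n \<phi>) x x' l = \<gamma>)"
proof -
  obtain S X p T Y q where xz: "x = (S, X, p)" "z = (T, Y, q)" by (metis prod_cases3)
  have x: "finite S" "X \<in> strs R S" "p \<in> S \<rightarrow>\<^sub>E {1..n}"
    and z: "finite T" "Y \<in> strs R T" "q \<in> T \<rightarrow>\<^sub>E {1..m}"
    using assms(3,4) by (auto simp: xz)
  have "(S, X, p) \<in> ob (part_level R n)" using x by simp
  from assms(5)[unfolded xz generic_on_ob[OF assms(2) this]]
  have \<gamma>: "\<gamma> \<in> struct_isos R (S, X) (T, Y)" "\<And>s. s \<in> S \<Longrightarrow> q (\<gamma> s) = new_part m \<phi> (p s)"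
    by auto
  define p' where "p' = (\<lambda>t\<in>T. p (inv_into S \<gamma> t))"
  have inv: "inv_into S \<gamma> t \<in> S" "\<gamma> (inv_into S \<gamma> t) = t" if "t \<in> T" for t
    using struct_isosD(4)[OF \<gamma>(1)] that by (auto intro: inv_into_into f_inv_into_f)
  have p': "p' \<in> T \<rightarrow>\<^sub>E {1..n}" using inv x(3) by (auto simp: p'_def)
  have p'\<gamma>: "p' (\<gamma> s) = p s" if "s \<in> S" for s
    using struct_isosD(1,5)[OF \<gamma>(1)] that by (auto simp: p'_def bij_betw_def)
  have x': "(T, Y, p') \<in> ob (part_level R n)" using z p' by simp
  have "(\<lambda>t\<in>T. new_part m \<phi> (p' t)) = q"
  proof (rule extensionalityI)
    fix t assume "t \<in> T"
    then show "(\<lambda>t\<in>T. new_part m \<phi> (p' t)) t = q t"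
      using \<gamma>(2)[OF inv(1)] inv(2) by (simp add: p'_def)
  qed (use z(3) in \<open>auto simp: PiE_def\<close>)
  then have "on_ob (part_act R m n \<phi>) (T, Y, p') = z"
    unfolding generic_on_ob[OF assms(2) x'] xz by simp
  moreover have "\<gamma> \<in> hom (part_level R n) x (T, Y, p')"
    using \<gamma>(1) p'\<gamma> by (simp add: xz)
  moreover have "on_hom (part_act R m n \<phi>) x (T, Y, p') \<gamma> = \<gamma>"
    using struct_isosD(6)[OF \<gamma>(1)] by (simp add: xz generic_kept[OF assms(2) x(3)])
  ultimately show ?thesis using x' by blast
qed

lemma generic_free_pullback:
  assumes gen: "generic k m g" and fr: "free k f" and po: "pushout_Delta k m n p g f f' g'"
  shows "homotopy_pullback (part_level R p) (part_level R m) (part_level R n) (part_level R k)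
    (part_act R m p f') (part_act R n p g') (part_act R k m g) (part_act R k n f)"
proof -
  note exp = pushout_Delta_explicit[OF assms]
  have Delta: "g \<in> Delta k m" "f \<in> Delta k n" "f' \<in> Delta m p" "g' \<in> Delta n p"
    and comm: "compose {..k} f' g = compose {..k} g' f"
    using po by (auto simp: pushout_Delta_def)
  have g: "g 0 = 0" "g k = m" using gen by (auto simp: generic_def)
  have g'1: "g' i = i" if "i \<le> f 0" for i using exp(1) exp(5)[of i] that by simp
  have g'2: "g' (f 0 + i) = f 0 + g i" if "i \<le> k" for i
    using exp(1) exp(5)[of "f 0 + i"] that g by simp
  have g'3: "g' i = i + m - k" if "f 0 + k \<le> i" "i \<le> n" for i
    using exp(5)[of i] that g by (cases "i = f 0 + k") auto
  have fk: "f k = f 0 + k" using exp(2)[of k] by simp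
  have f'0: "f' 0 = f 0" and f'm: "f' m = f 0 + m" using exp(4)[of 0] exp(4)[of m] by auto
  have gen': "generic n p g'"
    using g'1[of 0] g'3[of n] exp(1,3) by (simp add: generic_def)
  \<comment> \<open>Part \<open>c\<close> corresponds to the step from \<open>c - 1\<close> to
    \<open>c\<close>, so it lies in the segment exactly when f 0 < c \<le> f 0 + m, with a strict
    lower bound. The case distinctions below are below, inside and above this range.\<close>
  have np_f': "new_part m f' c = c - f 0" if "f 0 < c" "c \<le> f 0 + m" for c
    using that exp(4)[of "c - f 0 - 1"] exp(4)[of "c - f 0"]
    by (intro new_part_eqI[OF Delta(3)]) auto
  have np_f: "new_part k f c = c - f 0" if "f 0 < c" "c \<le> f 0 + k" for c
    using that exp(2)[of "c - f 0 - 1"] exp(2)[of "c - f 0"]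
    by (intro new_part_eqI[OF Delta(2)]) auto
  have np1: "new_part n g' c = c" if "1 \<le> c" "c \<le> f 0" for c
    using that g'1[of "c - 1"] g'1[of c] exp(1) by (intro new_part_eqI[OF Delta(4)]) auto
  have np2: "new_part n g' c = f 0 + new_part k g (c - f 0)" "new_part k g (c - f 0) \<in> {1..k}"
    if "f 0 < c" "c \<le> f 0 + m" for c
  proof -
    let ?j = "new_part k g (c - f 0)"
    note j = new_part[OF Delta(1), of "c - f 0"]
    have jk: "?j \<in> {1..k}" "g (?j - 1) < c - f 0" "c - f 0 \<le> g ?j"
      using j that g by auto
    show "new_part k g (c - f 0) \<in> {1..k}" by (rule jk(1))
    show "new_part n g' c = f 0 + new_part k g (c - f 0)"
    proof (rule new_part_eqI[OF Delta(4)])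
      have "g' (f 0 + (?j - 1)) = f 0 + g (?j - 1)" using jk(1) by (intro g'2) auto
      moreover have "f 0 + ?j - 1 = f 0 + (?j - 1)" using jk(1) by simp
      ultimately have "g' (f 0 + ?j - 1) = f 0 + g (?j - 1)" by simp
      then show "g' (f 0 + ?j - 1) < c" using jk(2) that by linarith
    qed (use jk that exp(1) g'2[of ?j] in auto)
  qed
  have np3: "new_part n g' c = c + k - m" if "f 0 + m < c" "c \<le> p" for c
    using that g'3[of "c + k - m"] g'3[of "c + k - m - 1"] exp(1,3)
    by (intro new_part_eqI[OF Delta(4)]) auto
  \<comment> \<open>Merging parts along g' moves no part into the segment or out of it, so deletion
    removes the same elements before and after merging.\<close>
  have kept_iff: "f 0 < new_part n g' c \<and> new_part n g' c \<le> f 0 + k \<longleftrightarrow> f 0 < c \<and> c \<le> f 0 + m"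
    if "c \<in> {1..p}" for c
  proof -
    consider "c \<le> f 0" | "f 0 < c" "c \<le> f 0 + m" | "f 0 + m < c" by linarith
    then show ?thesis
      using that np1[of c] np2[of c] np3[of c] by cases auto
  qed
  \<comment> \<open>Merging along g' loses information only inside the segment, and there f' retains
    the index: the two new indices together determine the old one.\<close>
  have inj: "c = c'"
    if c: "c \<in> {1..p}" "c' \<in> {1..p}" "new_part n g' c = new_part n g' c'"
      and f': "\<lbrakk>f 0 < c; c \<le> f 0 + m; f 0 < c'; c' \<le> f 0 + m\<rbrakk> \<Longrightarrow> new_part m f' c = new_part m f' c'"
    for c c'
  proof (cases "f 0 < c \<and> c \<le> f 0 + m")
    case True
    moreover from this have "f 0 < c' \<and> c' \<le> f 0 + m" using kept_iff[OF c(1)] kept_iff[OF c(2)] c(3) by auto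
    ultimately show ?thesis using f' np_f'[of c] np_f'[of c'] by auto
  next
    case False
    then have "\<not> (f 0 < c' \<and> c' \<le> f 0 + m)" using kept_iff[OF c(1)] kept_iff[OF c(2)] c(3) by auto
    then consider "c \<le> f 0" "c' \<le> f 0" | "c \<le> f 0" "f 0 + m < c'" | "f 0 + m < c" "c' \<le> f 0"
      | "f 0 + m < c" "f 0 + m < c'" using False by linarith
    then show ?thesis
      using np1[of c] np1[of c'] np3[of c] np3[of c'] c by cases auto
  qed
  show ?thesis
  proof (rule homotopy_pullback_if_lifting)
    show "groupoid_functor (part_level R p) (part_level R m) (part_act R m p f')"
      "groupoid_functor (part_level R p) (part_level R n) (part_act R n p g')"
      "groupoid_functor (part_level R m) (part_level R k) (part_act R k m g)"
      "groupoid_functor (part_level R n) (part_level R k) (part_act R k n f)"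
      using Delta by (auto intro: groupoid_functor_part_act)
    show comm': "fctr_eq (part_level R p) (fctr_comp (part_act R k m g) (part_act R m p f'))
        (fctr_comp (part_act R k n f) (part_act R n p g'))"
      using part_act_compose[OF Delta(1,3)] part_act_compose[OF Delta(2,4)]
      unfolding comm fctr_eq_def by metis
    show "\<exists>x' \<in> ob (part_level R m). on_ob (part_act R k m g) x' = z \<and>
        (\<exists>l \<in> hom (part_level R m) x x'. on_hom (part_act R k m g) x x' l = \<gamma>)"
      if "x \<in> ob (part_level R m)" "z \<in> ob (part_level R k)"
        "\<gamma> \<in> hom (part_level R k) (on_ob (part_act R k m g) x) z" for x z \<gamma>
      using generic_lifting[OF Delta(1) gen that] .
    show "\<exists>z \<in> ob (part_level R p). on_ob (part_act R m p f') z = x \<and> on_ob (part_act R n p g') z = y"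
      if xy: "x \<in> ob (part_level R m)" "y \<in> ob (part_level R n)"
        "on_ob (part_act R k m g) x = on_ob (part_act R k n f) y" for x y
    proof -
      obtain S X r T Y q where xy': "x = (S, X, r)" "y = (T, Y, q)" by (metis prod_cases3)
      have x: "finite S" "X \<in> strs R S" "r \<in> S \<rightarrow>\<^sub>E {1..m}"
        and y: "finite T" "Y \<in> strs R T" "q \<in> T \<rightarrow>\<^sub>E {1..n}"
        using xy by (auto simp: xy')
      have "(S, X, \<lambda>s\<in>S. new_part k g (r s)) = on_ob (part_act R k n f) (T, Y, q)"
        using xy(3) unfolding xy' generic_on_ob[OF gen xy(1)[unfolded xy']] .
      then have S: "S = kept k f (T, Y, q)" and X: "X = restr R T Y S"
        and npr: "(\<lambda>s\<in>S. new_part k g (r s)) = (\<lambda>s\<in>S. new_part k f (q s))"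
        by auto
      have S': "s \<in> S \<longleftrightarrow> s \<in> T \<and> f 0 < q s \<and> q s \<le> f 0 + k" for s
        unfolding S by (auto simp: kept_def fk)
      have rq: "f 0 + new_part k g (r s) = q s" if "s \<in> S" for s
        using fun_cong[OF npr, of s] that np_f[of "q s"] S'[of s] by simp
      have r: "1 \<le> r s" "r s \<le> m" if "s \<in> S" for s using x(3) that by auto
      have q: "1 \<le> q s" "q s \<le> n" if "s \<in> T" for s using y(3) that by auto
      \<comment> \<open>The glued partition: inside the segment the parts of the refinement
        \<open>r\<close>, moved up by f 0; below it the parts of \<open>q\<close>; above it the
        parts of \<open>q\<close>, moved by m - k.\<close>
      define w where "w = (\<lambda>t\<in>T. if t \<in> S then f 0 + r t else if q t \<le> f 0 then q t else q t + m - k)"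
      have wS: "f 0 < w t \<and> w t \<le> f 0 + m \<longleftrightarrow> t \<in> S" if "t \<in> T" for t
        using that r[of t] S'[of t] by (auto simp: w_def)
      have w: "w \<in> T \<rightarrow>\<^sub>E {1..p}"
      proof (rule PiE_I)
        fix t assume t: "t \<in> T"
        show "w t \<in> {1..p}"
          using t q[OF t] r[of t] S'[of t] exp(1,3) by (auto simp: w_def)
      qed (simp add: w_def)
      then have z: "(T, Y, w) \<in> ob (part_level R p)" using y by simp
      have K: "kept m f' (T, Y, w) = S"
        using wS S' by (auto simp: kept_def f'0 f'm)
      have "(\<lambda>s\<in>S. new_part m f' (w s)) = r"
      proof (rule extensionalityI)
        fix s assume "s \<in> S"
        then show "(\<lambda>s\<in>S. new_part m f' (w s)) s = r s"
          using np_f'[of "w s"] wS[of s] S'[of s] by (simp add: w_def)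
      qed (use x in \<open>auto simp: PiE_def\<close>)
      then have "on_ob (part_act R m p f') (T, Y, w) = x"
        using K X by (simp add: xy')
      moreover have "(\<lambda>t\<in>T. new_part n g' (w t)) = q"
      proof (rule extensionalityI)
        fix t assume t: "t \<in> T"
        have wp: "w t \<le> p" using w t by auto
        have "new_part n g' (w t) = q t"
          using np1[of "w t"] np2(1)[of "w t"] np3[of "w t"] wp t rq[of t] S'[of t] wS[OF t] q[OF t] exp(1,3)
          by (auto simp: w_def split: if_splits)
        then show "(\<lambda>t\<in>T. new_part n g' (w t)) t = q t" using t by simp
      qed (use y in \<open>auto simp: PiE_def\<close>)
      then have "on_ob (part_act R n p g') (T, Y, w) = y"
        unfolding generic_on_ob[OF gen' z] xy' by simp
      ultimately show ?thesis using z by blast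
    qed
    show "\<exists>!l. l \<in> hom (part_level R p) z z' \<and> on_hom (part_act R m p f') z z' l = a \<and>
        on_hom (part_act R n p g') z z' l = b"
      if z: "z \<in> ob (part_level R p)" "z' \<in> ob (part_level R p)"
        and a: "a \<in> hom (part_level R m) (on_ob (part_act R m p f') z) (on_ob (part_act R m p f') z')"
        and b: "b \<in> hom (part_level R n) (on_ob (part_act R n p g') z) (on_ob (part_act R n p g') z')"
        and ab: "on_hom (part_act R k m g) (on_ob (part_act R m p f') z) (on_ob (part_act R m p f') z') a =
          on_hom (part_act R k n f) (on_ob (part_act R n p g') z) (on_ob (part_act R n p g') z') b"
      for z z' a b
    proof -
      obtain U Z w U' Z' w' where zs: "z = (U, Z, w)" "z' = (U', Z', w')" by (metis prod_cases3)
      have w: "w \<in> U \<rightarrow>\<^sub>E {1..p}" and w': "w' \<in> U' \<rightarrow>\<^sub>E {1..p}" using z by (auto simp: zs)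
      note b = b[unfolded zs generic_on_ob[OF gen' z(1)[unfolded zs]] generic_on_ob[OF gen' z(2)[unfolded zs]]]
      have b': "b \<in> struct_isos R (U, Z) (U', Z')" using b by simp
      then have np_b': "new_part n g' (w' (b u)) = new_part n g' (w u)" if "u \<in> U" for u
        using bspec[OF b[unfolded part_level_simps, THEN conjunct2] that] that struct_isosD(5)[OF b' that]
        by simp
      define K where "K = kept m f' (U, Z, w)"
      have K: "u \<in> K \<longleftrightarrow> u \<in> U \<and> f 0 < w u \<and> w u \<le> f 0 + m" for u
        by (auto simp: K_def kept_def f'0 f'm)
      have "(\<lambda>s\<in>K. new_part m f' (w s)) \<in> K \<rightarrow>\<^sub>E {1..m}"
        using new_part(1)[OF Delta(3)] K by (auto simp: f'0 f'm)
      then have Kg: "kept k g (on_ob (part_act R m p f') z) = K"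
        by (simp add: zs K_def[symmetric] generic_kept[OF gen])
      have "kept k f (on_ob (part_act R n p g') z) = K"
      proof -
        have "kept k f (on_ob (part_act R n p g') z) =
            {u \<in> U. f 0 < new_part n g' (w u) \<and> new_part n g' (w u) \<le> f 0 + k}"
          unfolding zs generic_on_ob[OF gen' z(1)[unfolded zs]] by (auto simp: kept_def fk)
        also have "\<dots> = K" using kept_iff[OF PiE_mem[OF w]] K by blast
        finally show ?thesis .
      qed
      with ab Kg have "restrict a K = restrict b K" by simp
      moreover have a': "a \<in> struct_isos R (K, restr R U Z K) (kept m f' (U', Z', w'), restr R U' Z' (kept m f' (U', Z', w')))"
        "\<And>u. u \<in> K \<Longrightarrow> (\<lambda>s\<in>kept m f' (U', Z', w'). new_part m f' (w' s)) (a u) = new_part m f' (w u)"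
        using a by (auto simp: zs K_def[symmetric])
      ultimately have aK: "a = restrict b K" using struct_isosD(6)[OF a'(1)] by simp
      have np_b: "new_part m f' (w' (b u)) = new_part m f' (w u)" if "u \<in> K" for u
        using a'(2)[OF that] struct_isosD(5)[OF a'(1) that] that by (simp add: aK)
      \<comment> \<open>Since g' acts on arrows as the identity, \<open>b\<close> is the only
        candidate for the common lift. What remains is that it respects the finer partition, and by
        \<open>inj\<close> this can be tested after applying g' and, on the segment, f'.\<close>
      have "w' (b u) = w u" if u: "u \<in> U" for u
      proof (rule inj)
        show "w' (b u) \<in> {1..p}" "w u \<in> {1..p}"
          using w w' u struct_isosD(5)[OF b' u] by auto
        show "new_part n g' (w' (b u)) = new_part n g' (w u)" by (rule np_b'[OF u])
        show "new_part m f' (w' (b u)) = new_part m f' (w u)" if "f 0 < w u" "w u \<le> f 0 + m"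
          using np_b[of u] K[of u] that u by blast
      qed
      then have hom: "b \<in> hom (part_level R p) z z'" using b' by (simp add: zs)
      have gU: "on_hom (part_act R n p g') z z' l = l" if "l \<in> hom (part_level R p) z z'" for l
      proof -
        have "l \<in> struct_isos R (U, Z) (U', Z')" using that by (simp add: zs)
        from struct_isosD(6)[OF this] show ?thesis by (simp add: zs generic_kept[OF gen' w])
      qed
      have "on_hom (part_act R m p f') z z' b = a" by (simp add: zs aK K_def)
      with hom gU show ?thesis by metis
    qed
  qed
qed

theorem decomposition_space_species: "decomposition_space (species_simplicial R)"
  unfolding decomposition_space_def decomposition_space_axioms_def species_simplicial_simps
  using simplicial_groupoid_species generic_free_pullback by blast

end

section \<open>Morphisms of restriction species\<close>

locale restriction_species_morphism = dom: restriction_species R + cod: restriction_species R'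
  for R :: "('a::infinite, 'r) species" and R' :: "('a, 's) species" +
  fixes \<alpha> :: "'a set \<Rightarrow> 'r \<Rightarrow> 's"
  assumes morphism: "species_morphism R R' \<alpha>"
begin

lemma closed: "finite S \<Longrightarrow> X \<in> strs R S \<Longrightarrow> \<alpha> S X \<in> strs R' S"
  using morphism by (simp add: species_morphism_def)

lemma natural:
  "\<lbrakk>finite A; finite S; f \<in> injections A S; X \<in> strs R S\<rbrakk> \<Longrightarrow> pull R' A S f (\<alpha> S X) = \<alpha> A (pull R A S f X)"
  using morphism by (simp add: species_morphism_def)

lemma restr_natural: "\<lbrakk>finite S; X \<in> strs R S; A \<subseteq> S\<rbrakk> \<Longrightarrow> restr R' S (\<alpha> S X) A = \<alpha> A (restr R S X A)"
  unfolding restr_def by (rule natural) (auto simp: injections_def inj_on_def intro: finite_subset)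

lemma struct_isos_natural:
  assumes "finite S" "finite T" "Y \<in> strs R T" "f \<in> struct_isos R (S, X) (T, Y)"
  shows "f \<in> struct_isos R' (S, \<alpha> S X) (T, \<alpha> T Y)"
  using assms natural[OF assms(1,2) _ assms(3), of f]
  by (auto simp: struct_isos_def injections_def bij_betw_def)

lemma species_functor_closed:
  "x \<in> ob (part_level R k) \<Longrightarrow> on_ob (species_functor \<alpha> k) x \<in> ob (part_level R' k)"
  by (cases x) (auto intro: closed)

lemma groupoid_functor_species_functor:
  "groupoid_functor (part_level R k) (part_level R' k) (species_functor \<alpha> k)"
proof -
  interpret dom': groupoid "part_level R k" by (rule dom.groupoid_part_level)
  interpret cod': groupoid "part_level R' k" by (rule cod.groupoid_part_level)
  show ?thesis
  proof (unfold_locales, goal_cases)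
    case (1 x)
    then show ?case by (rule species_functor_closed)
  next
    case (2 x y f)
    then show ?case by (cases x; cases y) (auto intro: struct_isos_natural)
  next
    case (3 x)
    then show ?case by (cases x) simp
  next
    case (4 x y z f g)
    then show ?case by (cases x) simp
  qed
qed

lemma species_functor_natural:
  "fctr_eq (part_level R n) (fctr_comp (species_functor \<alpha> m) (part_act R m n \<phi>))
    (fctr_comp (part_act R' m n \<phi>) (species_functor \<alpha> n))"
  unfolding fctr_eq_def fctr_comp_def
  by (auto simp: kept_def restr_natural)

lemma simplicial_map_species_functor:
  "simplicial_map (species_simplicial R) (species_simplicial R') (species_functor \<alpha>)"
  unfolding simplicial_map_def simplicial_map_axioms_def species_simplicial_simps
  using dom.simplicial_groupoid_species cod.simplicial_groupoid_species
    groupoid_functor_species_functor species_functor_natural by blast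

text \<open>The structure of the common lift comes from \<open>x\<close> and its partition from
  \<open>y\<close>; on arrows all four functors act as the identity. Here isomorphisms are lifted
  along the functor of \<alpha>, not along the generic map.\<close>

lemma generic_naturality_pullback:
  assumes "\<phi> \<in> Delta m n" "generic m n \<phi>"
  shows "homotopy_pullback (part_level R n) (part_level R m) (part_level R' n) (part_level R' m)
    (part_act R m n \<phi>) (species_functor \<alpha> n) (species_functor \<alpha> m) (part_act R' m n \<phi>)"
proof (rule homotopy_pullback_if_lifting)
  show "groupoid_functor (part_level R n) (part_level R m) (part_act R m n \<phi>)"
    by (rule dom.groupoid_functor_part_act[OF assms(1)])
  show "groupoid_functor (part_level R' n) (part_level R' m) (part_act R' m n \<phi>)"
    by (rule cod.groupoid_functor_part_act[OF assms(1)])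
  show "groupoid_functor (part_level R n) (part_level R' n) (species_functor \<alpha> n)"
    "groupoid_functor (part_level R m) (part_level R' m) (species_functor \<alpha> m)"
    by (rule groupoid_functor_species_functor)+
  show "fctr_eq (part_level R n) (fctr_comp (species_functor \<alpha> m) (part_act R m n \<phi>))
      (fctr_comp (part_act R' m n \<phi>) (species_functor \<alpha> n))"
    by (rule species_functor_natural)
  show "\<exists>p \<in> ob (part_level R n). on_ob (part_act R m n \<phi>) p = x \<and> on_ob (species_functor \<alpha> n) p = y"
    if xy: "x \<in> ob (part_level R m)" "y \<in> ob (part_level R' n)"
      "on_ob (species_functor \<alpha> m) x = on_ob (part_act R' m n \<phi>) y" for x y
  proof -
    obtain S X p T Y q where xy': "x = (S, X, p)" "y = (T, Y, q)" by (metis prod_cases3)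
    have "(S, \<alpha> S X, p) = (T, Y, \<lambda>s\<in>T. new_part m \<phi> (q s))"
      using xy(3) unfolding xy' cod.generic_on_ob[OF assms(2) xy(2)[unfolded xy']] species_functor_simps .
    from this[unfolded prod.inject]
    have eqs: "S = T" "\<alpha> S X = Y" "p = (\<lambda>s\<in>T. new_part m \<phi> (q s))" by blast+
    have z: "(S, X, q) \<in> ob (part_level R n)" using xy(1,2) by (simp add: xy' eqs(1))
    have "on_ob (part_act R m n \<phi>) (S, X, q) = x"
      unfolding dom.generic_on_ob[OF assms(2) z] by (simp add: xy' eqs(1,3))
    moreover have "on_ob (species_functor \<alpha> n) (S, X, q) = y" using eqs by (simp add: xy')
    ultimately show ?thesis using z by blast
  qed
  show "\<exists>!l. l \<in> hom (part_level R n) z z' \<and> on_hom (part_act R m n \<phi>) z z' l = a \<and>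
      on_hom (species_functor \<alpha> n) z z' l = b"
    if z: "z \<in> ob (part_level R n)" "z' \<in> ob (part_level R n)"
      and a: "a \<in> hom (part_level R m) (on_ob (part_act R m n \<phi>) z) (on_ob (part_act R m n \<phi>) z')"
      and b: "b \<in> hom (part_level R' n) (on_ob (species_functor \<alpha> n) z) (on_ob (species_functor \<alpha> n) z')"
      and ab: "on_hom (species_functor \<alpha> m) (on_ob (part_act R m n \<phi>) z) (on_ob (part_act R m n \<phi>) z') a =
        on_hom (part_act R' m n \<phi>) (on_ob (species_functor \<alpha> n) z) (on_ob (species_functor \<alpha> n) z') b"
    for z z' a b
  proof -
    obtain U Z w U' Z' w' where zs: "z = (U, Z, w)" "z' = (U', Z', w')" by (metis prod_cases3)
    have w: "w \<in> U \<rightarrow>\<^sub>E {1..n}" using z by (simp add: zs)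
    have a': "a \<in> struct_isos R (U, Z) (U', Z')"
      using a unfolding zs dom.generic_on_ob[OF assms(2) z(1)[unfolded zs]]
        dom.generic_on_ob[OF assms(2) z(2)[unfolded zs]] by simp
    have b': "b \<in> struct_isos R' (U, \<alpha> U Z) (U', \<alpha> U' Z')" "\<forall>u \<in> U. w' (b u) = w u"
      using b by (auto simp: zs)
    have "a = b"
      using ab struct_isosD(6)[OF b'(1)] by (simp add: zs generic_kept[OF assms(2) w])
    moreover have "on_hom (part_act R m n \<phi>) z z' a = a"
      using struct_isosD(6)[OF a'] by (simp add: zs generic_kept[OF assms(2) w])
    moreover from \<open>a = b\<close> have "a \<in> hom (part_level R n) z z'" using a' b'(2) by (simp add: zs)
    ultimately show ?thesis by (intro ex1I[of _ a]) simp_all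
  qed
  show "\<exists>x' \<in> ob (part_level R m). on_ob (species_functor \<alpha> m) x' = z \<and>
      (\<exists>l \<in> hom (part_level R m) x x'. on_hom (species_functor \<alpha> m) x x' l = \<gamma>)"
    if xz: "x \<in> ob (part_level R m)" "z \<in> ob (part_level R' m)"
      "\<gamma> \<in> hom (part_level R' m) (on_ob (species_functor \<alpha> m) x) z" for x z \<gamma>
  proof -
    obtain S X p T Y q where xz': "x = (S, X, p)" "z = (T, Y, q)" by (metis prod_cases3)
    have fin: "finite S" "finite T" "X \<in> strs R S" "Y \<in> strs R' T" "q \<in> T \<rightarrow>\<^sub>E {1..m}"
      and \<gamma>: "\<gamma> \<in> struct_isos R' (S, \<alpha> S X) (T, Y)" "\<forall>s \<in> S. q (\<gamma> s) = p s"
      using xz by (auto simp: xz')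
    obtain \<delta> where \<delta>: "\<delta> \<in> struct_isos R' (T, Y) (S, \<alpha> S X)"
      "compose S \<delta> \<gamma> = (\<lambda>s\<in>S. s)" "compose T \<gamma> \<delta> = (\<lambda>t\<in>T. t)"
      using cod.struct_isos_inverse[OF fin(1,2,4) \<gamma>(1)] by blast
    have inj: "\<delta> \<in> injections T S" "\<gamma> \<in> injections S T"
      using \<delta>(1) \<gamma>(1) by (auto simp: struct_isos_def injections_def bij_betw_def)
    \<comment> \<open>\<open>X\<close> is transported along the inverse of \<gamma>; naturality of
      \<alpha> for this bijection sends the result to \<open>Y\<close>.\<close>
    define Y' where "Y' = pull R T S \<delta> X"
    have "\<alpha> T Y' = Y"
      using natural[OF fin(2,1) inj(1) fin(3)] struct_isosD(3)[OF \<delta>(1)] by (simp add: Y'_def)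
    moreover have Y': "Y' \<in> strs R T" unfolding Y'_def by (rule dom.pull_closed[OF fin(2,1) inj(1) fin(3)])
    moreover have "pull R S T \<gamma> Y' = X"
      using dom.pull_comp[OF fin(1,2,1) inj(2,1) fin(3)] \<delta>(2) dom.pull_id[OF fin(1,3)] by (simp add: Y'_def)
    then have "\<gamma> \<in> struct_isos R (S, X) (T, Y')" using \<gamma>(1) by (simp add: struct_isos_def)
    ultimately show ?thesis
      using fin \<gamma>(2) by (intro bexI[of _ "(T, Y', q)"]) (simp_all add: xz')
  qed
qed

lemma conservative_species_functor:
  "conservative (species_simplicial R) (species_simplicial R') (species_functor \<alpha>)"
  unfolding conservative_def degeneracy_def species_simplicial_simps
proof (intro allI impI generic_naturality_pullback)
  fix n i :: nat assume "i \<le> n"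
  then show "codegeneracy n i \<in> Delta (n + 1) n" "generic (n + 1) n (codegeneracy n i)"
    using codegeneracy_in_Delta by (auto simp: generic_def codegeneracy_def)
qed

text \<open>The bounds 0 < i < n + 1 say exactly that the coface map omits neither end-point, that
  is, that it is generic.\<close>

lemma ULF_species_functor: "ULF (species_simplicial R) (species_simplicial R') (species_functor \<alpha>)"
  unfolding ULF_def face_def species_simplicial_simps
proof (intro allI impI generic_naturality_pullback)
  fix n i :: nat assume "0 < i \<and> i < n + 1"
  then show "coface n i \<in> Delta n (n + 1)" "generic n (n + 1) (coface n i)"
    using coface_in_Delta by (auto simp: generic_def coface_def)
qed

end

section \<open>Coalgebras with comultiplication given by splitting sets\<close>

lemma delta_Pair: "delta (x, y) (a, b) = delta x a * delta y b"
  by (simp add: delta_def)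

lemma supp_delta: "supp (delta b) = {b}"
  by (auto simp: supp_def delta_def)

lemma delta_in_free_space: "b \<in> B \<Longrightarrow> delta b \<in> free_space B"
  by (simp add: free_space_def supp_delta)

lemma free_space_finite: "v \<in> free_space B \<Longrightarrow> finite (supp v)"
  by (simp add: free_space_def)

lemma supp_sum: "supp (\<lambda>x. \<Sum>i\<in>I. g i x) \<subseteq> (\<Union>i\<in>I. supp (g i))"
proof
  fix x assume "x \<in> supp (\<lambda>x. \<Sum>i\<in>I. g i x)"
  then have "(\<Sum>i\<in>I. g i x) \<noteq> 0" by (simp add: supp_def)
  then obtain i where "i \<in> I" "g i x \<noteq> 0" by (rule sum.not_neutral_contains_not_neutral)
  then show "x \<in> (\<Union>i\<in>I. supp (g i))" by (auto simp: supp_def)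
qed

lemma sum_delta_in_free_space:
  assumes "finite I" "h ` I \<subseteq> B"
  shows "(\<lambda>z. \<Sum>i\<in>I. delta (h i) z) \<in> free_space B"
proof -
  have "supp (\<lambda>z. \<Sum>i\<in>I. delta (h i) z) \<subseteq> h ` I"
    using supp_sum[where I = I and g = "\<lambda>i. delta (h i)"] by (auto simp: supp_delta)
  then show ?thesis
    using assms by (auto simp: free_space_def intro: finite_subset)
qed

lemma finite_supp_sum_delta: "finite I \<Longrightarrow> finite (supp (\<lambda>z. \<Sum>i\<in>I. delta (h i) z))"
  by (rule free_space_finite[OF sum_delta_in_free_space[OF _ subset_refl]])

lemma supp_linear_ext: "supp (linear_ext f v) \<subseteq> (\<Union>b\<in>supp v. supp (f b))"
  using supp_sum[where I = "supp v" and g = "\<lambda>b c. v b * f b c"] by (auto simp: linear_ext_def supp_def)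

text \<open>The sum in \<open>linear_ext\<close> runs over the support of its argument; a common
  finite set makes different vectors comparable.\<close>

lemma linear_ext_superset:
  assumes "finite I" "supp v \<subseteq> I"
  shows "linear_ext f v c = (\<Sum>b\<in>I. v b * f b c)"
  unfolding linear_ext_def using assms
  by (intro sum.mono_neutral_left) (auto simp: supp_def)

text \<open>A functional is a linear map into the space over a one-point basis, so it inherits the
  lemmas on \<open>linear_ext\<close>.\<close>

lemma functional_ext_eq_linear_ext: "functional_ext e v = linear_ext (\<lambda>b _. e b) v ()"
  by (simp add: functional_ext_def linear_ext_def)

lemma linear_ext_cong: "(\<And>b. b \<in> supp v \<Longrightarrow> f b = g b) \<Longrightarrow> linear_ext f v = linear_ext g v"
  by (simp add: linear_ext_def)

lemma linear_ext_add:
  assumes "finite (supp v)" "finite (supp w)"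
  shows "linear_ext f (\<lambda>b. v b + w b) c = linear_ext f v c + linear_ext f w c"
proof -
  let ?I = "supp v \<union> supp w"
  have "linear_ext f (\<lambda>b. v b + w b) c = (\<Sum>b\<in>?I. (v b + w b) * f b c)"
    using assms by (intro linear_ext_superset) (auto simp: supp_def)
  also have "\<dots> = (\<Sum>b\<in>?I. v b * f b c) + (\<Sum>b\<in>?I. w b * f b c)"
    by (simp add: distrib_right sum.distrib)
  also have "\<dots> = linear_ext f v c + linear_ext f w c"
    using assms linear_ext_superset[of ?I v f c] linear_ext_superset[of ?I w f c] by simp
  finally show ?thesis .
qed

lemma linear_ext_scale:
  assumes "finite (supp v)"
  shows "linear_ext f (\<lambda>b. r * v b) c = r * linear_ext f v c"
proof -
  have "linear_ext f (\<lambda>b. r * v b) c = (\<Sum>b\<in>supp v. r * v b * f b c)"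
    using assms by (intro linear_ext_superset) (auto simp: supp_def)
  then show ?thesis by (simp add: linear_ext_def sum_distrib_left mult.assoc)
qed

lemma linear_ext_of_delta [simp]: "linear_ext f (delta b) = f b"
  by (simp add: linear_ext_def supp_delta) (simp add: delta_def)

lemma functional_ext_of_delta [simp]: "functional_ext e (delta b) = e b"
  by (simp add: functional_ext_eq_linear_ext)

lemma linear_ext_delta_id: "finite (supp v) \<Longrightarrow> linear_ext delta v = v"
  by (auto simp: linear_ext_def delta_def fun_eq_iff supp_def if_distrib cong: if_cong)

text \<open>\<open>h\<close> may repeat values, so the coefficients of this vector are
  multiplicities; induction over \<open>I\<close> avoids counting them.\<close>

lemma linear_ext_sum_delta:
  "finite I \<Longrightarrow> linear_ext f (\<lambda>z. \<Sum>i\<in>I. delta (h i) z) = (\<lambda>c. \<Sum>i\<in>I. f (h i) c)"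
proof (induction I rule: finite_induct)
  case empty
  then show ?case by (simp add: linear_ext_def supp_def)
next
  case (insert i I)
  then show ?case
    using linear_ext_add[of "delta (h i)" "\<lambda>z. \<Sum>i\<in>I. delta (h i) z" f]
    by (simp add: fun_eq_iff finite_supp_sum_delta supp_delta)
qed

text \<open>The supports of all \<open>g b\<close> lie in one finite set, over which the two
  summations are interchanged.\<close>

lemma linear_ext_linear_ext:
  assumes "finite (supp v)" "\<And>b. b \<in> supp v \<Longrightarrow> finite (supp (g b))"
  shows "linear_ext f (linear_ext g v) = linear_ext (\<lambda>b. linear_ext f (g b)) v"
proof
  fix c
  let ?I = "\<Union>b\<in>supp v. supp (g b)"
  have fin: "finite ?I" using assms by blast
  have "linear_ext f (linear_ext g v) c = (\<Sum>x\<in>?I. linear_ext g v x * f x c)"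
    by (rule linear_ext_superset[OF fin supp_linear_ext])
  also have "\<dots> = (\<Sum>x\<in>?I. \<Sum>b\<in>supp v. v b * (g b x * f x c))"
    by (simp add: linear_ext_def sum_distrib_right mult.assoc)
  also have "\<dots> = (\<Sum>b\<in>supp v. \<Sum>x\<in>?I. v b * (g b x * f x c))"
    by (rule sum.swap)
  also have "\<dots> = (\<Sum>b\<in>supp v. v b * linear_ext f (g b) c)"
    using fin by (intro sum.cong refl) (subst linear_ext_superset[of ?I], auto simp: sum_distrib_left)
  finally show "linear_ext f (linear_ext g v) c = linear_ext (\<lambda>b. linear_ext f (g b)) v c"
    by (simp add: linear_ext_def)
qed

lemma functional_ext_linear_ext:
  assumes "finite (supp v)" "\<And>b. b \<in> supp v \<Longrightarrow> finite (supp (g b))"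
  shows "functional_ext e (linear_ext g v) = functional_ext (\<lambda>b. functional_ext e (g b)) v"
proof -
  have "linear_ext (\<lambda>b (_::unit). e b) (linear_ext g v) = linear_ext (\<lambda>b. linear_ext (\<lambda>b _. e b) (g b)) v"
    by (rule linear_ext_linear_ext[OF assms])
  from fun_cong[OF this, of "()"] show ?thesis by (simp add: functional_ext_def linear_ext_def)
qed

lemma linear_ext_in_free_space:
  assumes "v \<in> free_space B" "\<And>b. b \<in> B \<Longrightarrow> f b \<in> free_space C"
  shows "linear_ext f v \<in> free_space C"
proof -
  have f: "finite (supp (f b)) \<and> supp (f b) \<subseteq> C" if "b \<in> supp v" for b
    using assms that by (auto simp: free_space_def)
  then have "finite (\<Union>b\<in>supp v. supp (f b))"
    using assms(1) by (auto simp: free_space_def)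
  moreover have "supp (linear_ext f v) \<subseteq> C"
    using supp_linear_ext[of f v] f by blast
  ultimately show ?thesis
    using finite_subset[OF supp_linear_ext] by (simp add: free_space_def)
qed

lemma linear_between_linear_ext:
  "(\<And>b. b \<in> B \<Longrightarrow> f b \<in> free_space C) \<Longrightarrow> linear_between B C (linear_ext f)"
  by (auto simp: linear_between_def linear_ext_in_free_space fun_eq_iff linear_ext_add
      linear_ext_scale free_space_finite)

lemma linear_functional_functional_ext: "linear_functional B (functional_ext e)"
  by (auto simp: linear_functional_def functional_ext_eq_linear_ext linear_ext_add
      linear_ext_scale free_space_finite)

lemma linear_ext_delta_comp:
  assumes "finite (supp v)"
  shows "linear_ext (\<lambda>c. delta (k c)) (linear_ext (\<lambda>b. delta (h b)) v) = linear_ext (\<lambda>b. delta (k (h b))) v"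
  using assms by (simp add: linear_ext_linear_ext supp_delta)

lemma bij_betw_linear_ext_delta:
  assumes "bij_betw h B C"
  shows "bij_betw (linear_ext (\<lambda>b. delta (h b))) (free_space B) (free_space C)"
proof -
  have inverse: "linear_ext (\<lambda>c. delta (k c)) (linear_ext (\<lambda>b. delta (h b)) v) = v"
    if "v \<in> free_space B" "\<And>b. b \<in> B \<Longrightarrow> k (h b) = b" for v B and h :: "'x \<Rightarrow> 'y" and k
  proof -
    have "linear_ext (\<lambda>b. delta (k (h b))) v = linear_ext delta v"
      using that by (intro linear_ext_cong) (auto simp: free_space_def)
    then show ?thesis
      using that(1) by (simp add: linear_ext_delta_comp linear_ext_delta_id free_space_finite)
  qed
  let ?k = "inv_into B h"
  have k: "?k (h b) = b" if "b \<in> B" for b using assms that by (auto simp: bij_betw_def)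
  have h: "h (?k c) = c" "?k c \<in> B" if "c \<in> C" for c
    using assms that by (auto simp: bij_betw_def f_inv_into_f inv_into_into)
  show ?thesis
  proof (rule bij_betw_byWitness[where f' = "linear_ext (\<lambda>c. delta (?k c))"])
    show "\<forall>v\<in>free_space B. linear_ext (\<lambda>c. delta (?k c)) (linear_ext (\<lambda>b. delta (h b)) v) = v"
      using inverse[of _ B ?k h] k by blast
    show "\<forall>v\<in>free_space C. linear_ext (\<lambda>b. delta (h b)) (linear_ext (\<lambda>c. delta (?k c)) v) = v"
      using inverse[of _ C h ?k] h by blast
    show "linear_ext (\<lambda>b. delta (h b)) ` free_space B \<subseteq> free_space C"
      using assms by (auto simp: bij_betw_def intro!: linear_ext_in_free_space delta_in_free_space)
    show "linear_ext (\<lambda>c. delta (?k c)) ` free_space C \<subseteq> free_space B"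
      using h by (auto intro!: linear_ext_in_free_space delta_in_free_space)
  qed
qed

text \<open>
  Both the Schmitt coalgebra and the cardinality of the incidence coalgebra are instances, with
  \<open>cls\<close> sending a structure to its class, in degree 1 through its trivial partition.
\<close>

locale splitting_coalgebra = restriction_species R
  for R :: "('a::infinite, 'r) species" +
  fixes C :: "'c coalg" and cls :: "'a set \<times> 'r \<Rightarrow> 'c"
    and \<Delta> :: "'c \<Rightarrow> 'c \<times> 'c \<Rightarrow> rat" and \<epsilon> :: "'c \<Rightarrow> rat"
  assumes basis_eq: "basis C = cls ` ob (structures R)"
    and comult_eq: "comult C = linear_ext \<Delta>"
    and counit_eq: "counit C = functional_ext \<epsilon>"
    and comult_cls: "\<lbrakk>finite S; X \<in> strs R S\<rbrakk> \<Longrightarrow> \<Delta> (cls (S, X)) = (\<lambda>z. \<Sum>A\<in>Pow S.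
      delta (cls (A, restr R S X A), cls (S - A, restr R S X (S - A))) z)"
    and counit_cls: "\<lbrakk>finite S; X \<in> strs R S\<rbrakk> \<Longrightarrow> \<epsilon> (cls (S, X)) = (if S = {} then 1 else 0)"
begin

lemma basisE:
  assumes "c \<in> basis C"
  obtains S X where "finite S" "X \<in> strs R S" "c = cls (S, X)"
  using assms unfolding basis_eq by (auto simp: structures_def)

lemma cls_in_basis: "\<lbrakk>finite S; X \<in> strs R S\<rbrakk> \<Longrightarrow> cls (S, X) \<in> basis C"
  unfolding basis_eq by (auto simp: structures_def)

lemma comult_closed:
  assumes "c \<in> basis C"
  shows "\<Delta> c \<in> free_space (basis C \<times> basis C)"
proof -
  obtain S X where c: "finite S" "X \<in> strs R S" "c = cls (S, X)" using assms by (rule basisE)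
  show ?thesis
    unfolding c(3) comult_cls[OF c(1,2)] using c
    by (intro sum_delta_in_free_space) (auto intro!: cls_in_basis restr_closed intro: finite_subset)
qed

lemma finite_supp_comult: "v \<in> free_space (basis C) \<Longrightarrow> b \<in> supp v \<Longrightarrow> finite (supp (\<Delta> b))"
  using comult_closed by (auto simp: free_space_def)

lemma linear_ext_comult:
  assumes "finite S" "X \<in> strs R S"
  shows "linear_ext f (\<Delta> (cls (S, X))) c =
    (\<Sum>A\<in>Pow S. f (cls (A, restr R S X A), cls (S - A, restr R S X (S - A))) c)"
  using assms by (simp add: comult_cls linear_ext_sum_delta)

text \<open>Reduces a linear identity to classes of structures. The evaluation points
  \<open>c\<close> and \<open>d\<close> may have different types, as required by the two bracketings
  of a triple tensor product.\<close>

lemma linear_ext_comult_cong: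
  assumes "v \<in> free_space (basis C)"
    and "\<And>S X. \<lbrakk>finite S; X \<in> strs R S\<rbrakk> \<Longrightarrow>
      linear_ext f (\<Delta> (cls (S, X))) c = linear_ext g (\<Delta> (cls (S, X))) d"
  shows "linear_ext f (linear_ext \<Delta> v) c = linear_ext g (linear_ext \<Delta> v) d"
proof -
  have "linear_ext f (\<Delta> b) c = linear_ext g (\<Delta> b) d" if "b \<in> supp v" for b
  proof -
    have "b \<in> basis C" using assms(1) that by (auto simp: free_space_def)
    then obtain S X where "finite S" "X \<in> strs R S" "b = cls (S, X)" by (rule basisE)
    then show ?thesis using assms(2) by blast
  qed
  then show ?thesis
    using assms(1) finite_supp_comult
    by (simp add: linear_ext_linear_ext free_space_finite) (simp add: linear_ext_def)
qed

sublocale coalgebra C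
proof (unfold_locales, unfold comult_eq counit_eq)
  show "linear_between (basis C) (basis C \<times> basis C) (linear_ext \<Delta>)"
    by (intro linear_between_linear_ext comult_closed)
  show "linear_functional (basis C) (functional_ext \<epsilon>)"
    by (rule linear_functional_functional_ext)
next
  fix v a b c assume v: "v \<in> free_space (basis C)"
  show "tensor_map (linear_ext \<Delta>) (\<lambda>w. w) (linear_ext \<Delta> v) ((a, b), c) =
      tensor_map (\<lambda>w. w) (linear_ext \<Delta>) (linear_ext \<Delta> v) (a, b, c)"
    unfolding tensor_map_def
  proof (rule linear_ext_comult_cong[OF v])
    fix S X assume S: "finite S" "X \<in> strs R S"
    \<comment> \<open>Restrictions of restrictions of \<open>X\<close> are again restrictions of
      \<open>X\<close>, so every tensor factor after two splittings is a value of
      \<open>k\<close>.\<close>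
    define k where "k = (\<lambda>A. cls (A, restr R S X A))"
    have \<Delta>: "\<Delta> (k A) (x, y) = (\<Sum>B\<in>Pow A. delta (k B) x * delta (k (A - B)) y)"
      if "A \<subseteq> S" for A x y
    proof -
      have A: "finite A" "restr R S X A \<in> strs R A"
        using S that finite_subset by (auto intro: restr_closed)
      have "restr R A (restr R S X A) B = restr R S X B" if "B \<subseteq> A" for B
        using S that \<open>A \<subseteq> S\<close> by (rule restr_restr)
      then show ?thesis
        unfolding k_def comult_cls[OF A] by (auto simp: delta_Pair intro!: sum.cong)
    qed
    have "linear_ext (\<lambda>(b, d) (c, e). linear_ext \<Delta> (delta b) c * delta d e) (\<Delta> (cls (S, X))) ((a, b), c) =
        (\<Sum>A\<in>Pow S. \<Delta> (k A) (a, b) * delta (k (S - A)) c)"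
      unfolding linear_ext_comult[OF S] by (simp add: k_def)
    also have "\<dots> = (\<Sum>A\<in>Pow S. \<Sum>B\<in>Pow A. delta (k B) a * delta (k (A - B)) b * delta (k (S - A)) c)"
      by (intro sum.cong refl) (simp add: \<Delta> sum_distrib_right)
    also have "\<dots> = (\<Sum>(A, B)\<in>Sigma (Pow S) Pow. delta (k B) a * delta (k (A - B)) b * delta (k (S - A)) c)"
      using S(1) finite_subset by (subst sum.Sigma) auto
    also have "\<dots> = (\<Sum>(A, B)\<in>Sigma (Pow S) (\<lambda>A. Pow (S - A)).
        delta (k A) a * (delta (k B) b * delta (k (S - A - B)) c))"
    \<comment> \<open>Splitting the left factor gives the triple B, A - B, S - A; splitting the
      right factor gives A, B, S - A - B. The bijection matches equal triples.\<close>
    proof (rule sum.reindex_bij_witness[where i = "\<lambda>(A, B). (A \<union> B, A)" and j = "\<lambda>(A, B). (B, A - B)"], goal_cases)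
      case (5 x)
      then have "S - snd x - (fst x - snd x) = S - fst x" by auto
      then show ?case by (simp add: split_def mult.assoc)
    qed auto
    also have "\<dots> = (\<Sum>A\<in>Pow S. \<Sum>B\<in>Pow (S - A). delta (k A) a * (delta (k B) b * delta (k (S - A - B)) c))"
      using S(1) finite_subset by (subst sum.Sigma) auto
    also have "\<dots> = (\<Sum>A\<in>Pow S. delta (k A) a * \<Delta> (k (S - A)) (b, c))"
      by (intro sum.cong refl) (simp add: \<Delta> sum_distrib_left)
    also have "\<dots> = linear_ext (\<lambda>(b, d) (c, e). delta b c * linear_ext \<Delta> (delta d) e) (\<Delta> (cls (S, X))) (a, b, c)"
      unfolding linear_ext_comult[OF S] by (simp add: k_def)
    finally show "linear_ext (\<lambda>(b, d) (c, e). linear_ext \<Delta> (delta b) c * delta d e) (\<Delta> (cls (S, X))) ((a, b), c) =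
        linear_ext (\<lambda>(b, d) (c, e). delta b c * linear_ext \<Delta> (delta d) e) (\<Delta> (cls (S, X))) (a, b, c)" .
  qed
next
  \<comment> \<open>Both counit laws reduce to one surviving splitting of each structure: A = {} for
    the left law and A = S for the right, the other factor being the whole structure.\<close>
  have counit: "linear_ext f (linear_ext \<Delta> v) = v"
    if v: "v \<in> free_space (basis C)"
      and f: "\<And>S X x. \<lbrakk>finite S; X \<in> strs R S\<rbrakk> \<Longrightarrow>
        (\<Sum>A\<in>Pow S. f (cls (A, restr R S X A), cls (S - A, restr R S X (S - A))) x) = delta (cls (S, X)) x"
    for f v
  proof -
    have "linear_ext f (\<Delta> b) = delta b" if "b \<in> supp v" for b
    proof -
      have "b \<in> basis C" using v that by (auto simp: free_space_def)
      then obtain S X where S: "finite S" "X \<in> strs R S" "b = cls (S, X)" by (rule basisE)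
      show ?thesis unfolding S(3) by (rule ext) (simp add: linear_ext_comult[OF S(1,2)] f[OF S(1,2)])
    qed
    then have "linear_ext (\<lambda>b. linear_ext f (\<Delta> b)) v = linear_ext delta v" by (rule linear_ext_cong)
    then show ?thesis
      using v finite_supp_comult by (simp add: linear_ext_linear_ext linear_ext_delta_id free_space_finite)
  qed
  fix v assume v: "v \<in> free_space (basis C)"
  show "linear_ext (\<lambda>(a, b) x. functional_ext \<epsilon> (delta a) * delta b x) (linear_ext \<Delta> v) = v"
  proof (rule counit[OF v])
    fix S X x assume S: "finite S" "X \<in> strs R S"
    have "(\<Sum>A\<in>Pow S. \<epsilon> (cls (A, restr R S X A)) * delta (cls (S - A, restr R S X (S - A))) x) =
        (\<Sum>A\<in>Pow S. if A = {} then delta (cls (S, X)) x else 0)"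
    proof (intro sum.cong refl)
      fix A assume "A \<in> Pow S"
      then have "finite A" "restr R S X A \<in> strs R A" using S finite_subset by (auto intro: restr_closed)
      then show "\<epsilon> (cls (A, restr R S X A)) * delta (cls (S - A, restr R S X (S - A))) x =
          (if A = {} then delta (cls (S, X)) x else 0)"
        using S by (simp add: counit_cls restr_self)
    qed
    then show "(\<Sum>A\<in>Pow S. (case (cls (A, restr R S X A), cls (S - A, restr R S X (S - A))) of
        (a, b) \<Rightarrow> \<lambda>x. functional_ext \<epsilon> (delta a) * delta b x) x) = delta (cls (S, X)) x"
      using S(1) by simp
  qed
  show "linear_ext (\<lambda>(a, b) x. functional_ext \<epsilon> (delta b) * delta a x) (linear_ext \<Delta> v) = v"
  proof (rule counit[OF v])
    fix S X x assume S: "finite S" "X \<in> strs R S"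
    have "(\<Sum>A\<in>Pow S. \<epsilon> (cls (S - A, restr R S X (S - A))) * delta (cls (A, restr R S X A)) x) =
        (\<Sum>A\<in>Pow S. if A = S then delta (cls (S, X)) x else 0)"
    proof (intro sum.cong refl)
      fix A assume "A \<in> Pow S"
      moreover have "finite (S - A)" "restr R S X (S - A) \<in> strs R (S - A)"
        using S by (auto intro: restr_closed)
      ultimately show "\<epsilon> (cls (S - A, restr R S X (S - A))) * delta (cls (A, restr R S X A)) x =
          (if A = S then delta (cls (S, X)) x else 0)"
        using S by (auto simp: counit_cls restr_self)
    qed
    then show "(\<Sum>A\<in>Pow S. (case (cls (A, restr R S X A), cls (S - A, restr R S X (S - A))) of
        (a, b) \<Rightarrow> \<lambda>x. functional_ext \<epsilon> (delta b) * delta a x) x) = delta (cls (S, X)) x"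
      using S(1) by simp
  qed
qed

end

text \<open>Naturality of \<alpha> for inclusions matches the two comultiplications splitting by
  splitting. With the identity as \<alpha> the lemma also compares two coalgebras of the same
  species.\<close>

lemma splitting_coalgebra_hom:
  fixes D :: "'d coalg"
  assumes "splitting_coalgebra R C cls \<Delta> \<epsilon>" "splitting_coalgebra R' D cls' \<Delta>' \<epsilon>'"
    and "restriction_species_morphism R R' \<alpha>"
    and h: "\<And>S X. \<lbrakk>finite S; X \<in> strs R S\<rbrakk> \<Longrightarrow> h (cls (S, X)) = cls' (S, \<alpha> S X)"
  shows "coalgebra_hom C D (linear_ext (\<lambda>c. delta (h c)))"
proof -
  interpret C: splitting_coalgebra R C cls \<Delta> \<epsilon> by fact
  interpret D: splitting_coalgebra R' D cls' \<Delta>' \<epsilon>' by fact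
  interpret restriction_species_morphism R R' \<alpha> by fact
  have h_closed: "h c \<in> basis D" if "c \<in> basis C" for c
    using that by (rule C.basisE) (auto simp: h intro!: D.cls_in_basis closed)
  show ?thesis
  proof
    show "linear_between (basis C) (basis D) (linear_ext (\<lambda>c. delta (h c)))"
      by (intro linear_between_linear_ext delta_in_free_space h_closed)
  next
    fix v assume v: "v \<in> free_space (basis C)"
    have "\<Delta>' (h b) = tensor_map (linear_ext (\<lambda>c. delta (h c))) (linear_ext (\<lambda>c. delta (h c))) (\<Delta> b)"
      if "b \<in> supp v" for b
    proof -
      have "b \<in> basis C" using v that by (auto simp: free_space_def)
      then obtain S X where S: "finite S" "X \<in> strs R S" "b = cls (S, X)" by (rule C.basisE)
      show ?thesis
      proof
        fix z :: "'d \<times> 'd"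
        obtain x y where z: "z = (x, y)" by (cases z)
        have eq: "h (cls (A, restr R S X A)) = cls' (A, restr R' S (\<alpha> S X) A)" if "A \<subseteq> S" for A
        proof -
          have "finite A" "restr R S X A \<in> strs R A"
            using S that finite_subset by (auto intro: C.restr_closed)
          then show ?thesis using S that by (simp add: h restr_natural)
        qed
        show "\<Delta>' (h b) z = tensor_map (linear_ext (\<lambda>c. delta (h c))) (linear_ext (\<lambda>c. delta (h c))) (\<Delta> b) z"
          unfolding S(3) tensor_map_def C.linear_ext_comult[OF S(1,2)] h[OF S(1,2)]
            D.comult_cls[OF S(1) closed[OF S(1,2)]]
          by (intro sum.cong refl) (simp add: z delta_Pair eq)
      qed
    qed
    then have "linear_ext (\<lambda>b. \<Delta>' (h b)) v =
        linear_ext (\<lambda>b. tensor_map (linear_ext (\<lambda>c. delta (h c))) (linear_ext (\<lambda>c. delta (h c))) (\<Delta> b)) v"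
      by (rule linear_ext_cong)
    then show "comult D (linear_ext (\<lambda>c. delta (h c)) v) =
        tensor_map (linear_ext (\<lambda>c. delta (h c))) (linear_ext (\<lambda>c. delta (h c))) (comult C v)"
      using v C.finite_supp_comult[OF v]
      by (simp add: C.comult_eq D.comult_eq tensor_map_def linear_ext_linear_ext supp_delta free_space_finite)
    have "\<epsilon>' (h b) = \<epsilon> b" if "b \<in> supp v" for b
    proof -
      have "b \<in> basis C" using v that by (auto simp: free_space_def)
      then obtain S X where S: "finite S" "X \<in> strs R S" "b = cls (S, X)" by (rule C.basisE)
      show ?thesis
        using S by (simp add: h C.counit_cls D.counit_cls closed)
    qed
    then show "counit D (linear_ext (\<lambda>c. delta (h c)) v) = counit C v"
      using v by (simp add: C.counit_eq D.counit_eq functional_ext_linear_ext supp_delta free_space_finite)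
        (simp add: functional_ext_def)
  qed
qed

section \<open>Cardinality of the incidence coalgebra\<close>

text \<open>\<open>pi0_map\<close> unites the classes of the images of all members of a class; this
  union is a single class as soon as connected objects have connected images.\<close>

lemma (in groupoid) pi0_map_class:
  assumes "\<And>y. (x, y) \<in> iso_rel K \<Longrightarrow> hom G (on_ob F x) (on_ob F y) \<noteq> {} \<and> on_ob F y \<in> ob G"
    and "(x, x) \<in> iso_rel K"
  shows "pi0_map G F (iso_rel K `` {x}) = iso_rel G `` {on_ob F x}"
proof -
  have "iso_rel G `` {on_ob F y} = iso_rel G `` {on_ob F x}" if "(x, y) \<in> iso_rel K" for y
    using assms(1)[OF that] assms(1)[OF assms(2)] iso_rel_class_eq_iff by blast
  then show ?thesis using assms(2) unfolding pi0_map_def by blast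
qed

section \<open>Degree 1, and the face maps from degree 2\<close>

definition trivial_part :: "'a set \<times> 'r \<Rightarrow> ('a, 'r) part_struct" where
  "trivial_part = (\<lambda>(S, X). (S, X, \<lambda>s\<in>S. 1))"

definition part_class :: "('a, 'r) species \<Rightarrow> 'a set \<times> 'r \<Rightarrow> ('a, 'r) part_struct set" where
  "part_class R x = iso_rel (part_level R 1) `` {trivial_part x}"

lemma structures_simps [simp]:
  "(S, X) \<in> ob (structures R) \<longleftrightarrow> finite S \<and> X \<in> strs R S"
  "hom (structures R) = struct_isos R"
  by (simp_all add: structures_def)

lemma hom_trivial_part [simp]: "hom (part_level R 1) (trivial_part x) (trivial_part y) = struct_isos R x y"
  by (cases x; cases y) (auto simp: trivial_part_def part_level_def struct_isosD(5))

lemma cmp_trivial_part [simp]: "cmp (part_level R 1) (trivial_part (S, X)) y z g f = compose S g f"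
  by (simp add: trivial_part_def)

lemma ob_level_1: "ob (part_level R 1) = trivial_part ` ob (structures R)"
proof
  show "ob (part_level R 1) \<subseteq> trivial_part ` ob (structures R)"
  proof
    fix x assume x: "x \<in> ob (part_level R 1)"
    obtain S X p where x': "x = (S, X, p)" by (cases x)
    have p: "p \<in> S \<rightarrow>\<^sub>E {1}" using x by (simp add: x')
    have "p = (\<lambda>s\<in>S. 1)"
    proof (rule extensionalityI)
      fix s assume "s \<in> S"
      then show "p s = (\<lambda>s\<in>S. 1) s" using p by auto
    qed (use p in \<open>auto simp: PiE_def\<close>)
    then show "x \<in> trivial_part ` ob (structures R)"
      using x by (intro image_eqI[of _ _ "(S, X)"]) (simp_all add: x' trivial_part_def)
  qed
qed (auto simp: trivial_part_def)

lemma trivial_part_in_ob [simp]: "trivial_part x \<in> ob (part_level R 1) \<longleftrightarrow> x \<in> ob (structures R)"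
  by (cases x) (auto simp: trivial_part_def)

text \<open>The simplifier rewrites \<open>1 :: nat\<close> to \<open>Suc 0\<close>; these are the
  same rules for that normal form.\<close>

lemmas [simp] = hom_trivial_part[unfolded One_nat_def] cmp_trivial_part[unfolded One_nat_def]
  trivial_part_in_ob[unfolded One_nat_def]

lemma finite_struct_isos: "finite S \<Longrightarrow> finite T \<Longrightarrow> finite (struct_isos R (S, X) (T, Y))"
  by (rule finite_subset[OF _ finite_PiE[of S "\<lambda>_. T"]]) (auto simp: struct_isos_def)

lemma kept_coface:
  assumes "q \<in> T \<rightarrow>\<^sub>E {1..2}"
  shows "kept 1 (coface 1 1) (T, Y, q) = T" "kept 1 (coface 1 2) (T, Y, q) = {t \<in> T. q t = 1}"
    "kept 1 (coface 1 0) (T, Y, q) = {t \<in> T. q t = 2}"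
proof -
  have q: "1 \<le> q t" "q t \<le> 2" if "t \<in> T" for t using assms that by auto
  show "kept 1 (coface 1 1) (T, Y, q) = T" "kept 1 (coface 1 2) (T, Y, q) = {t \<in> T. q t = 1}"
    "kept 1 (coface 1 0) (T, Y, q) = {t \<in> T. q t = 2}"
    using q by (force simp: kept_def coface_def)+
qed

context restriction_species
begin

lemma part_class_eq_iff:
  assumes "x \<in> ob (structures R)" "y \<in> ob (structures R)"
  shows "part_class R x = part_class R y \<longleftrightarrow> struct_isos R x y \<noteq> {}"
  unfolding part_class_def
  using groupoid.iso_rel_class_eq_iff[OF groupoid_part_level[of 1], of "trivial_part x" "trivial_part y"] assms
  by simp

lemma struct_class_eq_iff:
  assumes "x \<in> ob (structures R)" "y \<in> ob (structures R)"
  shows "struct_class R x = struct_class R y \<longleftrightarrow> struct_isos R x y \<noteq> {}"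
  unfolding struct_class_def
  using groupoid.iso_rel_class_eq_iff[OF groupoid_structures] assms by simp

lemma pi0_level_1: "pi0 (part_level R 1) = part_class R ` ob (structures R)"
  unfolding groupoid.pi0_eq_class_image[OF groupoid_part_level] ob_level_1 part_class_def
  by (simp add: image_image)

lemma pi0_structures: "pi0 (structures R) = struct_class R ` ob (structures R)"
  unfolding groupoid.pi0_eq_class_image[OF groupoid_structures] struct_class_def ..

text \<open>Deleting the last part leaves part 1 and deleting the first leaves part 2, so the pair
  of \<open>d\<^sub>2\<close> and \<open>d\<^sub>0\<close> yields the tensor factors in the order of
  the parts.\<close>

lemma face_simps:
  assumes "(T, Y, q) \<in> ob (part_level R 2)"
  shows "on_ob (face (species_simplicial R) 1 1) (T, Y, q) = trivial_part (T, Y)"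
    and "on_ob (face (species_simplicial R) 1 2) (T, Y, q) =
      trivial_part ({t \<in> T. q t = 1}, restr R T Y {t \<in> T. q t = 1})"
    and "on_ob (face (species_simplicial R) 1 0) (T, Y, q) =
      trivial_part ({t \<in> T. q t = 2}, restr R T Y {t \<in> T. q t = 2})"
    and "on_hom (face (species_simplicial R) 1 1) (T, Y, q) y f = restrict f T"
    and "on_hom (face (species_simplicial R) 1 2) (T, Y, q) y f = restrict f {t \<in> T. q t = 1}"
    and "on_hom (face (species_simplicial R) 1 0) (T, Y, q) y f = restrict f {t \<in> T. q t = 2}"
proof -
  have q: "q \<in> T \<rightarrow>\<^sub>E {1..2}" using assms by simp
  then have q': "1 \<le> q t" "q t \<le> 2" if "t \<in> T" for t using that by auto
  have ob: "(T, Y, q) \<in> ob (part_level R (1 + 1))" using assms unfolding one_add_one .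
  have "(\<lambda>s\<in>T. if q s \<le> 1 then q s else q s - 1) = (\<lambda>s\<in>T. 1)"
    using q' by (intro restrict_ext) force
  then show "on_ob (face (species_simplicial R) 1 1) (T, Y, q) = trivial_part (T, Y)"
    using inner_face[OF ob, of 1] by (simp add: trivial_part_def)
  have "{s \<in> T. q s \<noteq> 1 + 1} = {t \<in> T. q t = 1}" using q' by force
  moreover have "(\<lambda>s\<in>{t \<in> T. q t = 1}. q s) = (\<lambda>s\<in>{t \<in> T. q t = 1}. 1)" by auto
  ultimately show "on_ob (face (species_simplicial R) 1 2) (T, Y, q) =
      trivial_part ({t \<in> T. q t = 1}, restr R T Y {t \<in> T. q t = 1})"
    using top_face[OF ob] unfolding trivial_part_def one_add_one by simp
  have "{s \<in> T. q s \<noteq> 1} = {t \<in> T. q t = 2}" using q' by force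
  moreover have "(\<lambda>s\<in>{t \<in> T. q t = 2}. q s - 1) = (\<lambda>s\<in>{t \<in> T. q t = 2}. 1)" by auto
  ultimately show "on_ob (face (species_simplicial R) 1 0) (T, Y, q) =
      trivial_part ({t \<in> T. q t = 2}, restr R T Y {t \<in> T. q t = 2})"
    using bottom_face[OF ob] unfolding trivial_part_def one_add_one by simp
  show "on_hom (face (species_simplicial R) 1 1) (T, Y, q) y f = restrict f T"
    "on_hom (face (species_simplicial R) 1 2) (T, Y, q) y f = restrict f {t \<in> T. q t = 1}"
    "on_hom (face (species_simplicial R) 1 0) (T, Y, q) y f = restrict f {t \<in> T. q t = 2}"
    unfolding face_def species_simplicial_simps part_act_simps kept_coface[OF q] by simp_all
qed

lemma groupoid_functor_face:
  "groupoid_functor (part_level R 2) (part_level R 1) (face (species_simplicial R) 1 i)"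
  unfolding face_def species_simplicial_simps one_add_one
  using groupoid_functor_part_act[OF coface_in_Delta[of 1 i]] unfolding one_add_one .

text \<open>Brings an object over a structure isomorphic to (S, X) onto (S, X) itself. Hence
  partitions of S exhaust the fibre of \<open>d\<^sub>1\<close> up to isomorphism.\<close>

lemma transport_part:
  assumes "(T, Y, q) \<in> ob (part_level R 2)" "finite S" "X \<in> strs R S"
    and "\<gamma> \<in> struct_isos R (T, Y) (S, X)" "\<delta> \<in> struct_isos R (S, X) (T, Y)"
    and "compose T \<delta> \<gamma> = (\<lambda>t\<in>T. t)"
  shows "(S, X, \<lambda>s\<in>S. q (\<delta> s)) \<in> ob (part_level R 2)"
    "\<gamma> \<in> hom (part_level R 2) (T, Y, q) (S, X, \<lambda>s\<in>S. q (\<delta> s))"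
proof -
  have "\<delta> (\<gamma> t) = t" if "t \<in> T" for t
    using fun_cong[OF assms(6), of t] that by (simp add: compose_def)
  then show "\<gamma> \<in> hom (part_level R 2) (T, Y, q) (S, X, \<lambda>s\<in>S. q (\<delta> s))"
    using assms(4) struct_isosD(5)[OF assms(4)] by simp
  show "(S, X, \<lambda>s\<in>S. q (\<delta> s)) \<in> ob (part_level R 2)"
    using assms(1-3) struct_isosD(5)[OF assms(5)] by auto
qed

text \<open>Up to the factor |Aut y| this is the indicator function of the class of
  \<open>y\<close>; the factor is divided out in the incidence coefficients.\<close>

lemma card_hom_part_class:
  assumes "x \<in> ob (structures R)" "y \<in> ob (structures R)"
  shows "card (struct_isos R x y) = (if part_class R x = part_class R y then card (struct_isos R y y) else 0)"
  using groupoid.hom_card_eq_automorphisms[OF groupoid_structures assms] part_class_eq_iff[OF assms]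
  by auto

section \<open>The fibres that define the comultiplication\<close>

lemma fibre3_simps:
  assumes "(T, Y, q) \<in> ob (part_level R 2)"
  shows "((T, Y, q), \<gamma>, \<gamma>1, \<gamma>2) \<in> ob (fibre3 (species_simplicial R) (trivial_part x) (trivial_part a) (trivial_part b)) \<longleftrightarrow>
      \<gamma> \<in> struct_isos R (T, Y) x \<and>
      \<gamma>1 \<in> struct_isos R ({t \<in> T. q t = 1}, restr R T Y {t \<in> T. q t = 1}) a \<and>
      \<gamma>2 \<in> struct_isos R ({t \<in> T. q t = 2}, restr R T Y {t \<in> T. q t = 2}) b"
    and "(T', Y', q') \<in> ob (part_level R 2) \<Longrightarrow>
      m \<in> hom (fibre3 (species_simplicial R) (trivial_part x) (trivial_part a) (trivial_part b))
        ((T, Y, q), \<gamma>, \<gamma>1, \<gamma>2) ((T', Y', q'), \<gamma>', \<gamma>1', \<gamma>2') \<longleftrightarrow>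
      m \<in> hom (part_level R 2) (T, Y, q) (T', Y', q') \<and> compose T \<gamma>' (restrict m T) = \<gamma> \<and>
      compose {t \<in> T. q t = 1} \<gamma>1' (restrict m {t \<in> T. q t = 1}) = \<gamma>1 \<and>
      compose {t \<in> T. q t = 2} \<gamma>2' (restrict m {t \<in> T. q t = 2}) = \<gamma>2"
  using assms unfolding fibre3_def species_simplicial_simps
  by (auto simp only: homotopy_fibre_simps prod_category_def fctr_pair_def category.simps fctr.simps
      face_simps hom_trivial_part cmp_trivial_part mem_Times_iff fst_conv snd_conv case_prod_conv prod.inject)

lemma groupoid_fibre3:
  assumes "x \<in> ob (structures R)" "a \<in> ob (structures R)" "b \<in> ob (structures R)"
  shows "groupoid (fibre3 (species_simplicial R) (trivial_part x) (trivial_part a) (trivial_part b))"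
  unfolding fibre3_def species_simplicial_simps
proof (rule groupoid_homotopy_fibre)
  show "groupoid_functor (part_level R 2)
      (prod_category (part_level R 1) (prod_category (part_level R 1) (part_level R 1)))
      (fctr_pair (face (species_simplicial R) 1 1)
        (fctr_pair (face (species_simplicial R) 1 2) (face (species_simplicial R) 1 0)))"
    by (intro groupoid_functor_pair groupoid_functor_face)
qed (use assms in \<open>simp add: prod_category_def\<close>)

text \<open>
  Every object of the fibre is uniquely isomorphic to one whose underlying structure is \<open>(S, X)\<close>
  itself with the identity as comparison.
\<close>

lemma groupoid_card_fibre3:
  assumes S: "finite S" "X \<in> strs R S" and a: "a \<in> ob (structures R)" and b: "b \<in> ob (structures R)"
  shows "groupoid_card (fibre3 (species_simplicial R) (trivial_part (S, X)) (trivial_part a) (trivial_part b)) =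
    of_nat (\<Sum>A\<in>Pow S. card (struct_isos R (A, restr R S X A) a) *
      card (struct_isos R (S - A, restr R S X (S - A)) b))"
proof -
  let ?F = "fibre3 (species_simplicial R) (trivial_part (S, X)) (trivial_part a) (trivial_part b)"
  interpret F: groupoid ?F using S a b by (intro groupoid_fibre3) simp_all
  \<comment> \<open>\<open>A\<close> is part 1 and its complement part 2. The image of
    \<open>E\<close> under \<open>e\<close> will be a transversal of the components.\<close>
  define q where "q = (\<lambda>A. \<lambda>s\<in>S. if s \<in> A then 1 else 2 :: nat)"
  define E where "E = (SIGMA A : Pow S. struct_isos R (A, restr R S X A) a \<times>
    struct_isos R (S - A, restr R S X (S - A)) b)"
  define e where "e = (\<lambda>(A, \<gamma>1, \<gamma>2). ((S, X, q A), (\<lambda>s\<in>S. s), \<gamma>1 :: 'a \<Rightarrow> 'a, \<gamma>2 :: 'a \<Rightarrow> 'a))"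
  have q: "(S, X, q A) \<in> ob (part_level R 2)" for A using S by (auto simp: q_def)
  have parts: "{s \<in> S. q A s = 1} = A" "{s \<in> S. q A s = 2} = S - A" if "A \<subseteq> S" for A
    using that by (auto simp: q_def)
  have id: "(\<lambda>s\<in>S. s) \<in> struct_isos R (S, X) (S, X)"
    using S by (auto simp: struct_isos_def pull_id bij_betw_def inj_on_def)
  have e_ob: "e ` E \<subseteq> ob ?F"
    using id by (auto simp: E_def e_def fibre3_simps[OF q] parts simp del: One_nat_def)
  have objectE: "\<exists>T Y r \<gamma> \<gamma>1 \<gamma>2. x = ((T, Y, r), \<gamma>, \<gamma>1, \<gamma>2) \<and> (T, Y, r) \<in> ob (part_level R 2)"
    if "x \<in> ob ?F" for x
  proof -
    obtain y \<gamma> where x: "x = (y, \<gamma>)" by (cases x)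
    then have "y \<in> ob (part_level R 2)" using that by (simp add: fibre3_def)
    with x show ?thesis by (cases y; cases \<gamma>) auto
  qed
  \<comment> \<open>An automorphism is compatible with the comparison \<gamma> to the fixed set S,
    and injectivity of \<gamma> leaves only one.\<close>
  have discrete: "m = m'" if x: "x \<in> ob ?F" and m: "m \<in> hom ?F x x" "m' \<in> hom ?F x x" for x m m'
  proof -
    obtain T Y r \<gamma> \<gamma>1 \<gamma>2 where x': "x = ((T, Y, r), \<gamma>, \<gamma>1, \<gamma>2)" and r: "(T, Y, r) \<in> ob (part_level R 2)"
      using objectE[OF x] by blast
    have "\<gamma> \<in> struct_isos R (T, Y) (S, X)"
      using x unfolding x' fibre3_simps[OF r] by blast
    then have inj: "inj_on \<gamma> T" by (rule bij_betw_imp_inj_on[OF struct_isosD(1)])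
    have mm: "m \<in> struct_isos R (T, Y) (T, Y)" "m' \<in> struct_isos R (T, Y) (T, Y)"
      "compose T \<gamma> (restrict m T) = \<gamma>" "compose T \<gamma> (restrict m' T) = \<gamma>"
      using m unfolding x' fibre3_simps(2)[OF r r] by auto
    show ?thesis
    proof (rule extensionalityI)
      show "m \<in> extensional T" "m' \<in> extensional T" using mm(1,2) by (auto simp: struct_isos_def PiE_def)
      fix t assume t: "t \<in> T"
      have "\<gamma> (m t) = \<gamma> (m' t)"
        using fun_cong[OF mm(3), of t] fun_cong[OF mm(4), of t] t by (simp add: compose_def)
      then show "m t = m' t"
        using inj t struct_isosD(5)[OF mm(1) t] struct_isosD(5)[OF mm(2) t] by (simp add: inj_on_eq_iff)
    qed
  qed
  have reach: "\<exists>d \<in> e ` E. hom ?F x d \<noteq> {}" if x: "x \<in> ob ?F" for x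
  proof -
    obtain T Y r \<gamma> \<gamma>1 \<gamma>2 where x': "x = ((T, Y, r), \<gamma>, \<gamma>1, \<gamma>2)" and r: "(T, Y, r) \<in> ob (part_level R 2)"
      using objectE[OF x] by blast
    have fin: "finite T" "Y \<in> strs R T" using r by auto
    have \<gamma>: "\<gamma> \<in> struct_isos R (T, Y) (S, X)"
      and \<gamma>1: "\<gamma>1 \<in> struct_isos R ({t \<in> T. r t = 1}, restr R T Y {t \<in> T. r t = 1}) a"
      and \<gamma>2: "\<gamma>2 \<in> struct_isos R ({t \<in> T. r t = 2}, restr R T Y {t \<in> T. r t = 2}) b"
      using x unfolding x' fibre3_simps[OF r] by auto
    obtain \<delta> where \<delta>: "\<delta> \<in> struct_isos R (S, X) (T, Y)"
      and inv: "compose T \<delta> \<gamma> = (\<lambda>s\<in>T. s)" "compose S \<gamma> \<delta> = (\<lambda>s\<in>S. s)"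
      using struct_isos_inverse[OF fin(1) S \<gamma>] by blast
    have \<gamma>\<delta>: "\<gamma> (\<delta> s) = s" if "s \<in> S" for s
      using fun_cong[OF inv(2), of s] that by (simp add: compose_def)
    have \<delta>\<gamma>: "\<delta> (\<gamma> t) = t" if "t \<in> T" for t
      using fun_cong[OF inv(1), of t] that by (simp add: compose_def)
    have \<delta>_in: "\<delta> s \<in> T" if "s \<in> S" for s using struct_isosD(5)[OF \<delta> that] .
    have \<gamma>_in: "\<gamma> t \<in> S" if "t \<in> T" for t using struct_isosD(5)[OF \<gamma> that] .
    have r12: "r t = 1 \<or> r t = 2" if "t \<in> T" for t
    proof -
      have "r t \<in> {1..2}" using r that by auto
      then show ?thesis by auto
    qed
    \<comment> \<open>Carries the isomorphism on one part over to the corresponding subset of S, by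
      precomposition with the restricted \<delta>; used for both parts.\<close>
    have transport: "compose {s \<in> S. r (\<delta> s) = j} \<gamma>' (restrict \<delta> {s \<in> S. r (\<delta> s) = j}) \<in>
        struct_isos R ({s \<in> S. r (\<delta> s) = j}, restr R S X {s \<in> S. r (\<delta> s) = j}) c"
      if \<gamma>': "\<gamma>' \<in> struct_isos R ({t \<in> T. r t = j}, restr R T Y {t \<in> T. r t = j}) c"
        and c: "c \<in> ob (structures R)" for j \<gamma>' c
    proof -
      have "\<delta> ` {s \<in> S. r (\<delta> s) = j} = {t \<in> T. r t = j}"
      proof
        show "{t \<in> T. r t = j} \<subseteq> \<delta> ` {s \<in> S. r (\<delta> s) = j}"
        proof
          fix t assume "t \<in> {t \<in> T. r t = j}"
          then show "t \<in> \<delta> ` {s \<in> S. r (\<delta> s) = j}"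
            using \<gamma>_in[of t] \<delta>\<gamma>[of t] by (intro image_eqI[of _ _ "\<gamma> t"]) auto
        qed
      qed (use \<delta>_in in auto)
      then have "restrict \<delta> {s \<in> S. r (\<delta> s) = j} \<in> struct_isos R
          ({s \<in> S. r (\<delta> s) = j}, restr R S X {s \<in> S. r (\<delta> s) = j})
          ({t \<in> T. r t = j}, restr R T Y {t \<in> T. r t = j})"
        using restrict_struct_iso[OF S(1) fin \<delta>, of "{s \<in> S. r (\<delta> s) = j}"] by simp
      moreover obtain U Z where "c = (U, Z)" by (cases c)
      ultimately show ?thesis
        using \<gamma>' c S(1) fin(1)
        by (simp, intro struct_isos_comp[where T = "{t \<in> T. r t = j}" and Y = "restr R T Y {t \<in> T. r t = j}"]) simp_all
    qed
    \<comment> \<open>The image of part 1 under \<gamma>, written as a preimage under its inverse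
      \<delta>.\<close>
    define A where "A = {s \<in> S. r (\<delta> s) = 1}"
    have A: "A \<subseteq> S" "S - A = {s \<in> S. r (\<delta> s) = 2}" using r12 \<delta>_in by (auto simp: A_def)
    define d where "d = (A, compose A \<gamma>1 (restrict \<delta> A), compose (S - A) \<gamma>2 (restrict \<delta> (S - A)))"
    have "d \<in> E"
      using transport[OF \<gamma>1 a, folded A_def] transport[OF \<gamma>2 b, folded A(2)] A(1)
      unfolding d_def E_def by blast
    \<comment> \<open>The comparison isomorphism itself serves as the arrow to the listed
      object.\<close>
    moreover have "\<gamma> \<in> hom ?F x (e d)"
    proof -
      have "q A (\<gamma> t) = r t" if "t \<in> T" for t
        using r12[OF that] \<gamma>_in[OF that] \<delta>\<gamma>[OF that] by (auto simp: q_def A_def)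
      then have "\<gamma> \<in> hom (part_level R 2) (T, Y, r) (S, X, q A)" using \<gamma> by simp
      moreover have "compose T (\<lambda>s\<in>S. s) (restrict \<gamma> T) = \<gamma>"
        using struct_isosD(6)[OF \<gamma>] \<gamma>_in by (auto simp: compose_def fun_eq_iff split: if_splits)
      moreover have "compose {t \<in> T. r t = 1} (compose A \<gamma>1 (restrict \<delta> A)) (restrict \<gamma> {t \<in> T. r t = 1}) = \<gamma>1"
        using \<gamma>1 \<gamma>_in \<delta>\<gamma>
        by (cases a) (auto simp: compose_def fun_eq_iff A_def struct_isos_def PiE_def extensional_def)
      moreover have "compose {t \<in> T. r t = 2} (compose (S - A) \<gamma>2 (restrict \<delta> (S - A))) (restrict \<gamma> {t \<in> T. r t = 2}) = \<gamma>2"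
        using \<gamma>2 \<gamma>_in \<delta>\<gamma> unfolding A(2)
        by (cases b) (auto simp: compose_def fun_eq_iff struct_isos_def PiE_def extensional_def)
      ultimately show ?thesis
        unfolding x' e_def d_def case_prod_conv fibre3_simps(2)[OF r q] by blast
    qed
    ultimately show ?thesis by blast
  qed
  \<comment> \<open>Between listed objects both comparisons are identities, so an arrow fixes S
    pointwise; this forces equal subsets and equal isomorphisms on them.\<close>
  have separate: "d = d'" if d: "d \<in> E" "d' \<in> E" and h: "hom ?F (e d) (e d') \<noteq> {}" for d d'
  proof -
    obtain A \<gamma>1 \<gamma>2 A' \<gamma>1' \<gamma>2' where d': "d = (A, \<gamma>1, \<gamma>2)" "d' = (A', \<gamma>1', \<gamma>2')" by (metis prod_cases3)
    have A: "A \<subseteq> S" "A' \<subseteq> S" using d by (auto simp: d' E_def)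
    obtain m where "m \<in> hom ?F (e d) (e d')" using h by blast
    then have m: "m \<in> hom (part_level R 2) (S, X, q A) (S, X, q A')"
        "compose S (\<lambda>s\<in>S. s) (restrict m S) = (\<lambda>s\<in>S. s)"
        "compose A \<gamma>1' (restrict m A) = \<gamma>1" "compose (S - A) \<gamma>2' (restrict m (S - A)) = \<gamma>2"
      unfolding d' e_def case_prod_conv fibre3_simps(2)[OF q q] parts[OF A(1)] by blast+
    have ms: "m s = s" if "s \<in> S" for s
      using fun_cong[OF m(2), of s] that m(1) struct_isosD(5)[of m R S X S X s]
      by (simp add: compose_def)
    then have "q A' s = q A s" if "s \<in> S" for s using m(1) that by simp
    then have "{s \<in> S. q A s = 1} = {s \<in> S. q A' s = 1}" by auto
    then have "A = A'" unfolding parts(1)[OF A(1)] parts(1)[OF A(2)] .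
    have same: "\<gamma>' = \<gamma>"
      if "\<gamma>' \<in> struct_isos R (B, Z) c" "compose B \<gamma>' (restrict m B) = \<gamma>" "B \<subseteq> S" for B Z c and \<gamma> \<gamma>' :: "'a \<Rightarrow> 'a"
    proof (rule extensionalityI)
      show "\<gamma>' \<in> extensional B" using that(1) by (cases c) (auto simp: struct_isos_def PiE_def)
      show "\<gamma> \<in> extensional B" using that(2) by (auto simp: compose_def)
      fix s assume "s \<in> B"
      then show "\<gamma>' s = \<gamma> s" using fun_cong[OF that(2), of s] ms[of s] that(3) by (auto simp: compose_def)
    qed
    have "\<gamma>1' \<in> struct_isos R (A', restr R S X A') a" "\<gamma>2' \<in> struct_isos R (S - A', restr R S X (S - A')) b"
      using d(2) unfolding d' E_def by blast+
    then have "\<gamma>1' = \<gamma>1" "\<gamma>2' = \<gamma>2"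
      using same m(3,4) A(1) unfolding \<open>A = A'\<close> by blast+
    with \<open>A = A'\<close> show ?thesis by (simp add: d')
  qed
  \<comment> \<open>Equal images are joined by an identity arrow, so injectivity is an instance of
    \<open>separate\<close>.\<close>
  have inj: "inj_on e E"
  proof (rule inj_onI)
    fix d d' assume d: "d \<in> E" "d' \<in> E" "e d = e d'"
    then have "e d \<in> ob ?F" using e_ob by blast
    from F.ide_closed[OF this] have "ide ?F (e d) \<in> hom ?F (e d) (e d')" by (simp only: d(3))
    then show "d = d'" using separate d by blast
  qed
  have "groupoid_card ?F = of_nat (card (pi0 ?F))"
    by (rule F.groupoid_card_discrete[OF discrete])
  also have "card (pi0 ?F) = card (e ` E)"
  proof (rule bij_betw_same_card[symmetric, OF F.bij_betw_pi0[OF e_ob reach]])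
    fix x y assume "x \<in> e ` E" "y \<in> e ` E" and h: "hom ?F x y \<noteq> {}"
    then obtain d d' where "d \<in> E" "d' \<in> E" "x = e d" "y = e d'" by (elim imageE)
    with h separate[of d d'] show "x = y" by simp
  qed
  also have "\<dots> = card E" by (rule card_image[OF inj])
  also have "\<dots> = (\<Sum>A\<in>Pow S. card (struct_isos R (A, restr R S X A) a \<times>
      struct_isos R (S - A, restr R S X (S - A)) b))"
    unfolding E_def
    by (rule card_SigmaI; cases a; cases b)
      (use S(1) a b in \<open>auto intro!: finite_cartesian_product finite_struct_isos intro: finite_subset\<close>)
  finally show ?thesis by (simp add: card_cartesian_product)
qed

section \<open>Incidence coefficients\<close>

lemma part_class_in_pi0: "\<lbrakk>finite S; X \<in> strs R S\<rbrakk> \<Longrightarrow> part_class R (S, X) \<in> pi0 (part_level R 1)"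
  unfolding pi0_level_1 by (rule imageI) simp

lemma rep_part_class:
  assumes "c \<in> pi0 (part_level R 1)"
  obtains S X where "finite S" "X \<in> strs R S" "rep c = trivial_part (S, X)" "part_class R (S, X) = c"
proof -
  interpret groupoid "part_level R 1" by (rule groupoid_part_level)
  obtain x where "x \<in> ob (structures R)" "rep c = trivial_part x"
    using rep_in_ob[OF assms] unfolding ob_level_1 by blast
  moreover have "part_class R x = c"
    using class_rep[OF assms] calculation(2) by (simp add: part_class_def)
  ultimately show thesis using that by (cases x) auto
qed

text \<open>Coefficients are evaluated at the representative chosen by \<open>rep\<close>, here (T,
  Y), instead of (S, X). An isomorphism induces a bijection of splittings, and \<open>k\<close>
  stands for any invariant of the two halves.\<close>

lemma sum_splittings_cong:
  assumes S: "finite S" "X \<in> strs R S" and T: "finite T" "Y \<in> strs R T"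
    and f: "f \<in> struct_isos R (S, X) (T, Y)"
    and k: "\<And>x y. \<lbrakk>x \<in> ob (structures R); y \<in> ob (structures R); struct_isos R x y \<noteq> {}\<rbrakk> \<Longrightarrow> k x = k y"
  shows "(\<Sum>A\<in>Pow S. g (k (A, restr R S X A)) (k (S - A, restr R S X (S - A)))) =
    (\<Sum>B\<in>Pow T. g (k (B, restr R T Y B)) (k (T - B, restr R T Y (T - B))))"
proof -
  have bij: "bij_betw f S T" using struct_isosD(1)[OF f] .
  have k': "k (A, restr R S X A) = k (f ` A, restr R T Y (f ` A))" if "A \<subseteq> S" for A
  proof (rule k)
    have "finite A" "f ` A \<subseteq> T" using that S(1) struct_isosD(4)[OF f] finite_subset by auto
    then show "(A, restr R S X A) \<in> ob (structures R)" "(f ` A, restr R T Y (f ` A)) \<in> ob (structures R)"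
      using S T that by (auto intro: restr_closed)
    show "struct_isos R (A, restr R S X A) (f ` A, restr R T Y (f ` A)) \<noteq> {}"
      using restrict_struct_iso[OF S(1) T f that] by blast
  qed
  have diff: "f ` (S - A) = T - f ` A" if "A \<subseteq> S" for A
    using bij that by (auto simp: bij_betw_def inj_on_def)
  have "(\<Sum>A\<in>Pow S. g (k (A, restr R S X A)) (k (S - A, restr R S X (S - A)))) =
      (\<Sum>A\<in>Pow S. g (k (f ` A, restr R T Y (f ` A))) (k (T - f ` A, restr R T Y (T - f ` A))))"
  proof (intro sum.cong refl)
    fix A assume "A \<in> Pow S"
    then show "g (k (A, restr R S X A)) (k (S - A, restr R S X (S - A))) =
        g (k (f ` A, restr R T Y (f ` A))) (k (T - f ` A, restr R T Y (T - f ` A)))"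
      using k'[of A] k'[of "S - A"] diff[of A] by simp
  qed
  also have "\<dots> = (\<Sum>B\<in>Pow T. g (k (B, restr R T Y B)) (k (T - B, restr R T Y (T - B))))"
    by (rule sum.reindex_bij_betw[OF bij_betw_Pow[OF bij],
          where g = "\<lambda>B. g (k (B, restr R T Y B)) (k (T - B, restr R T Y (T - B)))"])
  finally show ?thesis .
qed

lemma incidence_coeff_part_class:
  assumes "finite S" "X \<in> strs R S"
  shows "incidence_coeff (species_simplicial R) (part_class R (S, X)) =
    (\<lambda>z. \<Sum>A\<in>Pow S. delta (part_class R (A, restr R S X A), part_class R (S - A, restr R S X (S - A))) z)"
proof
  fix z :: "('a, 'r) part_struct set \<times> ('a, 'r) part_struct set"
  obtain a b where z: "z = (a, b)" by (cases z)
  interpret groupoid "part_level R 1" by (rule groupoid_part_level)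
  have in_pi0: "part_class R (A, restr R S X A) \<in> pi0 (part_level R 1)" if "A \<subseteq> S" for A
    using assms that finite_subset by (intro part_class_in_pi0) (auto intro: restr_closed)
  show "incidence_coeff (species_simplicial R) (part_class R (S, X)) z =
      (\<Sum>A\<in>Pow S. delta (part_class R (A, restr R S X A), part_class R (S - A, restr R S X (S - A))) z)"
  proof (cases "a \<in> pi0 (part_level R 1) \<and> b \<in> pi0 (part_level R 1)")
    case False
    \<comment> \<open>The coefficient is cut off to 0 outside the basis; no splitting contributes
      there because restrictions always have classes in \<open>pi0\<close>.\<close>
    have "(\<Sum>A\<in>Pow S. delta (part_class R (A, restr R S X A), part_class R (S - A, restr R S X (S - A))) z) = 0"
      using False in_pi0 by (intro sum.neutral ballI) (force simp: z delta_def)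
    moreover have "incidence_coeff (species_simplicial R) (part_class R (S, X)) z = 0"
      using False unfolding incidence_coeff_def z species_simplicial_simps by auto
    ultimately show ?thesis by simp
  next
    case True
    obtain Sa Xa where a: "finite Sa" "Xa \<in> strs R Sa" "rep a = trivial_part (Sa, Xa)" "part_class R (Sa, Xa) = a"
      using rep_part_class True by blast
    obtain Sb Xb where b: "finite Sb" "Xb \<in> strs R Sb" "rep b = trivial_part (Sb, Xb)" "part_class R (Sb, Xb) = b"
      using rep_part_class True by blast
    obtain T Y where T: "finite T" "Y \<in> strs R T" "rep (part_class R (S, X)) = trivial_part (T, Y)"
      "part_class R (T, Y) = part_class R (S, X)"
      using rep_part_class part_class_in_pi0[OF assms] by blast
    obtain f where f: "f \<in> struct_isos R (T, Y) (S, X)"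
      using T part_class_eq_iff[of "(T, Y)" "(S, X)"] assms by auto
    define Na Nb where "Na = card (struct_isos R (Sa, Xa) (Sa, Xa))" and "Nb = card (struct_isos R (Sb, Xb) (Sb, Xb))"
    \<comment> \<open>Identities make the automorphism groups nonempty. Positivity is essential for
      the cancellation, since division by 0 yields 0.\<close>
    have pos: "Na \<noteq> 0" "Nb \<noteq> 0"
      using ide_closed[of "trivial_part (Sa, Xa)"] ide_closed[of "trivial_part (Sb, Xb)"] a b
      by (auto simp: Na_def Nb_def finite_struct_isos card_eq_0_iff)
    have "groupoid_card (component (part_level R 1) a) = 1 / of_nat Na"
      "groupoid_card (component (part_level R 1) b) = 1 / of_nat Nb"
      using groupoid_card_component True unfolding Na_def Nb_def a(3) b(3) hom_trivial_part[symmetric]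
      by (auto simp: a(3) b(3))
    then have "incidence_coeff (species_simplicial R) (part_class R (S, X)) z =
        1 / of_nat Na * (1 / of_nat Nb) * of_nat (\<Sum>A\<in>Pow T. card (struct_isos R (A, restr R T Y A) (Sa, Xa)) *
          card (struct_isos R (T - A, restr R T Y (T - A)) (Sb, Xb)))"
      using True a b groupoid_card_fibre3[OF T(1,2), of "(Sa, Xa)" "(Sb, Xb)"]
      unfolding incidence_coeff_def z species_simplicial_simps case_prod_conv T(3) a(3) b(3) by simp
    also have "\<dots> = (\<Sum>A\<in>Pow T. 1 / of_nat Na * (1 / of_nat Nb) *
        of_nat (card (struct_isos R (A, restr R T Y A) (Sa, Xa)) *
          card (struct_isos R (T - A, restr R T Y (T - A)) (Sb, Xb))))"
      by (simp only: of_nat_sum sum_distrib_left)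
    also have "\<dots> = (\<Sum>A\<in>Pow T. delta (part_class R (A, restr R T Y A), part_class R (T - A, restr R T Y (T - A))) z)"
    proof (intro sum.cong refl)
      fix A assume "A \<in> Pow T"
      then have "finite A" "A \<subseteq> T" using T(1) finite_subset by auto
      then have ob: "(A, restr R T Y A) \<in> ob (structures R)" "(T - A, restr R T Y (T - A)) \<in> ob (structures R)"
        using T(1,2) by (auto intro: restr_closed)
      have "card (struct_isos R (A, restr R T Y A) (Sa, Xa)) = (if part_class R (A, restr R T Y A) = a then Na else 0)"
        "card (struct_isos R (T - A, restr R T Y (T - A)) (Sb, Xb)) =
          (if part_class R (T - A, restr R T Y (T - A)) = b then Nb else 0)"
        using card_hom_part_class[OF ob(1), of "(Sa, Xa)"] card_hom_part_class[OF ob(2), of "(Sb, Xb)"]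
        unfolding Na_def Nb_def a(4) b(4) using a(1,2) b(1,2) by simp_all
      then show "1 / of_nat Na * (1 / of_nat Nb) * of_nat (card (struct_isos R (A, restr R T Y A) (Sa, Xa)) *
          card (struct_isos R (T - A, restr R T Y (T - A)) (Sb, Xb))) =
          delta (part_class R (A, restr R T Y A), part_class R (T - A, restr R T Y (T - A))) z"
        using pos by (auto simp: z delta_def)
    qed
    also have "\<dots> = (\<Sum>A\<in>Pow S. delta (part_class R (A, restr R S X A), part_class R (S - A, restr R S X (S - A))) z)"
      by (rule sum_splittings_cong[OF T(1,2) assms f, where g = "\<lambda>x y. delta (x, y) z"])
        (simp add: part_class_eq_iff)
    finally show ?thesis .
  qed
qed

section \<open>The counit and the finiteness conditions\<close>

lemma groupoid_functor_degeneracy: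
  "groupoid_functor (part_level R 0) (part_level R 1) (degeneracy (species_simplicial R) 0 0)"
  unfolding degeneracy_def species_simplicial_simps
  using groupoid_functor_part_act[OF codegeneracy_in_Delta[of 0 0]] by simp

text \<open>A partition into zero parts exists only on the empty set, whose only extensional
  function is \<open>\<lambda>_. undefined\<close>. The comparison is then the empty map, along
  which pulling back is the identity, so the structure must be \<open>X\<close> itself.\<close>

lemma ob_fibre_degeneracy:
  assumes "finite S" "X \<in> strs R S"
  shows "ob (homotopy_fibre (part_level R 0) (part_level R 1) (degeneracy (species_simplicial R) 0 0)
      (trivial_part (S, X))) = (if S = {} then {(({}, X, \<lambda>_. undefined), \<lambda>_. undefined)} else {})"
proof -
  have deg: "on_ob (degeneracy (species_simplicial R) 0 0) ({}, Y, \<lambda>_. undefined) = trivial_part ({}, Y)"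
    if "Y \<in> strs R {}" for Y
    using degeneracy_empty_part[of "{}" Y "\<lambda>_. undefined" 0 0] that by (simp add: trivial_part_def restrict_def)
  have ob0: "(T, Y, q) \<in> ob (part_level R 0) \<longleftrightarrow> T = {} \<and> Y \<in> strs R {} \<and> q = (\<lambda>_. undefined)" for T Y q
    by (cases "T = {}") (auto simp: PiE_eq_empty_iff)
  have iso: "\<gamma> \<in> struct_isos R ({}, Y) (S, X) \<longleftrightarrow> S = {} \<and> X = Y \<and> \<gamma> = (\<lambda>_. undefined)" for Y \<gamma>
    using pull_id[of "{}" X] assms by (auto simp: struct_isos_def bij_betw_def restrict_def)
  have key: "((T, Y, q), \<gamma>) \<in> ob (homotopy_fibre (part_level R 0) (part_level R 1)
      (degeneracy (species_simplicial R) 0 0) (trivial_part (S, X))) \<longleftrightarrow>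
      S = {} \<and> T = {} \<and> Y = X \<and> q = (\<lambda>_. undefined) \<and> \<gamma> = (\<lambda>_. undefined)" for T Y q \<gamma>
  proof (cases "(T, Y, q) \<in> ob (part_level R 0)")
    case True
    then show ?thesis unfolding homotopy_fibre_simps by (auto simp: ob0 deg iso simp del: part_level_simps)
  next
    case False
    then show ?thesis using assms unfolding homotopy_fibre_simps ob0 by auto
  qed
  show ?thesis
  proof (rule set_eqI)
    fix x :: "('a, 'r) part_struct \<times> ('a \<Rightarrow> 'a)"
    obtain T Y q \<gamma> where x: "x = ((T, Y, q), \<gamma>)" by (metis prod_cases3 surj_pair)
    show "x \<in> ob (homotopy_fibre (part_level R 0) (part_level R 1) (degeneracy (species_simplicial R) 0 0)
        (trivial_part (S, X))) \<longleftrightarrow> x \<in> (if S = {} then {(({}, X, \<lambda>_. undefined), \<lambda>_. undefined)} else {})"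
      unfolding x key by auto
  qed
qed

lemma groupoid_card_fibre_degeneracy:
  assumes "finite S" "X \<in> strs R S"
  shows "groupoid_card (homotopy_fibre (part_level R 0) (part_level R 1)
    (degeneracy (species_simplicial R) 0 0) (trivial_part (S, X))) = (if S = {} then 1 else 0)"
proof -
  let ?F = "homotopy_fibre (part_level R 0) (part_level R 1) (degeneracy (species_simplicial R) 0 0)
    (trivial_part (S, X))"
  interpret groupoid ?F
    using assms by (intro groupoid_homotopy_fibre groupoid_functor_degeneracy) simp
  have "groupoid_card ?F = of_nat (card (pi0 ?F))"
  proof (rule groupoid_card_discrete)
    fix x f g assume x: "x \<in> ob ?F" and fg: "f \<in> hom ?F x x" "g \<in> hom ?F x x"
    then have "x = (({}, X, \<lambda>_. undefined), \<lambda>_. undefined)"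
      unfolding ob_fibre_degeneracy[OF assms] by (auto split: if_splits)
    then show "f = g" using fg by (auto simp: struct_isos_def)
  qed
  also have "card (pi0 ?F) = (if S = {} then 1 else 0)"
    unfolding pi0_eq_class_image ob_fibre_degeneracy[OF assms] by simp
  finally show ?thesis by simp
qed

lemma finiteness_conditions_species: "finiteness_conditions (species_simplicial R)"
proof -
  have level_1: "\<exists>S X. finite S \<and> X \<in> strs R S \<and> f = trivial_part (S, X)" if f: "f \<in> ob (part_level R 1)" for f
  proof -
    obtain x where "x \<in> ob (structures R)" "f = trivial_part x" using f unfolding ob_level_1 by blast
    then show ?thesis by (intro exI[of _ "fst x"] exI[of _ "snd x"]) (cases x, simp)
  qed
  have finite_hom: "finite (hom (part_level R k) x x)" if "x \<in> ob (part_level R k)" for k x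
  proof -
    obtain S X p where x: "x = (S, X, p)" by (cases x)
    have "finite S" using that by (simp add: x)
    then show ?thesis
      by (intro finite_subset[OF _ finite_struct_isos[of S S R X X]]) (auto simp: x)
  qed
  \<comment> \<open>Arrows of a fibre are arrows of the total groupoid with an additional
    condition.\<close>
  have fibre_hom: "finite (hom (homotopy_fibre (part_level R k) H F y) x x)"
    if "x \<in> ob (homotopy_fibre (part_level R k) H F y)" for k x y and H :: "('o, 'm) category" and F
  proof -
    obtain u \<gamma> where x: "x = (u, \<gamma>)" by (cases x)
    then have "u \<in> ob (part_level R k)" using that by simp
    then show ?thesis by (intro finite_subset[OF _ finite_hom]) (auto simp: x)
  qed
  have face: "finite (pi0 (homotopy_fibre (part_level R 2) (part_level R 1)
      (face (species_simplicial R) 1 1) (trivial_part (S, X))))" (is "finite (pi0 ?F)")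
    if S: "finite S" "X \<in> strs R S" for S X
  proof -
    interpret groupoid ?F
      using S by (intro groupoid_homotopy_fibre groupoid_functor_face) simp
    \<comment> \<open>The partitions of S into two parts, with the identity as comparison: a finite
      set meeting every component.\<close>
    let ?D = "(\<lambda>q. ((S, X, q), \<lambda>s\<in>S. s)) ` (S \<rightarrow>\<^sub>E {1..2::nat})"
    have id: "(\<lambda>s\<in>S. s) \<in> struct_isos R (S, X) (S, X)"
      using S by (auto simp: struct_isos_def pull_id bij_betw_def inj_on_def)
    show ?thesis
    proof (rule finite_pi0)
      show "finite ?D" using S by (auto intro: finite_PiE)
      show "?D \<subseteq> ob ?F"
      proof clarify
        fix q assume q: "q \<in> S \<rightarrow>\<^sub>E {1..2::nat}"
        then have q': "(S, X, q) \<in> ob (part_level R 2)" using S by simp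
        show "((S, X, q), \<lambda>s\<in>S. s) \<in> ob ?F"
          unfolding homotopy_fibre_simps face_simps[OF q'] hom_trivial_part using q' id by blast
      qed
      fix x assume x: "x \<in> ob ?F"
      obtain T Y r \<gamma> where x': "x = ((T, Y, r), \<gamma>)" by (metis prod_cases3 surj_pair)
      have r: "(T, Y, r) \<in> ob (part_level R 2)" using x unfolding x' homotopy_fibre_simps by blast
      have \<gamma>: "\<gamma> \<in> struct_isos R (T, Y) (S, X)"
        using x unfolding x' homotopy_fibre_simps face_simps[OF r] hom_trivial_part by blast
      obtain \<delta> where \<delta>: "\<delta> \<in> struct_isos R (S, X) (T, Y)" "compose T \<delta> \<gamma> = (\<lambda>s\<in>T. s)"
        using struct_isos_inverse[OF _ S \<gamma>] r by auto
      note t = transport_part[OF r S \<gamma> \<delta>]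
      have "compose T (\<lambda>s\<in>S. s) (restrict \<gamma> T) = \<gamma>"
        using struct_isosD(6)[OF \<gamma>] struct_isosD(5)[OF \<gamma>]
        by (auto simp: compose_def fun_eq_iff split: if_splits)
      then have "\<gamma> \<in> hom ?F x ((S, X, \<lambda>s\<in>S. r (\<delta> s)), \<lambda>s\<in>S. s)"
        unfolding x' homotopy_fibre_simps face_simps[OF r] face_simps[OF t(1)] cmp_trivial_part using t(2) by blast
      then show "\<exists>d\<in>?D. hom ?F x d \<noteq> {}" using t(1) by (intro bexI[OF _ imageI]) auto
    qed
  qed
  have degeneracy: "finite (pi0 (homotopy_fibre (part_level R 0) (part_level R 1)
      (degeneracy (species_simplicial R) 0 0) (trivial_part (S, X))))"
    if S: "finite S" "X \<in> strs R S" for S X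
    unfolding pi0_def quotient_def ob_fibre_degeneracy[OF S] by simp
  show ?thesis
    unfolding finiteness_conditions_def finite_groupoid_def species_simplicial_simps
  proof (intro conjI ballI)
    fix f assume f: "f \<in> ob (part_level R 1)"
    then show "finite (hom (part_level R 1) f f)" by (rule finite_hom)
    obtain S X where S: "finite S" "X \<in> strs R S" "f = trivial_part (S, X)" using level_1[OF f] by blast
    show "finite (pi0 (homotopy_fibre (part_level R 2) (part_level R 1) (face (species_simplicial R) 1 1) f))"
      unfolding S(3) by (rule face[OF S(1,2)])
    show "finite (pi0 (homotopy_fibre (part_level R 0) (part_level R 1) (degeneracy (species_simplicial R) 0 0) f))"
      unfolding S(3) by (rule degeneracy[OF S(1,2)])
  qed (rule fibre_hom; assumption)+
qed

section \<open>The two coalgebras of a species and their comparison\<close>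

lemma splitting_coalgebra_schmitt:
  "splitting_coalgebra R (schmitt_coalgebra R) (struct_class R) (\<lambda>c. schmitt_comult R (rep c))
    (\<lambda>c. schmitt_counit (rep c))"
proof unfold_locales
  show "basis (schmitt_coalgebra R) = struct_class R ` ob (structures R)"
    by (simp add: schmitt_coalgebra_def pi0_structures)
  show "comult (schmitt_coalgebra R) = linear_ext (\<lambda>c. schmitt_comult R (rep c))"
    "counit (schmitt_coalgebra R) = functional_ext (\<lambda>c. schmitt_counit (rep c))"
    by (simp_all add: schmitt_coalgebra_def)
  fix S X assume S: "finite S" "X \<in> strs R S"
  show "schmitt_counit (rep (struct_class R (S, X))) = (if S = {} then 1 else 0)"
    using counit_delta_struct_class[OF S] by (simp add: schmitt_coalgebra_def)
  have "schmitt_comult R (rep (struct_class R (S, X))) z =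
      (\<Sum>(A, B)\<in>{(A, B). A \<union> B = S \<and> A \<inter> B = {}}.
        delta (struct_class R (A, restr R S X A), struct_class R (B, restr R S X B)) z)" for z
    using fun_cong[OF comult_delta_struct_class[OF S], of z] by (simp add: schmitt_coalgebra_def)
  \<comment> \<open>An ordered pair of complementary subsets is determined by its first
    member.\<close>
  also have "\<dots> z = (\<Sum>A\<in>Pow S. delta (struct_class R (A, restr R S X A),
      struct_class R (S - A, restr R S X (S - A))) z)" for z
  proof (rule sum.reindex_bij_witness[where i = "\<lambda>A. (A, S - A)" and j = fst], goal_cases)
    case (5 x)
    then have "S - fst x = snd x" by auto
    then show ?case by (simp add: split_def)
  qed auto
  finally show "schmitt_comult R (rep (struct_class R (S, X))) =
      (\<lambda>z. \<Sum>A\<in>Pow S. delta (struct_class R (A, restr R S X A),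
        struct_class R (S - A, restr R S X (S - A))) z)" by blast
qed

lemma splitting_coalgebra_incidence:
  "splitting_coalgebra R (incidence_coalgebra (species_simplicial R)) (part_class R)
    (incidence_coeff (species_simplicial R))
    (\<lambda>f. groupoid_card (homotopy_fibre (part_level R 0) (part_level R 1)
      (degeneracy (species_simplicial R) 0 0) (rep f)))"
proof unfold_locales
  show "basis (incidence_coalgebra (species_simplicial R)) = part_class R ` ob (structures R)"
    unfolding incidence_coalgebra_def species_simplicial_simps pi0_level_1 by simp
  show "comult (incidence_coalgebra (species_simplicial R)) = linear_ext (incidence_coeff (species_simplicial R))"
    "counit (incidence_coalgebra (species_simplicial R)) = functional_ext (\<lambda>f. groupoid_card
      (homotopy_fibre (part_level R 0) (part_level R 1) (degeneracy (species_simplicial R) 0 0) (rep f)))"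
    by (simp_all add: incidence_coalgebra_def)
  fix S X assume S: "finite S" "X \<in> strs R S"
  show "incidence_coeff (species_simplicial R) (part_class R (S, X)) =
      (\<lambda>z. \<Sum>A\<in>Pow S. delta (part_class R (A, restr R S X A), part_class R (S - A, restr R S X (S - A))) z)"
    by (rule incidence_coeff_part_class[OF S])
  obtain T Y where T: "finite T" "Y \<in> strs R T" "rep (part_class R (S, X)) = trivial_part (T, Y)"
    "part_class R (T, Y) = part_class R (S, X)"
    using rep_part_class part_class_in_pi0[OF S] by blast
  obtain f where "f \<in> struct_isos R (T, Y) (S, X)"
    using T part_class_eq_iff[of "(T, Y)" "(S, X)"] S by auto
  \<comment> \<open>The counit is evaluated at the chosen representative, whose underlying set is
    empty together with S.\<close>
  from struct_isosD(4)[OF this] have "T = {} \<longleftrightarrow> S = {}" by auto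
  then show "groupoid_card (homotopy_fibre (part_level R 0) (part_level R 1)
      (degeneracy (species_simplicial R) 0 0) (rep (part_class R (S, X)))) = (if S = {} then 1 else 0)"
    unfolding T(3) groupoid_card_fibre_degeneracy[OF T(1,2)] by simp
qed

lemma iso_relD:
  assumes "((S, X), y) \<in> iso_rel (structures R)"
  obtains T Y f where "y = (T, Y)" "finite S" "X \<in> strs R S" "finite T" "Y \<in> strs R T"
    "f \<in> struct_isos R (S, X) (T, Y)"
  using assms by (cases y) (auto simp: iso_rel_def)

lemma iso_rel_structures_refl:
  assumes "finite S" "X \<in> strs R S"
  shows "((S, X), (S, X)) \<in> iso_rel (structures R)"
proof -
  interpret groupoid "structures R" by (rule groupoid_structures)
  show ?thesis using ide_closed[of "(S, X)"] assms by (auto simp: iso_rel_def)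
qed

lemma pi0_map_trivial_part:
  assumes "finite S" "X \<in> strs R S"
  shows "pi0_map (part_level R 1) \<lparr>on_ob = (\<lambda>(S, X). (S, X, \<lambda>s\<in>S. 1)), on_hom = (\<lambda>x y f. f)\<rparr>
    (struct_class R (S, X)) = part_class R (S, X)"
proof -
  interpret groupoid "part_level R 1" by (rule groupoid_part_level)
  define F :: "('a set \<times> 'r, 'a \<Rightarrow> 'a, ('a, 'r) part_struct, 'a \<Rightarrow> 'a) fctr"
    where "F = \<lparr>on_ob = trivial_part, on_hom = (\<lambda>x y f. f)\<rparr>"
  have "pi0_map (part_level R 1) F (struct_class R (S, X)) = iso_rel (part_level R 1) `` {on_ob F (S, X)}"
    unfolding struct_class_def
  proof (rule pi0_map_class)
    fix y assume "((S, X), y) \<in> iso_rel (structures R)"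
    then show "hom (part_level R 1) (on_ob F (S, X)) (on_ob F y) \<noteq> {} \<and> on_ob F y \<in> ob (part_level R 1)"
      by (rule iso_relD) (auto simp: F_def)
  qed (rule iso_rel_structures_refl[OF assms])
  then show ?thesis by (simp add: F_def part_class_def trivial_part_def)
qed

lemma coalgebra_iso_schmitt_to_incidence:
  "coalgebra_iso (schmitt_coalgebra R) (incidence_coalgebra (species_simplicial R)) (schmitt_to_incidence R)"
proof -
  define h :: "('a set \<times> 'r) set \<Rightarrow> ('a, 'r) part_struct set" where
    "h = pi0_map (part_level R 1) \<lparr>on_ob = (\<lambda>(S, X). (S, X, \<lambda>s\<in>S. 1)), on_hom = (\<lambda>x y f. f)\<rparr>"
  have h: "h (struct_class R (S, X)) = part_class R (S, X)" if "finite S" "X \<in> strs R S" for S X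
    unfolding h_def by (rule pi0_map_trivial_part[OF that])
  have eq: "schmitt_to_incidence R = linear_ext (\<lambda>c. delta (h c))"
    by (simp add: schmitt_to_incidence_def h_def)
  \<comment> \<open>The comparison lies over the identity morphism of \<open>R\<close>, so
    \<open>splitting_coalgebra_hom\<close> applies to it.\<close>
  have "restriction_species_morphism R R (\<lambda>S X. X)"
    by unfold_locales (simp add: species_morphism_def)
  then have hom: "coalgebra_hom (schmitt_coalgebra R) (incidence_coalgebra (species_simplicial R)) (schmitt_to_incidence R)"
    unfolding eq
    by (rule splitting_coalgebra_hom[OF splitting_coalgebra_schmitt splitting_coalgebra_incidence _ h])
  have "bij_betw h (pi0 (structures R)) (pi0 (part_level R 1))"
  proof (rule bij_betw_imageI)
    have h': "h (struct_class R x) = part_class R x" if "x \<in> ob (structures R)" for x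
      using h that by (cases x) simp
    \<comment> \<open>Both notions of class identify exactly the isomorphic structures, since the
      trivial partition imposes no condition on isomorphisms.\<close>
    show "inj_on h (pi0 (structures R))"
      unfolding pi0_structures
      by (rule inj_onI, elim imageE) (simp add: h' part_class_eq_iff struct_class_eq_iff)
    show "h ` pi0 (structures R) = pi0 (part_level R 1)"
      unfolding pi0_structures pi0_level_1 image_image by (rule image_cong[OF refl h'])
  qed
  then have "bij_betw (schmitt_to_incidence R) (free_space (basis (schmitt_coalgebra R)))
      (free_space (basis (incidence_coalgebra (species_simplicial R))))"
    unfolding eq schmitt_coalgebra_def incidence_coalgebra_def species_simplicial_simps coalg.simps
    by (rule bij_betw_linear_ext_delta)
  with hom show ?thesis by (simp add: coalgebra_iso_def coalgebra_iso_axioms_def)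
qed

end

section \<open>Functoriality in the species\<close>

context restriction_species_morphism
begin

lemma pi0_map_structures:
  assumes "finite S" "X \<in> strs R S"
  shows "pi0_map (structures R') \<lparr>on_ob = (\<lambda>(S, X). (S, \<alpha> S X)), on_hom = (\<lambda>x y f. f)\<rparr>
    (struct_class R (S, X)) = struct_class R' (S, \<alpha> S X)"
proof -
  interpret groupoid "structures R'" by (rule cod.groupoid_structures)
  define F :: "('a set \<times> 'r, 'a \<Rightarrow> 'a, 'a set \<times> 's, 'a \<Rightarrow> 'a) fctr"
    where "F = \<lparr>on_ob = (\<lambda>(S, X). (S, \<alpha> S X)), on_hom = (\<lambda>x y f. f)\<rparr>"
  have "pi0_map (structures R') F (struct_class R (S, X)) = iso_rel (structures R') `` {on_ob F (S, X)}"
    unfolding struct_class_def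
  proof (rule pi0_map_class)
    fix y assume "((S, X), y) \<in> iso_rel (structures R)"
    then show "hom (structures R') (on_ob F (S, X)) (on_ob F y) \<noteq> {} \<and> on_ob F y \<in> ob (structures R')"
      by (rule dom.iso_relD) (auto simp: F_def dest: struct_isos_natural intro: closed)
  qed (rule dom.iso_rel_structures_refl[OF assms])
  then show ?thesis by (simp add: F_def struct_class_def)
qed

lemma pi0_map_species_functor:
  assumes "finite S" "X \<in> strs R S"
  shows "pi0_map (part_level R' 1) (species_functor \<alpha> 1) (part_class R (S, X)) = part_class R' (S, \<alpha> S X)"
proof -
  interpret groupoid "part_level R' 1" by (rule cod.groupoid_part_level)
  interpret F: groupoid_functor "part_level R 1" "part_level R' 1" "species_functor \<alpha> 1"
    by (rule groupoid_functor_species_functor)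
  have "pi0_map (part_level R' 1) (species_functor \<alpha> 1) (part_class R (S, X)) =
      iso_rel (part_level R' 1) `` {on_ob (species_functor \<alpha> 1) (trivial_part (S, X))}"
    unfolding part_class_def
  proof (rule pi0_map_class)
    fix y assume "(trivial_part (S, X), y) \<in> iso_rel (part_level R 1)"
    then show "hom (part_level R' 1) (on_ob (species_functor \<alpha> 1) (trivial_part (S, X)))
        (on_ob (species_functor \<alpha> 1) y) \<noteq> {} \<and> on_ob (species_functor \<alpha> 1) y \<in> ob (part_level R' 1)"
      unfolding iso_rel_def using F.on_hom_closed F.on_ob_closed by blast
  next
    show "(trivial_part (S, X), trivial_part (S, X)) \<in> iso_rel (part_level R 1)"
      unfolding iso_rel_def using F.dom.ide_closed[of "trivial_part (S, X)"] assms by auto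
  qed
  then show ?thesis by (simp add: part_class_def trivial_part_def)
qed

lemma coalgebra_hom_schmitt_map:
  "coalgebra_hom (schmitt_coalgebra R) (schmitt_coalgebra R') (schmitt_map R' \<alpha>)"
  unfolding schmitt_map_def
  by (rule splitting_coalgebra_hom[OF dom.splitting_coalgebra_schmitt cod.splitting_coalgebra_schmitt
        restriction_species_morphism_axioms pi0_map_structures])

lemma coalgebra_hom_cardinality_map:
  "coalgebra_hom (incidence_coalgebra (species_simplicial R)) (incidence_coalgebra (species_simplicial R'))
    (cardinality_map (species_simplicial R') (species_functor \<alpha>))"
  unfolding cardinality_map_def species_simplicial_simps
  by (rule splitting_coalgebra_hom[OF dom.splitting_coalgebra_incidence cod.splitting_coalgebra_incidence
        restriction_species_morphism_axioms pi0_map_species_functor])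

text \<open>All four maps are linear extensions of maps of classes. On the class of (S, X) both
  routes end at \<open>part_class R' (S, \<alpha> S X)\<close>.\<close>

lemma cardinality_map_schmitt_to_incidence:
  assumes "v \<in> free_space (basis (schmitt_coalgebra R))"
  shows "cardinality_map (species_simplicial R') (species_functor \<alpha>) (schmitt_to_incidence R v) =
    schmitt_to_incidence R' (schmitt_map R' \<alpha> v)"
  unfolding cardinality_map_def schmitt_to_incidence_def schmitt_map_def species_simplicial_simps
    linear_ext_delta_comp[OF free_space_finite[OF assms]]
proof (rule linear_ext_cong)
  interpret C: splitting_coalgebra R "schmitt_coalgebra R" "struct_class R" "\<lambda>c. schmitt_comult R (rep c)"
    "\<lambda>c. schmitt_counit (rep c)" by (rule dom.splitting_coalgebra_schmitt)
  fix c assume "c \<in> supp v"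
  then have "c \<in> basis (schmitt_coalgebra R)" using assms by (auto simp: free_space_def)
  then obtain S X where "finite S" "X \<in> strs R S" "c = struct_class R (S, X)" by (rule C.basisE)
  then show "delta (pi0_map (part_level R' 1) (species_functor \<alpha> 1)
      (pi0_map (part_level R 1) \<lparr>on_ob = (\<lambda>(S, X). (S, X, \<lambda>s\<in>S. 1)), on_hom = (\<lambda>x y f. f)\<rparr> c)) =
    delta (pi0_map (part_level R' 1) \<lparr>on_ob = (\<lambda>(S, X). (S, X, \<lambda>s\<in>S. 1)), on_hom = (\<lambda>x y f. f)\<rparr>
      (pi0_map (structures R') \<lparr>on_ob = (\<lambda>(S, X). (S, \<alpha> S X)), on_hom = (\<lambda>x y f. f)\<rparr> c))"
    by (simp only: pi0_map_species_functor pi0_map_structures dom.pi0_map_trivial_part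
        cod.pi0_map_trivial_part closed)
qed

end

theorem theorem6p1p3:
  fixes R :: "('a::infinite, 'r) species"
  assumes "restriction_species R"
  shows "decomposition_space (species_simplicial R) \<and>
    finiteness_conditions (species_simplicial R) \<and>
    coalgebra_iso (schmitt_coalgebra R) (incidence_coalgebra (species_simplicial R))
      (schmitt_to_incidence R) \<and>
    (\<forall>(R' :: ('a, 's) species) \<alpha>. restriction_species R' \<and> species_morphism R R' \<alpha> \<longrightarrow>
      simplicial_map (species_simplicial R) (species_simplicial R') (species_functor \<alpha>) \<and>
      conservative (species_simplicial R) (species_simplicial R') (species_functor \<alpha>) \<and>
      ULF (species_simplicial R) (species_simplicial R') (species_functor \<alpha>) \<and>
      coalgebra_hom (schmitt_coalgebra R) (schmitt_coalgebra R') (schmitt_map R' \<alpha>) \<and>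
      coalgebra_hom (incidence_coalgebra (species_simplicial R))
        (incidence_coalgebra (species_simplicial R'))
        (cardinality_map (species_simplicial R') (species_functor \<alpha>)) \<and>
      (\<forall>v \<in> free_space (basis (schmitt_coalgebra R)).
        cardinality_map (species_simplicial R') (species_functor \<alpha>) (schmitt_to_incidence R v) =
        schmitt_to_incidence R' (schmitt_map R' \<alpha> v)))"
proof -
  interpret restriction_species R by fact
  have "simplicial_map (species_simplicial R) (species_simplicial R') (species_functor \<alpha>) \<and>
      conservative (species_simplicial R) (species_simplicial R') (species_functor \<alpha>) \<and>
      ULF (species_simplicial R) (species_simplicial R') (species_functor \<alpha>) \<and>
      coalgebra_hom (schmitt_coalgebra R) (schmitt_coalgebra R') (schmitt_map R' \<alpha>) \<and>
      coalgebra_hom (incidence_coalgebra (species_simplicial R))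
        (incidence_coalgebra (species_simplicial R'))
        (cardinality_map (species_simplicial R') (species_functor \<alpha>)) \<and>
      (\<forall>v \<in> free_space (basis (schmitt_coalgebra R)).
        cardinality_map (species_simplicial R') (species_functor \<alpha>) (schmitt_to_incidence R v) =
        schmitt_to_incidence R' (schmitt_map R' \<alpha> v))"
    if "restriction_species R' \<and> species_morphism R R' \<alpha>" for R' :: "('a, 's) species" and \<alpha>
  proof -
    interpret restriction_species_morphism R R' \<alpha>
      using assms that by (simp add: restriction_species_morphism_def restriction_species_morphism_axioms_def)
    show ?thesis
      by (intro conjI ballI simplicial_map_species_functor conservative_species_functor ULF_species_functor
          coalgebra_hom_schmitt_map coalgebra_hom_cardinality_map cardinality_map_schmitt_to_incidence)
  qed
  then show ?thesis
    using decomposition_space_species finiteness_conditions_species coalgebra_iso_schmitt_to_incidence by blast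
qed

end
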